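(* Let $\mathcal L$ be a sublogic of classical first-order logic. (1) If $\mathcal L$ admits the rules $\to$E and $\forall$E, then $\mathrm{HE}(\mathcal L)$ is EXPTime hard. (2) If $\mathcal L$ admits the rule $\to$E, then $\mathrm{HE}(\mathcal L,0)$ is PTime hard. (3) If $\mathcal L$ admits the rules $\to$E and $\forall$E, then $\mathrm{HE}(\mathcal L,k)$ is PTime hard for every integer $k\ge 0$.
   Context: A logic $\mathcal L$ consists of a notion of formula and an entailment relation between sets of formulas and formulas which is reflexive, monotone, transitive and finitary. $\mathcal L$ is a sublogic of classical first-order logic if its formulas are first-order formulas (built from atomic formulas, including $\top,\bot$, by $\land,\lor,\to,\forall,\exists$) and entailment in $\mathcal L$ implies classical entailment. $\mathcal L$ admits a rule with premises $A_1,\dots,A_k$ and conclusion $B$ if $A_1,\dots,A_k$ entail $B$ in $\mathcal L$ (for all instances of a schema). $\to$E is $A,\ A\to B\,/\,B$; $\forall$E is $\forall xA(x)\,/\,A(t)$. A Horn clause is $A_1\to(A_2\to\cdots\to(A_m\to B)\cdots)$ with $A_i,B$ atomic; a universal Horn formula is a Horn clause prefixed by zero or more universal quantifiers. $\mathrm{HE}(\mathcal L)$ is the problem of deciding whether a given finite set $\mathcal H$ of universal Horn formulas entails $\bot$ in $\mathcal L$; $\mathrm{HE}(\mathcal L,k)$ is its restriction to instances $\mathcal H$ with at most $k$ occurrences of quantifiers. EXPTime $=\bigcup_{d>0}\mathrm{Time}(2^{n^d})$. *)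

theory Defs
  imports Complex_Main
begin

section \<open>First-order formulas\<close>

text \<open>
  Formulas are taken up to renaming of bound variables: variables are de Bruijn indices, and an
  index pointing beyond all enclosing quantifiers is a free variable. A function or predicate symbol
  is a name together with the number of arguments it is applied to, so there are infinitely many
  predicate symbols of every arity. The available function symbols (constants have arity 0) are
  given by a set \<open>\<Sigma>\<close> of (name, arity) pairs, which may be empty.
\<close>

datatype trm = Var nat | Fun nat "trm list"

datatype fm =
    Top
  | Bot
  | Atom nat "trm list"
  | Conj fm fm
  | Disj fm fm
  | Imp fm fm
  | All fm
  | Ex fm

primrec trm_over :: "(nat \<times> nat) set \<Rightarrow> trm \<Rightarrow> bool" where
  "trm_over \<Sigma> (Var i) \<longleftrightarrow> True"
| "trm_over \<Sigma> (Fun f ts) \<longleftrightarrow> (f, length ts) \<in> \<Sigma> \<and> list_all (trm_over \<Sigma>) ts"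

primrec fm_over :: "(nat \<times> nat) set \<Rightarrow> fm \<Rightarrow> bool" where
  "fm_over \<Sigma> Top \<longleftrightarrow> True"
| "fm_over \<Sigma> Bot \<longleftrightarrow> True"
| "fm_over \<Sigma> (Atom p ts) \<longleftrightarrow> list_all (trm_over \<Sigma>) ts"
| "fm_over \<Sigma> (Conj A B) \<longleftrightarrow> fm_over \<Sigma> A \<and> fm_over \<Sigma> B"
| "fm_over \<Sigma> (Disj A B) \<longleftrightarrow> fm_over \<Sigma> A \<and> fm_over \<Sigma> B"
| "fm_over \<Sigma> (Imp A B) \<longleftrightarrow> fm_over \<Sigma> A \<and> fm_over \<Sigma> B"
| "fm_over \<Sigma> (All A) \<longleftrightarrow> fm_over \<Sigma> A"
| "fm_over \<Sigma> (Ex A) \<longleftrightarrow> fm_over \<Sigma> A"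

definition fo_formulas :: "(nat \<times> nat) set \<Rightarrow> fm set" where
  "fo_formulas \<Sigma> = {A. fm_over \<Sigma> A}"

text \<open>
  \<open>lift k\<close> renames the free variables so that index \<open>k\<close> becomes fresh; \<open>subst k s\<close> replaces
  variable \<open>k\<close> by \<open>s\<close> and closes the resulting gap in the numbering.
\<close>

primrec lift_trm :: "nat \<Rightarrow> trm \<Rightarrow> trm" where
  "lift_trm k (Var i) = Var (if i < k then i else Suc i)"
| "lift_trm k (Fun f ts) = Fun f (map (lift_trm k) ts)"

primrec subst_trm :: "nat \<Rightarrow> trm \<Rightarrow> trm \<Rightarrow> trm" where
  "subst_trm k s (Var i) = (if i < k then Var i else if i = k then s else Var (i - 1))"
| "subst_trm k s (Fun f ts) = Fun f (map (subst_trm k s) ts)"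

primrec lift :: "nat \<Rightarrow> fm \<Rightarrow> fm" where
  "lift k Top = Top"
| "lift k Bot = Bot"
| "lift k (Atom p ts) = Atom p (map (lift_trm k) ts)"
| "lift k (Conj A B) = Conj (lift k A) (lift k B)"
| "lift k (Disj A B) = Disj (lift k A) (lift k B)"
| "lift k (Imp A B) = Imp (lift k A) (lift k B)"
| "lift k (All A) = All (lift (Suc k) A)"
| "lift k (Ex A) = Ex (lift (Suc k) A)"

primrec subst :: "nat \<Rightarrow> trm \<Rightarrow> fm \<Rightarrow> fm" where
  "subst k s Top = Top"
| "subst k s Bot = Bot"
| "subst k s (Atom p ts) = Atom p (map (subst_trm k s) ts)"
| "subst k s (Conj A B) = Conj (subst k s A) (subst k s B)"
| "subst k s (Disj A B) = Disj (subst k s A) (subst k s B)"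
| "subst k s (Imp A B) = Imp (subst k s A) (subst k s B)"
| "subst k s (All A) = All (subst (Suc k) (lift_trm 0 s) A)"
| "subst k s (Ex A) = Ex (subst (Suc k) (lift_trm 0 s) A)"

text \<open>\<open>inst A t\<close> is \<open>A(t)\<close>, where \<open>A\<close> is the body of a quantified formula.\<close>

definition inst :: "fm \<Rightarrow> trm \<Rightarrow> fm" where
  "inst A t = subst 0 t A"

primrec quantifiers :: "fm \<Rightarrow> nat" where
  "quantifiers Top = 0"
| "quantifiers Bot = 0"
| "quantifiers (Atom p ts) = 0"
| "quantifiers (Conj A B) = quantifiers A + quantifiers B"
| "quantifiers (Disj A B) = quantifiers A + quantifiers B"
| "quantifiers (Imp A B) = quantifiers A + quantifiers B"
| "quantifiers (All A) = Suc (quantifiers A)"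
| "quantifiers (Ex A) = Suc (quantifiers A)"

text \<open>
  Classical entailment is derivability in natural deduction, which, unlike truth in all structures
  over one fixed HOL type, does not depend on a choice of universe. Lifting the context in the
  eigenvariable rules makes index 0 fresh. Derivations may use symbols outside a given \<open>\<Sigma>\<close>; this
  is conservative.
\<close>

inductive classical :: "fm set \<Rightarrow> fm \<Rightarrow> bool" where
  Assm: "A \<in> \<Gamma> \<Longrightarrow> classical \<Gamma> A"
| TopI: "classical \<Gamma> Top"
| RAA: "classical (insert (Imp A Bot) \<Gamma>) Bot \<Longrightarrow> classical \<Gamma> A"
| ConjI: "classical \<Gamma> A \<Longrightarrow> classical \<Gamma> B \<Longrightarrow> classical \<Gamma> (Conj A B)"
| ConjE1: "classical \<Gamma> (Conj A B) \<Longrightarrow> classical \<Gamma> A"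
| ConjE2: "classical \<Gamma> (Conj A B) \<Longrightarrow> classical \<Gamma> B"
| DisjI1: "classical \<Gamma> A \<Longrightarrow> classical \<Gamma> (Disj A B)"
| DisjI2: "classical \<Gamma> B \<Longrightarrow> classical \<Gamma> (Disj A B)"
| DisjE: "classical \<Gamma> (Disj A B) \<Longrightarrow> classical (insert A \<Gamma>) C \<Longrightarrow> classical (insert B \<Gamma>) C \<Longrightarrow>
    classical \<Gamma> C"
| ImpI: "classical (insert A \<Gamma>) B \<Longrightarrow> classical \<Gamma> (Imp A B)"
| ImpE: "classical \<Gamma> (Imp A B) \<Longrightarrow> classical \<Gamma> A \<Longrightarrow> classical \<Gamma> B"
| AllI: "classical (lift 0 ` \<Gamma>) A \<Longrightarrow> classical \<Gamma> (All A)"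
| AllE: "classical \<Gamma> (All A) \<Longrightarrow> classical \<Gamma> (inst A t)"
| ExI: "classical \<Gamma> (inst A t) \<Longrightarrow> classical \<Gamma> (Ex A)"
| ExE: "classical \<Gamma> (Ex A) \<Longrightarrow> classical (insert A (lift 0 ` \<Gamma>)) (lift 0 C) \<Longrightarrow> classical \<Gamma> C"


section \<open>Logics\<close>

record 'f logic =
  formulas :: "'f set"
  entails :: "'f set \<Rightarrow> 'f \<Rightarrow> bool"

definition is_logic :: "'f logic \<Rightarrow> bool" where
  "is_logic L \<longleftrightarrow>
     (\<forall>\<Gamma> A. entails L \<Gamma> A \<longrightarrow> \<Gamma> \<subseteq> formulas L \<and> A \<in> formulas L) \<and>
     (\<forall>A \<in> formulas L. entails L {A} A) \<and>
     (\<forall>\<Gamma> \<Delta> A. entails L \<Gamma> A \<and> \<Gamma> \<subseteq> \<Delta> \<and> \<Delta> \<subseteq> formulas L \<longrightarrow> entails L \<Delta> A) \<and>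
     (\<forall>\<Gamma> \<Delta> A. \<Gamma> \<subseteq> formulas L \<and> (\<forall>B \<in> \<Delta>. entails L \<Gamma> B) \<and> entails L \<Delta> A \<longrightarrow> entails L \<Gamma> A) \<and>
     (\<forall>\<Gamma> A. entails L \<Gamma> A \<longrightarrow> (\<exists>\<Gamma>\<^sub>0. finite \<Gamma>\<^sub>0 \<and> \<Gamma>\<^sub>0 \<subseteq> \<Gamma> \<and> entails L \<Gamma>\<^sub>0 A))"

definition classical_sublogic :: "(nat \<times> nat) set \<Rightarrow> fm logic \<Rightarrow> bool" where
  "classical_sublogic \<Sigma> L \<longleftrightarrow>
     formulas L = fo_formulas \<Sigma> \<and> (\<forall>\<Gamma> A. entails L \<Gamma> A \<longrightarrow> classical \<Gamma> A)"

text \<open>A rule is the set of its instances, each a list of premises with a conclusion.\<close>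

definition admits :: "'f logic \<Rightarrow> ('f list \<times> 'f) set \<Rightarrow> bool" where
  "admits L R \<longleftrightarrow>
     (\<forall>(As, B) \<in> R. set As \<subseteq> formulas L \<and> B \<in> formulas L \<longrightarrow> entails L (set As) B)"

definition imp_elim :: "(fm list \<times> fm) set" where
  "imp_elim = {([A, Imp A B], B) | A B. True}"

definition all_elim :: "(fm list \<times> fm) set" where
  "all_elim = {([All A], inst A t) | A t. True}"


section \<open>Horn formulas and their encoding\<close>

primrec atomic :: "fm \<Rightarrow> bool" where
  "atomic Top \<longleftrightarrow> True"
| "atomic Bot \<longleftrightarrow> True"
| "atomic (Atom p ts) \<longleftrightarrow> True"
| "atomic (Conj A B) \<longleftrightarrow> False"
| "atomic (Disj A B) \<longleftrightarrow> False"
| "atomic (Imp A B) \<longleftrightarrow> False"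
| "atomic (All A) \<longleftrightarrow> False"
| "atomic (Ex A) \<longleftrightarrow> False"

definition horn_clause :: "fm \<Rightarrow> bool" where
  "horn_clause C \<longleftrightarrow> (\<exists>As B. list_all atomic As \<and> atomic B \<and> C = foldr Imp As B)"

definition universal_horn :: "fm \<Rightarrow> bool" where
  "universal_horn H \<longleftrightarrow> (\<exists>n C. horn_clause C \<and> H = (All ^^ n) C)"

text \<open>
  Names and indices are written in binary, least significant digit first: each digit is preceded by
  \<open>True\<close>, and \<open>False\<close> ends the numeral. Lists use the same continuation flags, so that all encodings
  are prefix-free.
\<close>

fun enc_nat :: "nat \<Rightarrow> bool list" where
  "enc_nat n = (if n = 0 then [False] else True # odd n # enc_nat (n div 2))"

declare enc_nat.simps [simp del]

definition enc_list :: "('a \<Rightarrow> bool list) \<Rightarrow> 'a list \<Rightarrow> bool list" where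
  "enc_list e xs = concat (map (\<lambda>x. True # e x) xs) @ [False]"

primrec enc_trm :: "trm \<Rightarrow> bool list" where
  "enc_trm (Var i) = False # enc_nat i"
| "enc_trm (Fun f ts) = True # enc_nat f @ concat (map (\<lambda>b. True # b) (map enc_trm ts)) @ [False]"

primrec enc_fm :: "fm \<Rightarrow> bool list" where
  "enc_fm Top = [False, False, False]"
| "enc_fm Bot = [False, False, True]"
| "enc_fm (Atom p ts) = [False, True, False] @ enc_nat p @ enc_list enc_trm ts"
| "enc_fm (Conj A B) = [False, True, True] @ enc_fm A @ enc_fm B"
| "enc_fm (Disj A B) = [True, False, False] @ enc_fm A @ enc_fm B"
| "enc_fm (Imp A B) = [True, False, True] @ enc_fm A @ enc_fm B"
| "enc_fm (All A) = [True, True, False] @ enc_fm A"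
| "enc_fm (Ex A) = [True, True, True] @ enc_fm A"

lemma enc_nat_inject: "enc_nat m @ xs = enc_nat n @ ys \<longleftrightarrow> m = n \<and> xs = ys"
proof (induction m arbitrary: n rule: enc_nat.induct)
  case (1 m)
  have half: "m = n \<longleftrightarrow> odd m = odd n \<and> m div 2 = n div 2"
    by (metis bit_eq_rec)
  show ?case
  proof (cases "m = 0 \<or> n = 0")
    case True
    then show ?thesis by (auto simp: enc_nat.simps[of m] enc_nat.simps[of n])
  next
    case False
    then have "m \<noteq> 0" by simp
    from "1.IH"[OF this, of "n div 2"] False half show ?thesis
      by (subst enc_nat.simps[of m], subst enc_nat.simps[of n]) auto
  qed
qed

lemma enc_list_inject:
  assumes "\<And>x u v y. x \<in> set xs \<Longrightarrow> e x @ u = e y @ v \<longleftrightarrow> x = y \<and> u = v"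
  shows "enc_list e xs @ us = enc_list e ys @ vs \<longleftrightarrow> xs = ys \<and> us = vs"
  using assms
proof (induction xs arbitrary: ys)
  case Nil
  then show ?case by (cases ys) (auto simp: enc_list_def)
next
  case (Cons x xs)
  have IH: "enc_list e xs @ us = enc_list e zs @ vs \<longleftrightarrow> xs = zs \<and> us = vs" for zs
    using Cons by simp
  show ?case
  proof (cases ys)
    case Nil
    then show ?thesis by (auto simp: enc_list_def)
  next
    case (Cons y zs)
    then show ?thesis using Cons.prems[of x] IH[of zs] by (auto simp: enc_list_def)
  qed
qed

lemma enc_trm_Fun: "enc_trm (Fun f ts) = True # enc_nat f @ enc_list enc_trm ts"
  by (simp add: enc_list_def comp_def)

lemma enc_trm_inject: "enc_trm s @ xs = enc_trm t @ ys \<longleftrightarrow> s = t \<and> xs = ys"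
proof (induction s arbitrary: t xs ys)
  case (Var i)
  show ?case by (cases t) (auto simp: enc_nat_inject)
next
  case (Fun f ts)
  show ?case
  proof (cases t)
    case (Var i)
    then show ?thesis by simp
  next
    case (Fun g us)
    have "enc_list enc_trm ts @ xs = enc_list enc_trm us @ ys \<longleftrightarrow> ts = us \<and> xs = ys"
      using Fun.IH by (intro enc_list_inject) blast
    then show ?thesis using Fun by (auto simp: enc_trm_Fun enc_nat_inject simp del: enc_trm.simps)
  qed
qed

lemma enc_fm_inject: "enc_fm A @ xs = enc_fm B @ ys \<longleftrightarrow> A = B \<and> xs = ys"
proof (induction A arbitrary: B xs ys)
  case (Atom p ts)
  show ?case
    by (cases B) (auto simp: enc_nat_inject enc_list_inject[OF enc_trm_inject])
qed (case_tac [!] B, auto)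

lemma enc_instance_inject: "enc_list enc_fm As = enc_list enc_fm Bs \<longleftrightarrow> As = Bs"
  using enc_list_inject[OF enc_fm_inject, of As "[]" Bs "[]"] by simp

text \<open>Problems are languages of bit strings; a string encoding no instance is a negative one.\<close>

definition HE :: "fm logic \<Rightarrow> bool list set" where
  "HE L = {enc_list enc_fm Hs | Hs.
     (\<forall>H \<in> set Hs. universal_horn H \<and> H \<in> formulas L) \<and>
     entails L (set Hs) Bot}"

definition HE_bounded :: "fm logic \<Rightarrow> nat \<Rightarrow> bool list set" where
  "HE_bounded L k = {enc_list enc_fm Hs | Hs.
     (\<forall>H \<in> set Hs. universal_horn H \<and> H \<in> formulas L) \<and>
     (\<Sum>H \<in> set Hs. quantifiers H) \<le> k \<and>
     entails L (set Hs) Bot}"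


section \<open>Turing machines and complexity classes\<close>

text \<open>
  Deterministic machines with a read-only input tape with end markers, finitely many one-way infinite
  work tapes (a left move at cell 0 does not move the head), and a write-only output tape: each step
  appends at most one bit to the output. States and work symbols are initial segments of the natural
  numbers; symbol 0 is the blank.
\<close>

datatype input_symbol = Left_End | Bit bool | Right_End

datatype direction = Go_Left | Stay | Go_Right

record machine =
  work_tapes :: nat
  states :: nat
  symbols :: nat
  start :: nat
  accept :: nat
  reject :: nat
  delta :: "nat \<Rightarrow> input_symbol \<Rightarrow> nat list \<Rightarrow>
    nat \<times> direction \<times> (nat \<times> direction) list \<times> bool option"

definition is_machine :: "machine \<Rightarrow> bool" where
  "is_machine M \<longleftrightarrow>
     0 < symbols M \<and> start M < states M \<and> accept M < states M \<and> reject M < states M \<and>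
     accept M \<noteq> reject M \<and>
     (\<forall>q i ss. q < states M \<and> length ss = work_tapes M \<and> (\<forall>s \<in> set ss. s < symbols M) \<longrightarrow>
        (case delta M q i ss of (q', d, ws, b) \<Rightarrow>
           q' < states M \<and> length ws = work_tapes M \<and> (\<forall>(s, _) \<in> set ws. s < symbols M)))"

text \<open>A work tape is its head position together with its contents.\<close>

record config =
  state :: nat
  input_head :: nat
  work :: "(nat \<times> (nat \<Rightarrow> nat)) list"
  out :: "bool list"

definition initial :: "machine \<Rightarrow> config" where
  "initial M = \<lparr>state = start M, input_head = 0,
     work = replicate (work_tapes M) (0, \<lambda>_. 0), out = []\<rparr>"

definition halted :: "machine \<Rightarrow> config \<Rightarrow> bool" where
  "halted M c \<longleftrightarrow> state c = accept M \<or> state c = reject M"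

definition scan :: "bool list \<Rightarrow> nat \<Rightarrow> input_symbol" where
  "scan x p = (if p = 0 then Left_End else if p \<le> length x then Bit (x ! (p - 1)) else Right_End)"

primrec move :: "direction \<Rightarrow> nat \<Rightarrow> nat" where
  "move Go_Left p = p - 1"
| "move Stay p = p"
| "move Go_Right p = p + 1"

definition step :: "machine \<Rightarrow> bool list \<Rightarrow> config \<Rightarrow> config" where
  "step M x c =
     (if halted M c then c
      else case delta M (state c) (scan x (input_head c)) (map (\<lambda>(p, w). w p) (work c)) of
        (q, d, ws, b) \<Rightarrow>
          \<lparr>state = q,
           input_head = min (move d (input_head c)) (length x + 1),
           work = map2 (\<lambda>(s, d') (p, w). (move d' p, w(p := s))) ws (work c),
           out = out c @ (case b of None \<Rightarrow> [] | Some b' \<Rightarrow> [b'])\<rparr>)"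

definition run :: "machine \<Rightarrow> bool list \<Rightarrow> nat \<Rightarrow> config" where
  "run M x t = (step M x ^^ t) (initial M)"

text \<open>\<open>Time f\<close> is understood up to constant factors, i.e. as deterministic time \<open>O(f)\<close>.\<close>

definition Time :: "(nat \<Rightarrow> nat) \<Rightarrow> bool list set set" where
  "Time f = {X. \<exists>M c. is_machine M \<and>
     (\<forall>x. let r = run M x (c * f (length x) + c)
          in halted M r \<and> (x \<in> X \<longleftrightarrow> state r = accept M))}"

definition PTime :: "bool list set set" where
  "PTime = (\<Union>d. Time (\<lambda>n. n ^ d))"

definition EXPTime :: "bool list set set" where
  "EXPTime = (\<Union>d \<in> {0<..}. Time (\<lambda>n. 2 ^ (n ^ d)))"

text \<open>
  Space is measured on the work tapes only. The input length is shifted by one to keep the logarithm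
  away from 0.
\<close>

definition logspace_computable :: "(bool list \<Rightarrow> bool list) \<Rightarrow> bool" where
  "logspace_computable f \<longleftrightarrow> (\<exists>M (c::nat). is_machine M \<and>
     (\<forall>x. (\<exists>t. halted M (run M x t) \<and> out (run M x t) = f x) \<and>
          (\<forall>t. \<forall>(p, _) \<in> set (work (run M x t)).
             real p \<le> real c * log 2 (real (length x + 1)) + real c)))"

definition logspace_reducible :: "bool list set \<Rightarrow> bool list set \<Rightarrow> bool" where
  "logspace_reducible X Y \<longleftrightarrow> (\<exists>f. logspace_computable f \<and> (\<forall>x. x \<in> X \<longleftrightarrow> f x \<in> Y))"

definition hard_for :: "bool list set set \<Rightarrow> bool list set \<Rightarrow> bool" where
  "hard_for \<C> Y \<longleftrightarrow> (\<forall>X \<in> \<C>. logspace_reducible X Y)"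

end

theory Submission
  imports Defs "HOL-Library.Countable"
begin

text \<open>
  Number the cells of all tapes and the time steps of a deterministic machine; the input tape is
  treated as one more tape that is never modified. Whether a tape holds a given symbol at a given
  time and cell follows by Horn clauses which mention only times \<open>t\<close>, \<open>t + 1\<close> and cells \<open>p\<close>, \<open>p + 1\<close>:
  instead of the negative condition that the head is not at \<open>p\<close>, the clauses derive that the head is
  strictly to the left or to the right of \<open>p\<close>. If the machine accepts, \<open>\<bottom>\<close> is derived by modus ponens
  alone; if it rejects, its actual run is a classical model of all clauses, for all times and cells.
  Hence the two answers of the problem agree for every logic between Horn derivability and classical
  entailment.

  Numbers are coded without function symbols. For polynomial time, \<open>t\<close> is the free variable with
  index \<open>t\<close>, and all instances of the clauses are written out. For exponential time, \<open>t\<close> is a tuple of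
  \<open>m\<close> free variables \<open>v\<^sub>0\<close> and \<open>v\<^sub>1\<close>, its binary digits, and each clause is universally quantified over
  its four numbers; the successor relation needs one clause for each number of trailing ones.
  The reductions are computed by loop programs with polynomially bounded registers, which are kept in
  binary on work tapes of logarithmic length.
\<close>

section \<open>Register programs on logarithmic space\<close>

text \<open>Since \<open>\<Sigma>\<close> may be empty, only free variables can serve as names, and
  no clause says that two of them differ. None has to. In the accepting case only positive facts are
  derived; in the rejecting case one structure over the natural numbers suffices, in which free
  variable \<open>i\<close> denotes \<open>i\<close>. The clauses hold there for arbitrary numbers
  \<open>t\<close>, \<open>t'\<close>, \<open>p\<close>, \<open>p'\<close>, because succession is
  always a premise and never presupposed.

  The input is the one part that cannot be described uniformly. Each input position gets a single
  free variable as its name, and \<open>Inp\<close> ties it to the cell with the same number,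
  however cells are coded. So a program that writes an instance prints a counter and never the
  binary digits of a position.

  The clause lists are polymorphic in their arguments: the same lists are read over numbers, over
  blocks of variables and over register blocks of the writing program. Naturality of the lists
  carries every fact from one reading to another.\<close>

datatype 'r com =
    Init
  | Skip
  | Emit bool
  | Print 'r
  | Inc 'r
  | Copy 'r 'r
  | Head direction
  | Seq "'r com" "'r com"
  | While 'r 'r "'r com"
  | Until input_symbol "'r com"
  | Branch "input_symbol \<Rightarrow> 'r com"

text \<open>
  The control state of the compiled machine is the list of programs still to be executed, together with
  a phase: 0 sweeps to the right, 1 and 2 return to the marker, except that \<open>Print\<close> uses 2 for the second
  bit of a digit. All heads move together.
\<close>

fun ctrl :: "'r com list \<Rightarrow> nat \<Rightarrow> input_symbol \<Rightarrow> ('r \<Rightarrow> nat) \<Rightarrow>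
    ('r com list \<times> nat) \<times> direction \<times> ('r \<Rightarrow> nat) \<times> direction \<times> bool option" where
  "ctrl [] ph a u = (([], ph), Stay, u, Stay, None)"
| "ctrl (Init # k) ph a u = ((k, 0), Stay, \<lambda>_. 3, Stay, None)"
| "ctrl (Skip # k) ph a u = ((k, 0), Stay, u, Stay, None)"
| "ctrl (Emit b # k) ph a u = ((k, 0), Stay, u, Stay, Some b)"
| "ctrl (Head d # k) ph a u = ((k, 0), d, u, Stay, None)"
| "ctrl (Seq c c' # k) ph a u = ((c # c' # k, 0), Stay, u, Stay, None)"
| "ctrl (Branch f # k) ph a u = ((f a # k, 0), Stay, u, Stay, None)"
| "ctrl (Until b c # k) ph a u = ((if a = b then k else c # Until b c # k, 0), Stay, u, Stay, None)"
| "ctrl (Inc r # k) ph a u =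
     (if ph = 0 then
        if u r = 3 then ((Inc r # k, 0), Stay, u, Go_Right, None)
        else if u r = 2 then ((Inc r # k, 0), Stay, u(r := 1), Go_Right, None)
        else ((Inc r # k, 1), Stay, u(r := 2), Stay, None)
      else if u r = 3 then ((k, 0), Stay, u, Stay, None)
      else ((Inc r # k, 1), Stay, u, Go_Left, None))"
| "ctrl (Copy r s # k) ph a u =
     (if ph = 0 then
        if u r = 0 \<and> u s = 0 then ((Copy r s # k, 1), Stay, u, Stay, None)
        else ((Copy r s # k, 0), Stay, u(r := u s), Go_Right, None)
      else if u r = 3 then ((k, 0), Stay, u, Stay, None)
      else ((Copy r s # k, 1), Stay, u, Go_Left, None))"
| "ctrl (While r s c # k) ph a u =
     (if ph = 0 then
        if u r \<noteq> u s then ((While r s c # k, 2), Stay, u, Stay, None)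
        else if u r = 0 then ((While r s c # k, 1), Stay, u, Stay, None)
        else ((While r s c # k, 0), Stay, u, Go_Right, None)
      else if u r = 3 then ((if ph = 1 then k else c # While r s c # k, 0), Stay, u, Stay, None)
      else ((While r s c # k, ph), Stay, u, Go_Left, None))"
| "ctrl (Print r # k) ph a u =
     (if ph = 0 then
        if u r = 3 then ((Print r # k, 0), Stay, u, Go_Right, None)
        else if u r = 0 then ((Print r # k, 1), Stay, u, Stay, Some False)
        else ((Print r # k, 2), Stay, u, Stay, Some True)
      else if ph = 2 then ((Print r # k, 0), Stay, u, Go_Right, Some (u r = 2))
      else if u r = 3 then ((k, 0), Stay, u, Stay, None)
      else ((Print r # k, 1), Stay, u, Go_Left, None))"

type_synonym 'r conf =
  "'r com list \<times> nat \<times> nat \<times> nat \<times> ('r \<Rightarrow> nat \<Rightarrow> nat) \<times> bool list"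

fun astep :: "bool list \<Rightarrow> 'r conf \<Rightarrow> 'r conf" where
  "astep x (k, ph, p, h, w, os) =
     (case ctrl k ph (scan x h) (\<lambda>r. w r p) of ((k', ph'), d, u, e, b) \<Rightarrow>
        (k', ph', move e p, min (move d h) (length x + 1), \<lambda>r. (w r)(p := u r),
         os @ (case b of None \<Rightarrow> [] | Some b' \<Rightarrow> [b'])))"

fun pos :: "'r conf \<Rightarrow> nat" where
  "pos (k, ph, p, h, w, os) = p"

lemma column_update: "(\<lambda>r'. (w r')(p := ((\<lambda>r. w r p)(r := s)) r')) = w(r := (w r)(p := s))"
  by (auto simp: fun_eq_iff)

text \<open>
  Registers are written least significant digit first, with digits 1 and 2 for the bits, a blank after
  the last one, and the marker 3 in cell 0, which is needed because a machine cannot detect the left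
  end of a work tape.
\<close>

definition digit :: "nat \<Rightarrow> nat" where
  "digit v = (if v = 0 then 0 else if odd v then 2 else 1)"

definition tape :: "nat \<Rightarrow> nat \<Rightarrow> nat" where
  "tape v p = (if p = 0 then 3 else digit (v div 2 ^ (p - 1)))"

lemma digit_simps [simp]: "digit 0 = 0" "digit v = 0 \<longleftrightarrow> v = 0" "digit v = 2 \<longleftrightarrow> odd v"
  "digit v \<noteq> 3" "digit v = Suc 0 \<longleftrightarrow> v \<noteq> 0 \<and> even v"
  by (auto simp: digit_def)

lemma tape_simps [simp]: "tape v 0 = 3" "tape v (Suc p) = digit (v div 2 ^ p)" "tape v p = 3 \<longleftrightarrow> p = 0"
  by (auto simp: tape_def)

lemma tape_marker [simp]: "(tape v)(0 := 3) = tape v"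
  by (simp add: fun_eq_iff)

lemma tape_eqI: "w 0 = 3 \<Longrightarrow> (\<And>i. w (1 + i) = digit (v div 2 ^ i)) \<Longrightarrow> w = tape v"
  by (auto simp: fun_eq_iff tape_def) (metis Suc_pred)

lemma half_power: "v div 2 ^ Suc i = v div 2 div 2 ^ i" for v :: nat
  by (simp add: div_mult2_eq)

definition registers_fit :: "nat \<Rightarrow> ('r \<Rightarrow> nat) \<Rightarrow> bool" where
  "registers_fit B \<sigma> \<longleftrightarrow> (\<forall>r. \<sigma> r < 2 ^ B)"

section \<open>Programs as reachability within a space bound\<close>

context
  fixes x :: "bool list" and B :: nat
begin

text \<open>Every configuration on the way keeps the heads within cell \<open>B + 1\<close>, so that
  correctness and the space bound come out of one derivation.\<close>

inductive reach :: "'r conf \<Rightarrow> 'r conf \<Rightarrow> bool" where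
  refl: "pos c \<le> B + 1 \<Longrightarrow> reach c c"
| step: "pos c \<le> B + 1 \<Longrightarrow> reach (astep x c) c' \<Longrightarrow> reach c c'"

lemma reach_trans [trans]: "reach c c' \<Longrightarrow> reach c' c'' \<Longrightarrow> reach c c''"
  by (induction rule: reach.induct) (auto intro: reach.step)

lemma reach_pos: "reach c c' \<Longrightarrow> pos c' \<le> B + 1"
  by (induction rule: reach.induct) auto

lemma reach_step: "astep x c = c' \<Longrightarrow> pos c \<le> B + 1 \<Longrightarrow> pos c' \<le> B + 1 \<Longrightarrow> reach c c'"
  by (metis reach.intros)

lemma reach_rewind:
  assumes "\<And>q. 0 < q \<Longrightarrow> astep x (k, ph, q, h, w, os) = (k, ph, q - 1, h, w, os)" and "q \<le> B + 1"
  shows "reach (k, ph, q, h, w, os) (k, ph, 0, h, w, os)"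
  using assms(2)
proof (induction q)
  case (Suc q)
  then show ?case using assms(1)[of "Suc q"] by (auto intro: reach.step)
qed (auto intro: reach.refl)

text \<open>Here \<open>v\<close> is the number held by the cells from \<open>p\<close> on. The
  carry turns ones (digit 2) into zeros (digit 1) and stops at the first zero or at the blank;
  \<open>Suc v < 2 ^ b\<close> makes it stop within the \<open>b\<close> cells left.\<close>

lemma inc_sweep:
  assumes "\<And>i. w r (p + i) = digit (v div 2 ^ i)" "Suc v < 2 ^ b" "p + b \<le> B + 1" "h \<le> length x + 1"
  shows "\<exists>q w'. reach (Inc r # k, 0, p, h, w, os) (Inc r # k, 1, q, h, w(r := w'), os) \<and>
    (\<forall>i. w' (p + i) = digit (Suc v div 2 ^ i)) \<and> (\<forall>i<p. w' i = w r i)"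
  using assms(1-3)
proof (induction b arbitrary: p v w)
  case (Suc b)
  have 0: "w r p = digit v" using Suc.prems(1)[of 0] by simp
  show ?case
  proof (cases "odd v")
    case True
    let ?w = "w(r := (w r)(p := 1))"
    have "?w r (Suc p + i) = digit (v div 2 div 2 ^ i)" for i
      using Suc.prems(1)[of "Suc i"] by (simp only: half_power) simp
    moreover have "Suc (v div 2) < 2 ^ b" "Suc p + b \<le> B + 1"
      using Suc.prems(2,3) True by (auto elim!: oddE)
    ultimately obtain q w' where
      *: "reach (Inc r # k, 0, Suc p, h, ?w, os) (Inc r # k, 1, q, h, ?w(r := w'), os)"
      "\<And>i. w' (Suc p + i) = digit (Suc (v div 2) div 2 ^ i)" "\<And>i. i < Suc p \<Longrightarrow> w' i = ?w r i"
      using Suc.IH[of ?w "Suc p" "v div 2"] by blast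
    have "reach (Inc r # k, 0, p, h, w, os) (Inc r # k, 0, Suc p, h, ?w, os)"
      using True 0 Suc.prems(3) assms(4) by (intro reach_step) (auto simp: column_update)
    also note *(1)
    finally have "reach (Inc r # k, 0, p, h, w, os) (Inc r # k, 1, q, h, w(r := w'), os)" by simp
    moreover have "w' (p + i) = digit (Suc v div 2 ^ i)" for i
    proof (cases i)
      case 0
      then show ?thesis using *(3)[of p] True by (auto simp: digit_def)
    next
      case (Suc j)
      then show ?thesis using *(2)[of j] True by (simp only: half_power) simp
    qed
    moreover have "\<forall>i<p. w' i = w r i" using *(3) by simp
    ultimately show ?thesis by blast
  next
    case False
    let ?w = "(w r)(p := 2)"
    have "reach (Inc r # k, 0, p, h, w, os) (Inc r # k, 1, p, h, w(r := ?w), os)"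
      using False 0 Suc.prems(3) assms(4) by (intro reach_step) (auto simp: column_update)
    moreover have "?w (p + i) = digit (Suc v div 2 ^ i)" for i
    proof (cases i)
      case 0
      then show ?thesis using False by (auto simp: digit_def)
    next
      case (Suc j)
      have "Suc v div 2 = v div 2" using False by simp
      then show ?thesis using Suc.prems(1)[of i] Suc by (simp only: half_power) simp
    qed
    ultimately show ?thesis by fastforce
  qed
qed auto

text \<open>The tape has the layout of \<open>enc_nat\<close>: each digit becomes
  \<open>True\<close> and its bit, the blank becomes the closing \<open>False\<close>. One step
  appends at most one bit, so a digit takes two phases.\<close>

lemma print_sweep:
  assumes "\<And>i. w r (p + i) = digit (v div 2 ^ i)" "v < 2 ^ b" "p + b \<le> B + 1" "h \<le> length x + 1"
  shows "\<exists>q. reach (Print r # k, 0, p, h, w, os) (Print r # k, 1, q, h, w, os @ enc_nat v)"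
  using assms(1-3)
proof (induction b arbitrary: p v os)
  case 0
  have "w r p = 0" using 0(1)[of 0] 0(2) by simp
  then have "reach (Print r # k, 0, p, h, w, os) (Print r # k, 1, p, h, w, os @ enc_nat v)"
    using 0 assms(4) by (intro reach_step) (auto simp: enc_nat.simps)
  then show ?case by blast
next
  case (Suc b)
  have 0: "w r p = digit v" using Suc.prems(1)[of 0] by simp
  show ?case
  proof (cases "v = 0")
    case True
    then have "reach (Print r # k, 0, p, h, w, os) (Print r # k, 1, p, h, w, os @ enc_nat v)"
      using Suc.prems 0 assms(4) by (intro reach_step) (auto simp: enc_nat.simps)
    then show ?thesis by blast
  next
    case False
    have "w r (Suc p + i) = digit (v div 2 div 2 ^ i)" for i
      using Suc.prems(1)[of "Suc i"] by (simp only: half_power) simp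
    moreover have "v div 2 < 2 ^ b" "Suc p + b \<le> B + 1"
      using Suc.prems(2,3) less_mult_imp_div_less[of v "2 ^ b" 2] by (simp_all add: mult.commute)
    ultimately obtain q where
      *: "reach (Print r # k, 0, Suc p, h, w, os @ [True, odd v])
        (Print r # k, 1, q, h, w, (os @ [True, odd v]) @ enc_nat (v div 2))"
      using Suc.IH[of "Suc p" "v div 2" "os @ [True, odd v]"] by blast
    have "reach (Print r # k, 0, p, h, w, os) (Print r # k, 2, p, h, w, os @ [True])"
      using False Suc.prems 0 assms(4) by (intro reach_step) auto
    also have "reach \<dots> (Print r # k, 0, Suc p, h, w, os @ [True, odd v])"
      using False Suc.prems 0 assms(4) by (intro reach_step) auto
    also note *
    also have "(os @ [True, odd v]) @ enc_nat (v div 2) = os @ enc_nat v"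
      using False by (simp add: enc_nat.simps[of v])
    finally show ?thesis by blast
  qed
qed

lemma digit_eq: "digit v = digit v' \<longleftrightarrow> (v = 0 \<longleftrightarrow> v' = 0) \<and> (odd v \<longleftrightarrow> odd v')"
  by (auto simp: digit_def)

text \<open>Registers have no leading zeros, since \<open>digit\<close> is blank as soon as the
  remaining quotient is 0. Hence two values are equal exactly if their digits agree up to a common
  blank.\<close>

lemma while_sweep:
  assumes "\<And>i. w r (p + i) = digit (v div 2 ^ i)" "\<And>i. w s (p + i) = digit (v' div 2 ^ i)"
    "v < 2 ^ b" "v' < 2 ^ b" "p + b \<le> B + 1" "h \<le> length x + 1"
  shows "\<exists>q. reach (While r s c # k, 0, p, h, w, os)
    (While r s c # k, if v = v' then 1 else 2, q, h, w, os)"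
  using assms(1-5)
proof (induction b arbitrary: p v v')
  case 0
  have "w r p = 0" "w s p = 0" using 0(1,2)[of 0] 0(3,4) by auto
  then have "reach (While r s c # k, 0, p, h, w, os) (While r s c # k, 1, p, h, w, os)"
    using 0 assms(6) by (intro reach_step) auto
  then show ?case using 0 by auto
next
  case (Suc b)
  have 0: "w r p = digit v" "w s p = digit v'" using Suc.prems(1,2)[of 0] by auto
  show ?case
  proof (cases "digit v = digit v' \<and> v \<noteq> 0")
    case False
    then have "reach (While r s c # k, 0, p, h, w, os)
        (While r s c # k, if v = v' then 1 else 2, p, h, w, os)"
      using Suc.prems(3-5) 0 assms(6) by (intro reach_step) (auto simp: digit_eq)
    then show ?thesis by blast
  next
    case True
    have 1: "w r (Suc p + i) = digit (v div 2 div 2 ^ i)" "w s (Suc p + i) = digit (v' div 2 div 2 ^ i)" for i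
      using Suc.prems(1,2)[of "Suc i"] by (simp_all only: half_power) simp_all
    have "v div 2 < 2 ^ b" "v' div 2 < 2 ^ b" "Suc p + b \<le> B + 1"
      using Suc.prems(3-5) less_mult_imp_div_less[of v "2 ^ b" 2] less_mult_imp_div_less[of v' "2 ^ b" 2]
      by (simp_all add: mult.commute)
    from Suc.IH[of "Suc p" "v div 2" "v' div 2", OF 1 this] obtain q where
      *: "reach (While r s c # k, 0, Suc p, h, w, os)
        (While r s c # k, if v div 2 = v' div 2 then 1 else 2, q, h, w, os)" by auto
    have "reach (While r s c # k, 0, p, h, w, os) (While r s c # k, 0, Suc p, h, w, os)"
      using True Suc.prems(5) 0 assms(6) by (intro reach_step) (auto simp: digit_eq)
    also note *
    also have "v div 2 = v' div 2 \<longleftrightarrow> v = v'" using True unfolding digit_eq by (metis bit_eq_rec)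
    finally show ?thesis by blast
  qed
qed

text \<open>The sweep ends only where both registers are blank, so a longer old value of
  \<open>r\<close> is erased completely.\<close>

lemma copy_sweep:
  assumes "\<And>i. w r (p + i) = digit (v div 2 ^ i)" "\<And>i. w s (p + i) = digit (v' div 2 ^ i)"
    "v < 2 ^ b" "v' < 2 ^ b" "p + b \<le> B + 1" "h \<le> length x + 1"
  shows "\<exists>q w'. reach (Copy r s # k, 0, p, h, w, os) (Copy r s # k, 1, q, h, w(r := w'), os) \<and>
    (\<forall>i. w' (p + i) = digit (v' div 2 ^ i)) \<and> (\<forall>i<p. w' i = w r i)"
  using assms(1-5)
proof (induction b arbitrary: p v v' w)
  case 0
  have *: "w r p = 0" "w s p = 0" "v = 0" "v' = 0" using 0(1,2)[of 0] 0(3,4) by auto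
  then have "reach (Copy r s # k, 0, p, h, w, os) (Copy r s # k, 1, p, h, w(r := w r), os)"
    using 0(5) assms(6) by (intro reach_step) auto
  then show ?case using 0 * by blast
next
  case (Suc b)
  have 0: "w r p = digit v" "w s p = digit v'" using Suc.prems(1,2)[of 0] by auto
  show ?case
  proof (cases "v = 0 \<and> v' = 0")
    case True
    then have "reach (Copy r s # k, 0, p, h, w, os) (Copy r s # k, 1, p, h, w(r := w r), os)"
      using Suc.prems(5) 0 assms(6) by (intro reach_step) auto
    then show ?thesis using Suc.prems(1) True by blast
  next
    case False
    let ?w = "w(r := (w r)(p := w s p))"
    have 1: "?w r (Suc p + i) = digit (v div 2 div 2 ^ i)" "?w s (Suc p + i) = digit (v' div 2 div 2 ^ i)" for i
      using Suc.prems(1,2)[of "Suc i"] by (simp_all only: half_power) auto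
    have "v div 2 < 2 ^ b" "v' div 2 < 2 ^ b" "Suc p + b \<le> B + 1"
      using Suc.prems(3-5) less_mult_imp_div_less[of v "2 ^ b" 2] less_mult_imp_div_less[of v' "2 ^ b" 2]
      by (simp_all add: mult.commute)
    from Suc.IH[of ?w "Suc p" "v div 2" "v' div 2", OF 1 this] obtain q w' where
      *: "reach (Copy r s # k, 0, Suc p, h, ?w, os) (Copy r s # k, 1, q, h, ?w(r := w'), os)"
      "\<And>i. w' (Suc p + i) = digit (v' div 2 div 2 ^ i)" "\<And>i. i < Suc p \<Longrightarrow> w' i = ?w r i" by blast
    have "reach (Copy r s # k, 0, p, h, w, os) (Copy r s # k, 0, Suc p, h, ?w, os)"
      using False Suc.prems(5) 0 assms(6) by (intro reach_step) (auto simp: column_update)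
    also note *(1)
    finally have "reach (Copy r s # k, 0, p, h, w, os) (Copy r s # k, 1, q, h, w(r := w'), os)" by simp
    moreover have "w' (p + i) = digit (v' div 2 ^ i)" for i
    proof (cases i)
      case 0
      then show ?thesis using *(3)[of p] \<open>w s p = _\<close> by simp
    next
      case (Suc j)
      then show ?thesis using *(2)[of j] by (simp only: half_power) simp
    qed
    moreover have "\<forall>i<p. w' i = w r i" using *(3) by simp
    ultimately show ?thesis by blast
  qed
qed

fun conf :: "'r com list \<Rightarrow> ('r \<Rightarrow> nat) \<times> nat \<Rightarrow> bool list \<Rightarrow> 'r conf" where
  "conf k (\<sigma>, h) os = (k, 0, 0, h, \<lambda>r. tape (\<sigma> r), os)"

fun fits :: "('r \<Rightarrow> nat) \<times> nat \<Rightarrow> bool" where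
  "fits (\<sigma>, h) \<longleftrightarrow> registers_fit B \<sigma> \<and> h \<le> length x + 1"

text \<open>Arbitrary \<open>k\<close> and \<open>os\<close> make executions composable under any
  pending programs and after any earlier output. With \<open>fits\<close> as an inner premise the
  composition rules carry no side conditions on sizes; only an increment has to exclude
  overflow.\<close>

definition exec :: "'r com \<Rightarrow> ('r \<Rightarrow> nat) \<times> nat \<Rightarrow> ('r \<Rightarrow> nat) \<times> nat \<Rightarrow> bool list \<Rightarrow> bool" where
  "exec c s s' o1 \<longleftrightarrow> (fits s \<longrightarrow> fits s' \<and> (\<forall>k os. reach (conf (c # k) s os) (conf k s' (os @ o1))))"

lemma exec_Skip: "exec Skip s s []"
  unfolding exec_def by (cases s) (auto intro!: reach_step)

lemma exec_Emit: "exec (Emit b) s s [b]"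
  unfolding exec_def by (cases s) (auto intro!: reach_step)

lemma exec_Head: "exec (Head d) (\<sigma>, h) (\<sigma>, min (move d h) (length x + 1)) []"
  unfolding exec_def by (auto intro!: reach_step)

lemma exec_Seq:
  assumes "exec c s s' o1" "exec c' s' s'' o2"
  shows "exec (Seq c c') s s'' (o1 @ o2)"
  unfolding exec_def
proof (intro impI conjI allI)
  assume s: "fits s"
  with assms show "fits s''" by (simp add: exec_def)
  fix k os
  have "reach (conf (Seq c c' # k) s os) (conf (c # c' # k) s os)"
    using s by (cases s) (auto intro!: reach_step)
  also have "reach \<dots> (conf (c' # k) s' (os @ o1))" using s assms(1) by (simp add: exec_def)
  also have "reach \<dots> (conf k s'' ((os @ o1) @ o2))"
    using s assms by (simp add: exec_def del: append_assoc)
  finally show "reach (conf (Seq c c' # k) s os) (conf k s'' (os @ o1 @ o2))" by simp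
qed

lemma exec_Branch:
  assumes "exec (f (scan x h)) (\<sigma>, h) s' o1"
  shows "exec (Branch f) (\<sigma>, h) s' o1"
  unfolding exec_def
proof (intro impI conjI allI)
  assume s: "fits (\<sigma>, h)"
  with assms show "fits s'" by (simp add: exec_def)
  fix k os
  have "reach (conf (Branch f # k) (\<sigma>, h) os) (conf (f (scan x h) # k) (\<sigma>, h) os)"
    using s by (auto intro!: reach_step)
  also have "reach \<dots> (conf k s' (os @ o1))" using s assms(1) by (simp add: exec_def)
  finally show "reach (conf (Branch f # k) (\<sigma>, h) os) (conf k s' (os @ o1))" by simp
qed

lemma exec_Until_stop: "scan x h = a \<Longrightarrow> exec (Until a c) (\<sigma>, h) (\<sigma>, h) []"
  unfolding exec_def by (auto intro!: reach_step)

lemma exec_Until_loop: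
  assumes "scan x h \<noteq> a" "exec c (\<sigma>, h) s' o1" "exec (Until a c) s' s'' o2"
  shows "exec (Until a c) (\<sigma>, h) s'' (o1 @ o2)"
  unfolding exec_def
proof (intro impI conjI allI)
  assume s: "fits (\<sigma>, h)"
  with assms show "fits s''" by (simp add: exec_def)
  fix k os
  have "reach (conf (Until a c # k) (\<sigma>, h) os) (conf (c # Until a c # k) (\<sigma>, h) os)"
    using s assms(1) by (auto intro!: reach_step)
  also have "reach \<dots> (conf (Until a c # k) s' (os @ o1))" using s assms(2) by (simp add: exec_def)
  also have "reach \<dots> (conf k s'' ((os @ o1) @ o2))"
    using s assms by (simp add: exec_def del: append_assoc)
  finally show "reach (conf (Until a c # k) (\<sigma>, h) os) (conf k s'' (os @ o1 @ o2))" by simp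
qed

lemma exec_Inc:
  assumes "Suc (\<sigma> r) < 2 ^ B"
  shows "exec (Inc r) (\<sigma>, h) (\<sigma>(r := Suc (\<sigma> r)), h) []"
  unfolding exec_def
proof (intro impI conjI allI)
  assume s: "fits (\<sigma>, h)"
  then show "fits (\<sigma>(r := Suc (\<sigma> r)), h)" using assms by (auto simp: registers_fit_def)
  fix k os
  let ?w = "\<lambda>r. tape (\<sigma> r)" and ?w' = "\<lambda>r'. tape ((\<sigma>(r := Suc (\<sigma> r))) r')"
  have "reach (Inc r # k, 0, 0, h, ?w, os) (Inc r # k, 0, 1, h, ?w, os)"
    using s by (intro reach_step) auto
  also obtain q w' where *: "reach (Inc r # k, 0, 1, h, ?w, os) (Inc r # k, 1, q, h, ?w(r := w'), os)"
      "\<forall>i. w' (1 + i) = digit (Suc (\<sigma> r) div 2 ^ i)" "\<forall>i<1. w' i = ?w r i"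
    using s assms inc_sweep[of ?w r 1 "\<sigma> r" B h k os] by (auto simp: registers_fit_def)
  have "w' = tape (Suc (\<sigma> r))" using *(2,3) by (intro tape_eqI) auto
  then have w': "?w(r := w') = ?w'" by (auto simp: fun_eq_iff)
  note *(1)[unfolded w']
  also have "reach (Inc r # k, 1, q, h, ?w', os) (Inc r # k, 1, 0, h, ?w', os)"
    using s reach_pos[OF *(1)] by (intro reach_rewind) auto
  also have "reach \<dots> (k, 0, 0, h, ?w', os)" using s by (intro reach_step) auto
  finally show "reach (conf (Inc r # k) (\<sigma>, h) os) (conf k (\<sigma>(r := Suc (\<sigma> r)), h) (os @ []))"
    by simp
qed

lemma exec_Copy: "exec (Copy r s) (\<sigma>, h) (\<sigma>(r := \<sigma> s), h) []"
  unfolding exec_def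
proof (intro impI conjI allI)
  assume s: "fits (\<sigma>, h)"
  then show "fits (\<sigma>(r := \<sigma> s), h)" by (auto simp: registers_fit_def)
  fix k os
  let ?w = "\<lambda>r. tape (\<sigma> r)" and ?w' = "\<lambda>r'. tape ((\<sigma>(r := \<sigma> s)) r')"
  have "reach (Copy r s # k, 0, 0, h, ?w, os) (Copy r s # k, 0, 1, h, ?w, os)"
    using s by (intro reach_step) (auto simp: column_update fun_eq_iff)
  also obtain q w' where *: "reach (Copy r s # k, 0, 1, h, ?w, os) (Copy r s # k, 1, q, h, ?w(r := w'), os)"
      "\<forall>i. w' (1 + i) = digit (\<sigma> s div 2 ^ i)" "\<forall>i<1. w' i = ?w r i"
    using s copy_sweep[of ?w r 1 "\<sigma> r" s "\<sigma> s" B h k os] by (auto simp: registers_fit_def)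
  have "w' = tape (\<sigma> s)" using *(2,3) by (intro tape_eqI) auto
  then have w': "?w(r := w') = ?w'" by (auto simp: fun_eq_iff)
  note *(1)[unfolded w']
  also have "reach (Copy r s # k, 1, q, h, ?w', os) (Copy r s # k, 1, 0, h, ?w', os)"
    using s reach_pos[OF *(1)] by (intro reach_rewind) auto
  also have "reach \<dots> (k, 0, 0, h, ?w', os)" using s by (intro reach_step) auto
  finally show "reach (conf (Copy r s # k) (\<sigma>, h) os) (conf k (\<sigma>(r := \<sigma> s), h) (os @ []))"
    by simp
qed

lemma exec_Print: "exec (Print r) (\<sigma>, h) (\<sigma>, h) (enc_nat (\<sigma> r))"
  unfolding exec_def
proof (intro impI conjI allI)
  assume s: "fits (\<sigma>, h)"
  then show "fits (\<sigma>, h)" .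
  fix k os
  let ?w = "\<lambda>r. tape (\<sigma> r)" and ?os = "os @ enc_nat (\<sigma> r)"
  have "reach (Print r # k, 0, 0, h, ?w, os) (Print r # k, 0, 1, h, ?w, os)"
    using s by (intro reach_step) auto
  also obtain q where *: "reach (Print r # k, 0, 1, h, ?w, os) (Print r # k, 1, q, h, ?w, ?os)"
    using s print_sweep[of ?w r 1 "\<sigma> r" B h k os] by (auto simp: registers_fit_def)
  note *(1)
  also have "reach (Print r # k, 1, q, h, ?w, ?os) (Print r # k, 1, 0, h, ?w, ?os)"
    using s reach_pos[OF *(1)] by (intro reach_rewind) auto
  also have "reach \<dots> (k, 0, 0, h, ?w, ?os)" using s by (intro reach_step) auto
  finally show "reach (conf (Print r # k) (\<sigma>, h) os) (conf k (\<sigma>, h) ?os)" by simp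
qed

lemma reach_While:
  assumes s: "fits (\<sigma>, h)"
  shows "reach (conf (While r s c # k) (\<sigma>, h) os)
    (conf (if \<sigma> r = \<sigma> s then k else c # While r s c # k) (\<sigma>, h) os)"
proof -
  let ?w = "\<lambda>r. tape (\<sigma> r)" and ?ph = "if \<sigma> r = \<sigma> s then 1 else 2 :: nat"
  have "reach (While r s c # k, 0, 0, h, ?w, os) (While r s c # k, 0, 1, h, ?w, os)"
    using s by (intro reach_step) auto
  also obtain q where *: "reach (While r s c # k, 0, 1, h, ?w, os) (While r s c # k, ?ph, q, h, ?w, os)"
    using s while_sweep[of ?w r 1 "\<sigma> r" s "\<sigma> s" B h c k os] by (fastforce simp: registers_fit_def)
  note *(1)
  also have "reach (While r s c # k, ?ph, q, h, ?w, os) (While r s c # k, ?ph, 0, h, ?w, os)"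
    using s reach_pos[OF *(1)] by (intro reach_rewind) auto
  also have "reach \<dots> (if \<sigma> r = \<sigma> s then k else c # While r s c # k, 0, 0, h, ?w, os)"
    using s by (intro reach_step) auto
  finally show ?thesis by simp
qed

lemma exec_While_stop: "\<sigma> r = \<sigma> s \<Longrightarrow> exec (While r s c) (\<sigma>, h) (\<sigma>, h) []"
  unfolding exec_def using reach_While[of \<sigma> h r s c] by auto

lemma exec_While_loop:
  assumes "\<sigma> r \<noteq> \<sigma> s" "exec c (\<sigma>, h) s' o1" "exec (While r s c) s' s'' o2"
  shows "exec (While r s c) (\<sigma>, h) s'' (o1 @ o2)"
  unfolding exec_def
proof (intro impI conjI allI)
  assume s: "fits (\<sigma>, h)"
  with assms show "fits s''" by (simp add: exec_def)
  fix k os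
  have "reach (conf (While r s c # k) (\<sigma>, h) os) (conf (c # While r s c # k) (\<sigma>, h) os)"
    using reach_While[OF s, of r s c k os] assms(1) by simp
  also have "reach \<dots> (conf (While r s c # k) s' (os @ o1))" using s assms(2) by (simp add: exec_def)
  also have "reach \<dots> (conf k s'' ((os @ o1) @ o2))"
    using s assms by (simp add: exec_def del: append_assoc)
  finally show "reach (conf (While r s c # k) (\<sigma>, h) os) (conf k s'' (os @ o1 @ o2))" by simp
qed

text \<open>The family \<open>\<sigma>\<close> plays the part of a loop invariant:
  \<open>\<sigma> v\<close> is the state before round \<open>v\<close>.\<close>

lemma exec_While:
  assumes "a \<le> b" and "\<And>v. a \<le> v \<Longrightarrow> v < b \<Longrightarrow> \<sigma> v r \<noteq> \<sigma> v s"
    and "\<And>v. a \<le> v \<Longrightarrow> v < b \<Longrightarrow> exec c (\<sigma> v, h) (\<sigma> (Suc v), h) (os v)"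
    and "\<sigma> b r = \<sigma> b s"
  shows "exec (While r s c) (\<sigma> a, h) (\<sigma> b, h) (concat (map os [a..<b]))"
  using assms
proof (induction a rule: inc_induct)
  case base
  then show ?case by (simp add: exec_While_stop)
next
  case (step v)
  then have "exec (While r s c) (\<sigma> v, h) (\<sigma> b, h) (os v @ concat (map os [Suc v..<b]))"
    by (intro exec_While_loop) auto
  then show ?case using step.hyps by (simp add: upt_rec)
qed

lemma exec_Until:
  assumes "m \<le> n" and "\<And>v. m \<le> v \<Longrightarrow> v < n \<Longrightarrow> scan x (h v) \<noteq> a"
    and "\<And>v. m \<le> v \<Longrightarrow> v < n \<Longrightarrow> exec c (\<sigma> v, h v) (\<sigma> (Suc v), h (Suc v)) (os v)"
    and "scan x (h n) = a"
  shows "exec (Until a c) (\<sigma> m, h m) (\<sigma> n, h n) (concat (map os [m..<n]))"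
  using assms
proof (induction m rule: inc_induct)
  case base
  then show ?case by (simp add: exec_Until_stop)
next
  case (step v)
  then have "exec (Until a c) (\<sigma> v, h v) (\<sigma> n, h n) (os v @ concat (map os [Suc v..<n]))"
    by (intro exec_Until_loop) auto
  then show ?case using step.hyps by (simp add: upt_rec)
qed

end

section \<open>Compilation into a Turing machine\<close>

lemma UNIV_input_symbol: "UNIV = {Left_End, Bit False, Bit True, Right_End}"
proof -
  have "a \<in> {Left_End, Bit False, Bit True, Right_End}" for a
    by (cases a) auto
  then show ?thesis by blast
qed

text \<open>The stacks that can occur while \<open>c\<close> runs on top of \<open>k\<close>, before
  \<open>k\<close> alone is left. A loop pushes its body onto the very stack it came from, so there
  are finitely many, and stacks can be states of a machine.\<close>

primrec conts :: "'r com \<Rightarrow> 'r com list \<Rightarrow> 'r com list set" where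
  "conts Init k = {Init # k}"
| "conts Skip k = {Skip # k}"
| "conts (Emit b) k = {Emit b # k}"
| "conts (Print r) k = {Print r # k}"
| "conts (Inc r) k = {Inc r # k}"
| "conts (Copy r s) k = {Copy r s # k}"
| "conts (Head d) k = {Head d # k}"
| "conts (Seq c c') k = insert (Seq c c' # k) (conts c (c' # k) \<union> conts c' k)"
| "conts (While r s c) k = insert (While r s c # k) (conts c (While r s c # k))"
| "conts (Until a c) k = insert (Until a c # k) (conts c (Until a c # k))"
| "conts (Branch f) k = insert (Branch f # k) (\<Union>a. conts (f a) k)"

lemma finite_conts: "finite (conts c k)"
  by (induction c arbitrary: k) (auto simp: UNIV_input_symbol)

lemma conts_self: "c # k \<in> conts c k"
  by (cases c) auto

lemma conts_closed: "k' \<in> conts c k \<Longrightarrow> fst (fst (ctrl k' ph a u)) \<in> insert k (conts c k)"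
proof (induction c arbitrary: k)
  case (Seq c1 c2)
  then show ?case using conts_self[of c1 "c2 # k"] conts_self[of c2 k] by fastforce
next
  case (While r s c)
  show ?case
  proof (cases "k' = While r s c # k")
    case True
    then show ?thesis using conts_self[of c "While r s c # k"] by auto
  next
    case False
    then have "k' \<in> conts c (While r s c # k)" using While.prems by simp
    from While.IH[OF this] show ?thesis by auto
  qed
next
  case (Until b c)
  show ?case
  proof (cases "k' = Until b c # k")
    case True
    then show ?thesis using conts_self[of c "Until b c # k"] by auto
  next
    case False
    then have "k' \<in> conts c (Until b c # k)" using Until.prems by simp
    from Until.IH[OF this] show ?thesis by auto
  qed
next
  case (Branch f)
  then show ?case using conts_self[of _ k] by fastforce
qed auto

lemma ctrl_phase: "ph \<le> 2 \<Longrightarrow> snd (fst (ctrl k ph a u)) \<le> 2"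
  by (cases "(k, ph, a, u)" rule: ctrl.cases) auto

lemma ctrl_symbols:
  assumes "\<And>r. u r < 4"
  shows "fst (snd (snd (ctrl k ph a u))) r < 4"
  using assms by (cases "(k, ph, a, u)" rule: ctrl.cases) auto

lemma reach_finite:
  assumes "reach x B c c'"
  shows "\<exists>t. (astep x ^^ t) c = c' \<and> (\<forall>i \<le> t. pos ((astep x ^^ i) c) \<le> B + 1)"
  using assms
proof (induction rule: reach.induct)
  case (refl c)
  then show ?case by (intro exI[of _ 0]) auto
next
  case (step c c')
  then obtain t where "(astep x ^^ t) (astep x c) = c'"
    "\<forall>i \<le> t. pos ((astep x ^^ i) (astep x c)) \<le> B + 1" by auto
  moreover from this have "pos ((astep x ^^ i) c) \<le> B + 1" if "i \<le> Suc t" for i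
    using step.hyps(1) that by (cases i) (simp_all add: funpow_swap1)
  ultimately show ?case by (intro exI[of _ "Suc t"]) (auto simp: funpow_swap1)
qed

lemma exec_logspace_computable:
  fixes prog :: "'r::finite com"
  assumes exec: "\<And>x. \<exists>s. exec x (B x) prog (\<lambda>_. 0, 0) s (f x)"
    and bound: "\<And>x. real (B x + 1) \<le> real c * log 2 (real (length x + 1)) + real c"
  shows "logspace_computable f"
proof -
  let ?P = "Seq Init prog"
  define CS where "CS = insert [] (conts ?P []) \<times> {..2::nat}"
  have "finite CS" by (auto simp: CS_def finite_conts)
  then obtain code where code: "bij_betw code CS {0..<card CS}"
    using ex_bij_betw_finite_nat by blast
  obtain rs :: "'r list" where rs: "set rs = UNIV" using finite_list[OF finite] by blast
  then have "\<forall>r. \<exists>i. i < length rs \<and> rs ! i = r" by (metis UNIV_I in_set_conv_nth)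
  then obtain idx where idx: "\<And>r. idx r < length rs" "\<And>r. rs ! idx r = r" by metis
  \<comment> \<open>Each register is a work tape, and a state is the code of a stack with a phase.
    The additional state \<open>card CS\<close> is there only to be a rejecting state different from
    the accepting one; no run enters it.\<close>
  define M where "M = \<lparr>work_tapes = length rs, states = Suc (card CS), symbols = 4,
    start = code ([?P], 0), accept = code ([], 0), reject = card CS,
    delta = (\<lambda>q a ss. if q < card CS then
        (case inv_into CS code q of (k, ph) \<Rightarrow> case ctrl k ph a (\<lambda>r. ss ! idx r) of
          (q', d, u, e, b) \<Rightarrow> (code q', d, map (\<lambda>r. (u r, e)) rs, b))
      else (q, Stay, map (\<lambda>s. (s, Stay)) ss, None))\<rparr>"
  have code_less: "code q < card CS" if "q \<in> CS" for q
    using code that by (auto simp: bij_betw_def)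
  have code_inv: "inv_into CS code (code q) = q" if "q \<in> CS" for q
    using code that by (auto simp: bij_betw_def)
  have code_inj: "code q = code q' \<longleftrightarrow> q = q'" if "q \<in> CS" "q' \<in> CS" for q q'
    using code that by (auto simp: bij_betw_def inj_on_def)
  have CS: "([?P], 0) \<in> CS" "([], 0) \<in> CS" by (auto simp: CS_def)
  have ctrl_CS: "fst (ctrl k ph a u) \<in> CS" if "(k, ph) \<in> CS" for k ph a u
  proof -
    from that have k: "k = [] \<or> k \<in> conts ?P []" and ph: "ph \<le> 2" by (auto simp: CS_def)
    have "fst (fst (ctrl k ph a u)) \<in> insert [] (conts ?P [])"
      using k conts_closed[of k ?P "[]" ph a u] by (cases "k = []") auto
    with ctrl_phase[OF ph] show ?thesis by (auto simp: CS_def mem_Times_iff simp del: conts.simps)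
  qed
  have machine: "is_machine M"
    unfolding is_machine_def
  proof (intro conjI allI impI)
    show "start M < states M" "accept M < states M" "accept M \<noteq> reject M"
      using code_less[OF CS(1)] code_less[OF CS(2)] by (auto simp: M_def)
    fix q i ss
    assume *: "q < states M \<and> length ss = work_tapes M \<and> (\<forall>s \<in> set ss. s < symbols M)"
    show "case delta M q i ss of (q', d, ws, b) \<Rightarrow>
      q' < states M \<and> length ws = work_tapes M \<and> (\<forall>(s, _) \<in> set ws. s < symbols M)"
    proof (cases "q < card CS")
      case True
      obtain k ph where q: "inv_into CS code q = (k, ph)" by (cases "inv_into CS code q")
      have CSk: "(k, ph) \<in> CS"
        using True code q by (metis atLeastLessThan_iff bij_betw_def inv_into_into le0)
      have "ss ! idx r < 4" for r using * idx(1) by (auto simp: M_def)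
      then have "fst (snd (snd (ctrl k ph i (\<lambda>r. ss ! idx r)))) r < 4" for r
        by (rule ctrl_symbols)
      then show ?thesis
        using True q code_less[OF ctrl_CS[OF CSk, of i "\<lambda>r. ss ! idx r"]]
        by (auto simp: M_def split: prod.splits)
    qed (use * in \<open>auto simp: M_def\<close>)
  qed (auto simp: M_def)
  define rep where "rep = (\<lambda>(k, ph, p, h, w :: 'r \<Rightarrow> nat \<Rightarrow> nat, os).
    \<lparr>state = code (k, ph), input_head = h, work = map (\<lambda>r. (p :: nat, w r)) rs, out = os\<rparr>)"
  define good where "good = (\<lambda>x :: bool list. \<lambda>(k, ph, p :: nat, h, w :: 'r \<Rightarrow> nat \<Rightarrow> nat, os :: bool list).
    (k, ph) \<in> CS \<and> h \<le> length x + 1)"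
  have step: "good x (astep x c) \<and> step M x (rep c) = rep (astep x c)" if c: "good x c" for x c
  proof -
    obtain k ph p h w os where [simp]: "c = (k, ph, p, h, w, os)" by (cases c)
    have CSk: "(k, ph) \<in> CS" and h: "h \<le> length x + 1" using c by (auto simp: good_def)
    obtain k' ph' d u e b where ctrl: "ctrl k ph (scan x h) (\<lambda>r. w r p) = ((k', ph'), d, u, e, b)"
      by (cases "ctrl k ph (scan x h) (\<lambda>r. w r p)") auto
    have 1: "good x (astep x c)"
      using ctrl_CS[OF CSk, of "scan x h" "\<lambda>r. w r p"] by (auto simp: ctrl good_def)
    show ?thesis
    proof (cases "(k, ph) = ([], 0)")
      case True
      then have "halted M (rep c)" by (auto simp: rep_def halted_def M_def)
      moreover have "astep x c = c" using True h by auto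
      ultimately show ?thesis using 1 by (simp add: Defs.step_def)
    next
      case False
      have col: "(\<lambda>r. map (\<lambda>(p, w). w p) (work (rep c)) ! idx r) = (\<lambda>r. w r p)"
        using idx by (auto simp: rep_def)
      have nh: "\<not> halted M (rep c)"
        using code_less[OF CSk] code_inj[OF CSk CS(2)] False by (auto simp: rep_def halted_def M_def)
      have "delta M (state (rep c)) (scan x (input_head (rep c))) (map (\<lambda>(p, w). w p) (work (rep c))) =
          (code (k', ph'), d, map (\<lambda>r. (u r, e)) rs, b)"
        using code_less[OF CSk] code_inv[OF CSk] col ctrl by (auto simp: M_def rep_def)
      then show ?thesis using 1 nh ctrl
        by (auto simp: Defs.step_def rep_def zip_map1 zip_map2 zip_same_conv_map comp_def)
    qed
  qed
  let ?c0 = "([?P], 0, 0, 0, \<lambda>_ _. 0, []) :: 'r conf"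
  have run: "good x ((astep x ^^ t) ?c0) \<and> run M x t = rep ((astep x ^^ t) ?c0)" for x t
  proof (induction t)
    case 0
    show ?case using CS by (auto simp: run_def initial_def good_def rep_def M_def map_replicate_const)
  next
    case (Suc t)
    then show ?case using step[of x "(astep x ^^ t) ?c0"] by (simp add: run_def)
  qed
  show ?thesis
    unfolding logspace_computable_def
  proof (rule exI[of _ M], rule exI[of _ c], rule conjI[OF machine], rule allI, rule conjI[OF _ allI])
    fix x
    obtain \<sigma> h where ex: "exec x (B x) prog (\<lambda>_. 0, 0) (\<sigma>, h) (f x)" using exec[of x] by fast
    then have fin: "\<forall>k os. reach x (B x) (conf (prog # k) (\<lambda>_. 0, 0) os) (conf k (\<sigma>, h) (os @ f x))"
      by (simp add: exec_def registers_fit_def)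
    have "reach x (B x) ?c0 ([Init, prog], 0, 0, 0, \<lambda>_ _. 0, [])"
      by (intro reach_step) auto
    also have "reach x (B x) \<dots> (conf [prog] (\<lambda>_. 0, 0) [])"
      by (intro reach_step) (auto simp: fun_eq_iff tape_def)
    also have "reach x (B x) \<dots> (conf [] (\<sigma>, h) ([] @ f x))"
      using spec[OF spec[OF fin, of "[]"], of "[]"] .
    finally have "reach x (B x) ?c0 (conf [] (\<sigma>, h) (f x))" by (simp only: append_Nil)
    from reach_finite[OF this] obtain T where T: "(astep x ^^ T) ?c0 = conf [] (\<sigma>, h) (f x)"
      "\<And>i. i \<le> T \<Longrightarrow> pos ((astep x ^^ i) ?c0) \<le> B x + 1"
      by blast
    have "h \<le> length x + 1" using ex by (simp add: exec_def registers_fit_def)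
    then have fixed: "(astep x ^^ i) (conf [] (\<sigma>, h) (f x)) = conf [] (\<sigma>, h) (f x)" for i
      by (induction i) auto
    \<comment> \<open>The space bound is demanded at all times. After the halt the configuration no
      longer changes, so times beyond \<open>T\<close> add nothing.\<close>
    have pos: "pos ((astep x ^^ t) ?c0) \<le> B x + 1" for t
    proof (cases "t \<le> T")
      case False
      then have "(astep x ^^ t) ?c0 = (astep x ^^ (t - T)) ((astep x ^^ T) ?c0)"
        using fun_cong[OF funpow_add[of "t - T" T "astep x"], of ?c0] by simp
      then have "(astep x ^^ t) ?c0 = conf [] (\<sigma>, h) (f x)" by (simp only: T(1) fixed)
      then show ?thesis by simp
    next
      case True
      then show ?thesis by (rule T(2))
    qed
    show "\<exists>t. halted M (run M x t) \<and> out (run M x t) = f x"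
      using run[of x T] T(1) by (intro exI[of _ T]) (auto simp: rep_def halted_def M_def)
    fix t
    show "\<forall>(p, _) \<in> set (work (run M x t)). real p \<le> real c * log 2 (real (length x + 1)) + real c"
    proof -
      obtain k ph p h w os where c: "(astep x ^^ t) ?c0 = (k, ph, p, h, w, os)"
        by (cases "(astep x ^^ t) ?c0")
      then have "real p \<le> real (B x + 1)" using pos[of t] by simp
      also note bound
      finally show ?thesis using run[of x t] c by (auto simp: rep_def)
    qed
  qed
qed

section \<open>Horn clauses describing a computation\<close>

text \<open>The heads stand on different cells, and a transition depends on all symbols read. A
  clause naming all these cells would need one cell variable per tape. \<open>Rd\<close> therefore
  reports the symbol read by one tape without its cell, and \<open>Act\<close> joins the state and
  all symbols read into a single fact about the time; every clause then gets by with
  \<open>p\<close> and \<open>p'\<close>.\<close>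

datatype pred =
    Zero
  | Succ
  | Inp
  | St nat
  | Act nat "nat list"
  | Rd nat nat
  | Hd nat
  | Rt nat
  | Lt nat
  | Cell nat nat

instance pred :: countable by countable_datatype

type_synonym 'b clause = "(pred \<times> 'b list) list \<times> (pred \<times> 'b list) option"

fun insym :: "input_symbol \<Rightarrow> nat" where
  "insym Left_End = 0"
| "insym (Bit b) = (if b then 2 else 1)"
| "insym Right_End = 3"

definition outsym :: "nat \<Rightarrow> input_symbol" where
  "outsym s = (if s = 0 then Left_End else if s = 3 then Right_End else Bit (s = 2))"

lemma outsym_insym [simp]: "outsym (insym a) = a"
  by (cases a) (auto simp: outsym_def)

lemma insym_less: "insym a < 4"
  by (cases a) auto

lemma insym_eq_3 [simp]: "insym a = 3 \<longleftrightarrow> a = Right_End"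
  by (cases a) auto

text \<open>
  Tape 0 is the input tape. A head on the right end marker must not move right, which replaces the
  clamping in \<^const>\<open>step\<close>; a halted configuration repeats itself.
\<close>

definition action :: "machine \<Rightarrow> nat \<Rightarrow> nat list \<Rightarrow> nat \<times> (nat \<times> direction) list" where
  "action M q ss =
     (if q = accept M \<or> q = reject M then (q, map (\<lambda>s. (s, Stay)) ss)
      else case delta M q (outsym (hd ss)) (tl ss) of (q', d, ws, b) \<Rightarrow>
        (q', (hd ss, if hd ss = 3 \<and> d = Go_Right then Stay else d) # ws))"

text \<open>The second clause for \<open>Go_Left\<close> covers the move at cell 0, which leaves the
  head in place.\<close>

fun move_clauses :: "nat \<Rightarrow> (pred \<times> 'b list) list \<Rightarrow> 'b \<Rightarrow> 'b \<Rightarrow> 'b \<Rightarrow> 'b \<Rightarrow> direction \<Rightarrow> 'b clause list" where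
  "move_clauses j As t t' p p' Stay = [(As @ [(Hd j, [t, p])], Some (Hd j, [t', p]))]"
| "move_clauses j As t t' p p' Go_Right =
     [(As @ [(Hd j, [t, p]), (Succ, [p, p'])], Some (Hd j, [t', p']))]"
| "move_clauses j As t t' p p' Go_Left =
     [(As @ [(Hd j, [t, p']), (Succ, [p, p'])], Some (Hd j, [t', p])),
      (As @ [(Hd j, [t, p]), (Zero, [p])], Some (Hd j, [t', p]))]"

definition action_clauses :: "machine \<Rightarrow> 'b \<Rightarrow> 'b \<Rightarrow> 'b \<Rightarrow> 'b \<Rightarrow> nat \<times> nat list \<Rightarrow> 'b clause list" where
  "action_clauses M t t' p p' = (\<lambda>(q, ss).
     let (q', ws) = action M q ss; As = [(Act q ss, [t]), (Succ, [t, t'])] in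
     ((St q, [t]) # map (\<lambda>j. (Rd j (ss ! j), [t])) [0..<Suc (work_tapes M)], Some (Act q ss, [t])) #
     (As, Some (St q', [t'])) #
     concat (map (\<lambda>j. (As @ [(Hd j, [t, p])], Some (Cell j (fst (ws ! j)), [t', p])) #
       move_clauses j As t t' p p' (snd (ws ! j))) [0..<Suc (work_tapes M)]))"

text \<open>Tape 0 needs the four codes of \<open>insym\<close>, the work tapes the symbols of
  \<open>M\<close>.\<close>

definition alphabet :: "machine \<Rightarrow> nat" where
  "alphabet M = max 4 (symbols M)"

definition cell_clauses :: "nat \<Rightarrow> 'b \<Rightarrow> 'b \<Rightarrow> 'b \<Rightarrow> nat \<Rightarrow> 'b clause list" where
  "cell_clauses j t t' p s =
     [([(Hd j, [t, p]), (Cell j s, [t, p])], Some (Rd j s, [t])),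
      ([(Rt j, [t, p]), (Cell j s, [t, p]), (Succ, [t, t'])], Some (Cell j s, [t', p])),
      ([(Lt j, [t, p]), (Cell j s, [t, p]), (Succ, [t, t'])], Some (Cell j s, [t', p]))]"

definition tape_clauses :: "machine \<Rightarrow> 'b \<Rightarrow> 'b \<Rightarrow> 'b \<Rightarrow> 'b \<Rightarrow> nat \<Rightarrow> 'b clause list" where
  "tape_clauses M t t' p p' j =
     ([(Zero, [t]), (Zero, [p])], Some (Hd j, [t, p])) #
     (if j = 0 then [] else [([(Zero, [t])], Some (Cell j 0, [t, p]))]) @
     [([(Hd j, [t, p]), (Succ, [p, p'])], Some (Rt j, [t, p'])),
      ([(Rt j, [t, p]), (Succ, [p, p'])], Some (Rt j, [t, p'])),
      ([(Hd j, [t, p']), (Succ, [p, p'])], Some (Lt j, [t, p])),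
      ([(Lt j, [t, p']), (Succ, [p, p'])], Some (Lt j, [t, p]))] @
     concat (map (cell_clauses j t t' p) [0..<alphabet M])"

text \<open>The parameter \<open>z\<close> names input position 0. It is separate from
  \<open>t\<close> and \<open>p\<close> because positions are coded differently from times and
  cells.\<close>

definition run_clauses :: "machine \<Rightarrow> 'b \<Rightarrow> 'b \<Rightarrow> 'b \<Rightarrow> 'b \<Rightarrow> 'b \<Rightarrow> 'b clause list" where
  "run_clauses M z t t' p p' =
     [([(Zero, [t])], Some (St (start M), [t])),
      ([(Zero, [p])], Some (Inp, [z, p])),
      ([(St (accept M), [t])], None)] @
     concat (map (tape_clauses M t t' p p') [0..<Suc (work_tapes M)]) @
     concat (map (action_clauses M t t' p p')
       (List.product [0..<states M] (List.n_lists (Suc (work_tapes M)) [0..<alphabet M])))"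

definition input_clauses :: "'b \<Rightarrow> 'b \<Rightarrow> 'b \<Rightarrow> 'b \<Rightarrow> 'b \<Rightarrow> input_symbol \<Rightarrow> 'b clause list" where
  "input_clauses i i' t p p' a =
     [([(Inp, [i, p]), (Succ, [p, p'])], Some (Inp, [i', p'])),
      ([(Inp, [i, p]), (Zero, [t])], Some (Cell 0 (insym a), [t, p]))]"

text \<open>\<open>G\<close> stands for falsity, the conclusion \<open>None\<close>. With
  \<open>G\<close> false this is truth of a clause in the run; with \<open>G\<close> the
  derivability of \<open>Bot\<close> it is closure of derivability under the clause. Both halves of
  the reduction thus use one notion.\<close>

definition sat :: "(pred \<Rightarrow> 'b list \<Rightarrow> bool) \<Rightarrow> bool \<Rightarrow> 'b clause \<Rightarrow> bool" where
  "sat I G = (\<lambda>(As, B). (\<forall>(P, as) \<in> set As. I P as) \<longrightarrow>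
     (case B of None \<Rightarrow> G | Some (P, as) \<Rightarrow> I P as))"

section \<open>The run as a model of the clauses\<close>

context
  fixes M :: machine and x :: "bool list"
  assumes M: "is_machine M"
begin

definition run_state :: "nat \<Rightarrow> nat" where
  "run_state t = state (run M x t)"

definition run_head :: "nat \<Rightarrow> nat \<Rightarrow> nat" where
  "run_head j t = (if j = 0 then input_head (run M x t) else fst (work (run M x t) ! (j - 1)))"

definition run_cell :: "nat \<Rightarrow> nat \<Rightarrow> nat \<Rightarrow> nat" where
  "run_cell j t p = (if j = 0 then insym (scan x p) else snd (work (run M x t) ! (j - 1)) p)"

definition run_read :: "nat \<Rightarrow> nat list" where
  "run_read t = map (\<lambda>j. run_cell j t (run_head j t)) [0..<Suc (work_tapes M)]"

lemma delta_invariant: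
  assumes "delta M q a ss = (q', d, ws, b)" "q < states M" "length ss = work_tapes M" "\<forall>s \<in> set ss. s < symbols M"
  shows "q' < states M" "length ws = work_tapes M" "\<forall>(s, _) \<in> set ws. s < symbols M"
proof -
  have "case delta M q a ss of (q', d, ws, b) \<Rightarrow>
      q' < states M \<and> length ws = work_tapes M \<and> (\<forall>(s, _) \<in> set ws. s < symbols M)"
    using M[unfolded is_machine_def] assms(2-4) by simp
  then show "q' < states M" "length ws = work_tapes M" "\<forall>(s, _) \<in> set ws. s < symbols M"
    by (auto simp: assms(1))
qed

lemma run_invariant:
  "run_state t < states M \<and> length (work (run M x t)) = work_tapes M \<and>
   (\<forall>(p, w) \<in> set (work (run M x t)). \<forall>q. w q < symbols M) \<and> input_head (run M x t) \<le> length x + 1"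
proof (induction t)
  case 0
  show ?case using M by (auto simp: run_state_def run_def initial_def is_machine_def)
next
  case (Suc t)
  let ?c = "run M x t"
  obtain q d ws b where del: "delta M (state ?c) (scan x (input_head ?c)) (map (\<lambda>(p, w). w p) (work ?c)) =
      (q, d, ws, b)" by (metis prod_cases4)
  have "\<forall>s \<in> set (map (\<lambda>(p, w). w p) (work ?c)). s < symbols M" using Suc by auto
  then have *: "q < states M" "length ws = work_tapes M" "\<forall>(s, _) \<in> set ws. s < symbols M"
    using delta_invariant[OF del] Suc by (auto simp: run_state_def)
  have st: "run M x (Suc t) = step M x ?c" by (simp add: run_def)
  show ?case
  proof (cases "halted M ?c")
    case True
    then have "run M x (Suc t) = ?c" by (simp add: st step_def)
    then show ?thesis using Suc by (simp add: run_state_def)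
  next
    case False
    have "w q < symbols M" if "(p, w) \<in> set (map2 (\<lambda>(s, d') (p, w). (move d' p, w(p := s))) ws (work ?c))" for p w q
    proof -
      from that obtain s d' p' w' where "(s, d') \<in> set ws" "(p', w') \<in> set (work ?c)" "w = w'(p' := s)"
        by (auto elim!: in_set_zipE)
      then show ?thesis using *(3) Suc by auto
    qed
    then show ?thesis using * Suc False
      by (auto simp: run_state_def st step_def del simp del: set_map)
  qed
qed

lemma run_read_simps [simp]:
  "length (run_read t) = Suc (work_tapes M)"
  "j \<le> work_tapes M \<Longrightarrow> run_read t ! j = run_cell j t (run_head j t)"
  "hd (run_read t) = insym (scan x (input_head (run M x t)))"
  by (auto simp: run_read_def nth_append le_less hd_append run_cell_def run_head_def hd_map
    simp del: upt_Suc)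

lemma tl_run_read: "tl (run_read t) = map (\<lambda>(p, w). w p) (work (run M x t))"
  using run_invariant[of t]
  by (intro nth_equalityI) (auto simp: nth_tl run_cell_def run_head_def split: prod.splits)

lemma run_cell_less: "j \<le> work_tapes M \<Longrightarrow> run_cell j t p < alphabet M"
proof -
  assume "j \<le> work_tapes M"
  then have "snd (work (run M x t) ! (j - 1)) p < symbols M" if "j \<noteq> 0"
    using run_invariant[of t] that nth_mem[of "j - 1" "work (run M x t)"]
    by (fastforce split: prod.splits)
  then show ?thesis using insym_less[of "scan x p"] by (auto simp: run_cell_def alphabet_def less_max_iff_disj)
qed

lemma run_start: "run_state 0 = start M" "j \<le> work_tapes M \<Longrightarrow> run_head j 0 = 0"
  "0 < j \<Longrightarrow> j \<le> work_tapes M \<Longrightarrow> run_cell j 0 p = 0"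
  by (auto simp: run_state_def run_head_def run_cell_def run_def initial_def)

lemma run_action:
  assumes "action M (run_state t) (run_read t) = (q', ws)"
  shows "run_state (Suc t) = q'"
    and "j \<le> work_tapes M \<Longrightarrow> run_head j (Suc t) = move (snd (ws ! j)) (run_head j t)"
    and "j \<le> work_tapes M \<Longrightarrow>
      run_cell j (Suc t) p = (if p = run_head j t then fst (ws ! j) else run_cell j t p)"
proof -
  let ?c = "run M x t"
  have st: "run M x (Suc t) = step M x ?c" by (simp add: run_def)
  have "run_state (Suc t) = q' \<and> (j \<le> work_tapes M \<longrightarrow>
    run_head j (Suc t) = move (snd (ws ! j)) (run_head j t) \<and>
    run_cell j (Suc t) p = (if p = run_head j t then fst (ws ! j) else run_cell j t p))" for j p
  proof (cases "halted M ?c")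
    case True
    then have "run M x (Suc t) = ?c" by (simp add: st step_def)
    moreover have "q' = run_state t" "ws = map (\<lambda>s. (s, Stay)) (run_read t)"
      using True assms by (auto simp: action_def run_state_def halted_def)
    ultimately show ?thesis by (auto simp: run_state_def run_head_def run_cell_def)
  next
    case False
    obtain d vs b where del: "delta M (state ?c) (scan x (input_head ?c)) (map (\<lambda>(p, w). w p) (work ?c)) =
        (q', d, vs, b)"
      and ws: "ws = (insym (scan x (input_head ?c)),
        if scan x (input_head ?c) = Right_End \<and> d = Go_Right then Stay else d) # vs"
      using False assms by (auto simp: action_def run_state_def halted_def tl_run_read split: prod.splits)
    have "\<forall>s \<in> set (map (\<lambda>(p, w). w p) (work ?c)). s < symbols M" using run_invariant[of t] by auto
    then have len: "length vs = work_tapes M"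
      using delta_invariant(2)[OF del] run_invariant[of t] by (simp add: run_state_def)
    have new: "run M x (Suc t) = \<lparr>state = q', input_head = min (move d (input_head ?c)) (length x + 1),
        work = map2 (\<lambda>(s, d') (p, w). (move d' p, w(p := s))) vs (work ?c),
        out = out ?c @ (case b of None \<Rightarrow> [] | Some b' \<Rightarrow> [b'])\<rparr>"
      using False by (simp add: st step_def del)
    show ?thesis
    proof (cases j)
      case 0
      have "input_head ?c \<le> length x + 1" using run_invariant[of t] by blast
      then have "min (move d (input_head ?c)) (length x + 1) =
          move (if scan x (input_head ?c) = Right_End \<and> d = Go_Right then Stay else d) (input_head ?c)"
        by (cases d) (auto simp: scan_def)
      then show ?thesis
        using 0 by (simp add: new run_state_def run_head_def run_cell_def ws)
    next
      case (Suc i)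
      then show ?thesis using len run_invariant[of t]
        by (auto simp: new run_state_def run_head_def run_cell_def ws split: prod.splits)
    qed
  qed
  then show "run_state (Suc t) = q'"
    "j \<le> work_tapes M \<Longrightarrow> run_head j (Suc t) = move (snd (ws ! j)) (run_head j t)"
    "j \<le> work_tapes M \<Longrightarrow>
      run_cell j (Suc t) p = (if p = run_head j t then fst (ws ! j) else run_cell j t p)"
    by blast+
qed

fun run_holds :: "pred \<Rightarrow> nat list \<Rightarrow> bool" where
  "run_holds Zero [a] \<longleftrightarrow> a = 0"
| "run_holds Succ [a, b] \<longleftrightarrow> b = Suc a"
| "run_holds Inp [i, p] \<longleftrightarrow> i = p"
| "run_holds (St q) [t] \<longleftrightarrow> run_state t = q"
| "run_holds (Act q ss) [t] \<longleftrightarrow> run_state t = q \<and> run_read t = ss"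
| "run_holds (Rd j s) [t] \<longleftrightarrow> run_cell j t (run_head j t) = s"
| "run_holds (Hd j) [t, p] \<longleftrightarrow> run_head j t = p"
| "run_holds (Rt j) [t, p] \<longleftrightarrow> run_head j t < p"
| "run_holds (Lt j) [t, p] \<longleftrightarrow> p < run_head j t"
| "run_holds (Cell j s) [t, p] \<longleftrightarrow> run_cell j t p = s"
| "run_holds _ _ \<longleftrightarrow> False"

lemma tape_clauses_sound:
  assumes "j \<le> work_tapes M" and "c \<in> set (tape_clauses M t t' p p' j)"
  shows "sat run_holds False c"
proof -
  have "run_cell j (Suc t) p = run_cell j t p" if "p \<noteq> run_head j t" for p
    using run_action(3)[OF prod.collapse[symmetric] assms(1)] that by auto
  then show ?thesis
    using assms by (auto simp: tape_clauses_def cell_clauses_def sat_def run_start split: if_splits)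
qed

lemma action_clauses_sound:
  assumes "length (snd a) = Suc (work_tapes M)" and "c \<in> set (action_clauses M t t' p p' a)"
  shows "sat run_holds False c"
proof -
  obtain q ss where a: "a = (q, ss)" by (cases a)
  obtain q' ws where act: "action M q ss = (q', ws)" by (cases "action M q ss")
  let ?As = "[(Act q ss, [t]), (Succ, [t, t'])]"
  from assms(2) consider
    "c = ((St q, [t]) # map (\<lambda>j. (Rd j (ss ! j), [t])) [0..<Suc (work_tapes M)], Some (Act q ss, [t]))"
    | "c = (?As, Some (St q', [t']))"
    | j where "j \<le> work_tapes M" "c = (?As @ [(Hd j, [t, p])], Some (Cell j (fst (ws ! j)), [t', p]))"
    | j where "j \<le> work_tapes M" "c \<in> set (move_clauses j ?As t t' p p' (snd (ws ! j)))"
    unfolding action_clauses_def a by (auto simp: act Let_def less_Suc_eq_le simp del: upt_Suc move_clauses.simps)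
  then show ?thesis
  proof cases
    case 1
    have "run_read t = ss" if "\<forall>j \<in> {0..<Suc (work_tapes M)}. run_cell j t (run_head j t) = ss ! j"
      using that assms(1) a by (intro nth_equalityI) auto
    then show ?thesis using 1 by (auto simp: sat_def simp del: upt_Suc)
  next
    case 2
    then show ?thesis using run_action(1)[of t q' ws] act by (auto simp: sat_def)
  next
    case 3
    then show ?thesis using run_action(3)[of t q' ws j] act by (auto simp: sat_def)
  next
    case 4
    then show ?thesis using run_action(2)[of t q' ws j] act
      by (cases "snd (ws ! j)") (auto simp: sat_def)
  qed
qed

text \<open>Only the clause leading from the accepting state to falsity refers to acceptance; the
  others hold in every run.\<close>

lemma run_clauses_sound:
  assumes "\<And>t. run_state t \<noteq> accept M" and "c \<in> set (run_clauses M 0 t t' p p')"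
  shows "sat run_holds False c"
proof -
  from assms(2) consider "c \<in> {([(Zero, [t])], Some (St (start M), [t])),
      ([(Zero, [p])], Some (Inp, [0, p])), ([(St (accept M), [t])], None)}"
    | j where "j \<le> work_tapes M" "c \<in> set (tape_clauses M t t' p p' j)"
    | a where "length (snd a) = Suc (work_tapes M)" "c \<in> set (action_clauses M t t' p p' a)"
    unfolding run_clauses_def by (auto simp: set_n_lists less_Suc_eq_le simp del: upt_Suc n_lists.simps)
  then show ?thesis
  proof cases
    case 1
    then show ?thesis using assms(1) by (auto simp: sat_def run_start)
  qed (auto intro: tape_clauses_sound action_clauses_sound)
qed

lemma input_clauses_sound:
  "c \<in> set (input_clauses i (Suc i) t p p' (scan x i)) \<Longrightarrow> sat run_holds False c"
  by (auto simp: input_clauses_def sat_def run_cell_def)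

section \<open>Deriving the run from the clauses for numbers below a bound\<close>

context
  fixes D :: "pred \<Rightarrow> nat list \<Rightarrow> bool" and G :: bool and N :: nat
  assumes zero: "D Zero [0]" and succ: "\<And>v. v < N \<Longrightarrow> D Succ [v, Suc v]"
    and run_closed: "\<And>t p c. t < N \<Longrightarrow> p < N \<Longrightarrow>
      c \<in> set (run_clauses M 0 t (Suc t) p (Suc p)) \<Longrightarrow> sat D G c"
    and input_closed: "\<And>i t p c. i \<le> length x + 1 \<Longrightarrow> t < N \<Longrightarrow> p < N \<Longrightarrow>
      c \<in> set (input_clauses i (Suc i) t p (Suc p) (scan x i)) \<Longrightarrow> sat D G c"
    and N: "length x + 1 < N"
begin

lemma tape_closed:
  "j \<le> work_tapes M \<Longrightarrow> t < N \<Longrightarrow> p < N \<Longrightarrow> c \<in> set (tape_clauses M t (Suc t) p (Suc p) j) \<Longrightarrow> sat D G c"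
  by (rule run_closed[of t p]) (auto simp: run_clauses_def simp del: upt_Suc)

lemma action_closed:
  "t < N \<Longrightarrow> p < N \<Longrightarrow> c \<in> set (action_clauses M t (Suc t) p (Suc p) (run_state t, run_read t)) \<Longrightarrow> sat D G c"
proof (rule run_closed[of t p])
  assume "c \<in> set (action_clauses M t (Suc t) p (Suc p) (run_state t, run_read t))"
  moreover have "(run_state t, run_read t) \<in>
    set (List.product [0..<states M] (List.n_lists (Suc (work_tapes M)) [0..<alphabet M]))"
    using run_invariant[of t] run_cell_less
    by (auto simp: set_n_lists run_read_def simp del: upt_Suc n_lists.simps)
  ultimately show "c \<in> set (run_clauses M 0 t (Suc t) p (Suc p))"
    unfolding run_clauses_def set_append set_concat set_map by blast
qed auto

text \<open>A head moves by at most one cell in each step. Hence one bound \<open>N\<close> serves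
  for times and for cells.\<close>

lemma run_head_le: "j \<le> work_tapes M \<Longrightarrow> run_head j t \<le> t"
proof (induction t)
  case (Suc t)
  have "run_head j (Suc t) = move (snd (snd (action M (run_state t) (run_read t)) ! j)) (run_head j t)"
    using run_action(2)[OF prod.collapse[symmetric] Suc.prems] .
  also have "\<dots> \<le> Suc (run_head j t)"
    by (cases "snd (snd (action M (run_state t) (run_read t)) ! j)") auto
  finally show ?case using Suc by simp
qed (simp add: run_start)

lemma input_head_le: "run_head 0 t \<le> length x + 1"
  using run_invariant[of t] by (simp add: run_head_def)

lemma derive_Inp: "i \<le> length x + 1 \<Longrightarrow> D Inp [i, i]"
proof (induction i)
  case 0
  then show ?case using run_closed[of 0 0 "([(Zero, [0])], Some (Inp, [0, 0]))"] zero N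
    by (simp add: run_clauses_def sat_def)
next
  case (Suc i)
  then show ?case
    using input_closed[of i 0 i "([(Inp, [i, i]), (Succ, [i, Suc i])], Some (Inp, [Suc i, Suc i]))"] N succ[of i]
    by (simp add: input_clauses_def sat_def)
qed

lemma derive_Rt:
  assumes "j \<le> work_tapes M" "t < N" "D (Hd j) [t, h]" "h < p" "p < N"
  shows "D (Rt j) [t, p]"
proof -
  from \<open>h < p\<close> have "Suc h \<le> p" by simp
  then show ?thesis using assms(5)
  proof (induction p rule: dec_induct)
    case base
    then show ?case using tape_closed[OF assms(1,2), of h
        "([(Hd j, [t, h]), (Succ, [h, Suc h])], Some (Rt j, [t, Suc h]))"] assms(3) succ[of h]
      by (simp add: tape_clauses_def sat_def)
  next
    case (step p)
    then show ?case using tape_closed[OF assms(1,2), of p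
        "([(Rt j, [t, p]), (Succ, [p, Suc p])], Some (Rt j, [t, Suc p]))"] succ[of p]
      by (simp add: tape_clauses_def sat_def)
  qed
qed

lemma derive_Lt:
  assumes "j \<le> work_tapes M" "t < N" "D (Hd j) [t, h]" "h < N" "p < h"
  shows "D (Lt j) [t, p]"
proof -
  from \<open>p < h\<close> obtain h' where h: "h = Suc h'" "p \<le> h'" by (cases h) auto
  have "p < N" using assms by simp
  from \<open>p \<le> h'\<close> show ?thesis
  proof (induction p rule: inc_induct)
    case base
    then show ?case using tape_closed[OF assms(1,2), of h'
        "([(Hd j, [t, Suc h']), (Succ, [h', Suc h'])], Some (Lt j, [t, h']))"] assms(3,4) succ[of h'] h
      by (simp add: tape_clauses_def sat_def)
  next
    case (step p)
    then show ?case using tape_closed[OF assms(1,2), of p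
        "([(Lt j, [t, Suc p]), (Succ, [p, Suc p])], Some (Lt j, [t, p]))"] succ[of p] assms(4) h
      by (simp add: tape_clauses_def sat_def)
  qed
qed

text \<open>The input clauses fill tape 0 only up to the right end marker. The restriction on
  \<open>p\<close> is harmless because the input head never leaves this range.\<close>

definition derives_config :: "nat \<Rightarrow> bool" where
  "derives_config t \<longleftrightarrow> D (St (run_state t)) [t] \<and>
     (\<forall>j \<le> work_tapes M. D (Hd j) [t, run_head j t] \<and>
       (\<forall>p < N. (j = 0 \<longrightarrow> p \<le> length x + 1) \<longrightarrow> D (Cell j (run_cell j t p)) [t, p]))"

lemma derives_initial: "derives_config 0"
proof -
  have "D (Hd j) [0, 0]" if "j \<le> work_tapes M" for j
    using tape_closed[OF that, of 0 0 "([(Zero, [0]), (Zero, [0])], Some (Hd j, [0, 0]))"] N zero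
    by (simp add: tape_clauses_def sat_def)
  moreover have "D (Cell j 0) [0, p]" if "j \<le> work_tapes M" "0 < j" "p < N" for j p
    using tape_closed[OF that(1), of 0 p "([(Zero, [0])], Some (Cell j 0, [0, p]))"] N zero that
    by (simp add: tape_clauses_def sat_def)
  moreover have "D (Cell 0 (run_cell 0 0 p)) [0, p]" if "p \<le> length x + 1" for p
    using input_closed[OF that, of 0 p "([(Inp, [p, p]), (Zero, [0])], Some (Cell 0 (insym (scan x p)), [0, p]))"]
      N zero that derive_Inp[OF that]
    by (simp add: input_clauses_def sat_def run_cell_def)
  moreover have "D (St (start M)) [0]"
    using run_closed[of 0 0 "([(Zero, [0])], Some (St (start M), [0]))"] N zero
    by (simp add: run_clauses_def sat_def)
  ultimately show ?thesis
    unfolding derives_config_def using run_start by (metis neq0_conv)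
qed

lemma derives_step:
  assumes "derives_config t" and t: "Suc t < N"
  shows "derives_config (Suc t)"
proof -
  have st: "D (St (run_state t)) [t]"
    and hd: "\<And>j. j \<le> work_tapes M \<Longrightarrow> D (Hd j) [t, run_head j t]"
    and cell: "\<And>j p. j \<le> work_tapes M \<Longrightarrow> p < N \<Longrightarrow> (j = 0 \<Longrightarrow> p \<le> length x + 1) \<Longrightarrow>
      D (Cell j (run_cell j t p)) [t, p]"
    using assms(1) by (auto simp: derives_config_def)
  have head: "run_head j t < N" "run_head 0 t \<le> length x + 1" if "j \<le> work_tapes M" for j
    using run_head_le[OF that, of t] input_head_le[of t] t by auto
  obtain q' ws where act: "action M (run_state t) (run_read t) = (q', ws)" by fastforce
  note new = run_action[OF act]
  have "D (Rd j (run_cell j t (run_head j t))) [t]" if "j \<le> work_tapes M" for j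
    using tape_closed[OF that, of t "run_head j t" "([(Hd j, [t, run_head j t]),
      (Cell j (run_cell j t (run_head j t)), [t, run_head j t])], Some (Rd j (run_cell j t (run_head j t)), [t]))"]
      t hd[OF that] cell[OF that head(1)[OF that]] head[OF that] run_cell_less[OF that, of t "run_head j t"]
    by (cases "j = 0") (auto simp: tape_clauses_def cell_clauses_def sat_def)
  \<comment> \<open>This clause and the next one mention no cell, so any number below
    \<open>N\<close> may be taken for it; \<open>t\<close> is such a number.\<close>
  then have A: "D (Act (run_state t) (run_read t)) [t]"
    using action_closed[of t t "((St (run_state t), [t]) # map (\<lambda>j. (Rd j (run_read t ! j), [t]))
      [0..<Suc (work_tapes M)], Some (Act (run_state t) (run_read t), [t]))"] t st
    by (auto simp: action_clauses_def act Let_def sat_def less_Suc_eq_le simp del: upt_Suc)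
  let ?As = "[(Act (run_state t) (run_read t), [t]), (Succ, [t, Suc t])]"
  have S: "D Succ [t, Suc t]" using succ t by simp
  have "D (St q') [Suc t]"
    using action_closed[of t t "(?As, Some (St q', [Suc t]))"] t A S
    by (auto simp: action_clauses_def act Let_def sat_def simp del: upt_Suc)
  moreover have "D (Hd j) [Suc t, run_head j (Suc t)]" if j: "j \<le> work_tapes M" for j
  proof -
    have mem: "c \<in> set (move_clauses j ?As t (Suc t) p (Suc p) (snd (ws ! j))) \<Longrightarrow> p < N \<Longrightarrow> sat D G c" for c p
    proof (rule action_closed[of t p])
      assume "c \<in> set (move_clauses j ?As t (Suc t) p (Suc p) (snd (ws ! j)))"
      then show "c \<in> set (action_clauses M t (Suc t) p (Suc p) (run_state t, run_read t))"
        using j by (auto simp: action_clauses_def act Let_def Bex_def less_Suc_eq_le simp del: upt_Suc)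
    qed (use t in auto)
    show ?thesis
    proof (cases "snd (ws ! j)")
      case Go_Left
      show ?thesis
      proof (cases "run_head j t")
        case 0
        then show ?thesis
          using mem[of "(?As @ [(Hd j, [t, 0]), (Zero, [0])], Some (Hd j, [Suc t, 0]))" 0]
            A S Go_Left new(2)[OF j] hd[OF j] zero head[OF j] by (simp add: sat_def)
      next
        case (Suc h)
        then show ?thesis
          using mem[of "(?As @ [(Hd j, [t, Suc h]), (Succ, [h, Suc h])], Some (Hd j, [Suc t, h]))" h]
            A S Go_Left new(2)[OF j] hd[OF j] succ[of h] head(1)[OF j] by (simp add: sat_def)
      qed
    next
      case Stay
      then show ?thesis
        using mem[of "(?As @ [(Hd j, [t, run_head j t])], Some (Hd j, [Suc t, run_head j t]))" "run_head j t"]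
          A S new(2)[OF j] hd[OF j] head(1)[OF j] by (simp add: sat_def)
    next
      case Go_Right
      then show ?thesis
        using mem[of "(?As @ [(Hd j, [t, run_head j t]), (Succ, [run_head j t, Suc (run_head j t)])],
          Some (Hd j, [Suc t, Suc (run_head j t)]))" "run_head j t"]
          A S new(2)[OF j] hd[OF j] succ[of "run_head j t"] head(1)[OF j] by (simp add: sat_def)
    qed
  qed
  moreover have "D (Cell j (run_cell j (Suc t) p)) [Suc t, p]"
    if j: "j \<le> work_tapes M" and p: "p < N" "j = 0 \<longrightarrow> p \<le> length x + 1" for j p
  proof (cases "p = run_head j t")
    case True
    have "(?As @ [(Hd j, [t, p])], Some (Cell j (fst (ws ! j)), [Suc t, p])) \<in>
        set (action_clauses M t (Suc t) p (Suc p) (run_state t, run_read t))"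
      using j by (auto simp: action_clauses_def act Let_def simp del: upt_Suc)
    from action_closed[OF _ p(1) this] show ?thesis
      using t A S hd[OF j] True new(3)[OF j] by (simp add: sat_def)
  next
    case False
    define s where "s = run_cell j t p"
    have s: "D (Cell j s) [t, p]" "s < alphabet M"
      using cell[OF j p(1)] p(2) run_cell_less[OF j] by (auto simp: s_def)
    have new_s: "run_cell j (Suc t) p = s" using new(3)[OF j] False by (simp add: s_def)
    consider "run_head j t < p" | "p < run_head j t" using False by linarith
    then show ?thesis
    proof cases
      case 1
      then have "D (Rt j) [t, p]" using derive_Rt[OF j _ hd[OF j] _ p(1)] t by simp
      moreover have "([(Rt j, [t, p]), (Cell j s, [t, p]), (Succ, [t, Suc t])], Some (Cell j s, [Suc t, p])) \<in>
          set (tape_clauses M t (Suc t) p (Suc p) j)"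
        using s(2) by (auto simp: tape_clauses_def cell_clauses_def)
      from tape_closed[OF j _ p(1) this] have "D (Rt j) [t, p] \<Longrightarrow> D (Cell j s) [Suc t, p]"
        using t S s(1) by (simp add: sat_def)
      ultimately show ?thesis using new_s by simp
    next
      case 2
      then have "D (Lt j) [t, p]" using derive_Lt[OF j _ hd[OF j] head(1)[OF j]] t by simp
      moreover have "([(Lt j, [t, p]), (Cell j s, [t, p]), (Succ, [t, Suc t])], Some (Cell j s, [Suc t, p])) \<in>
          set (tape_clauses M t (Suc t) p (Suc p) j)"
        using s(2) by (auto simp: tape_clauses_def cell_clauses_def)
      from tape_closed[OF j _ p(1) this] have "D (Lt j) [t, p] \<Longrightarrow> D (Cell j s) [Suc t, p]"
        using t S s(1) by (simp add: sat_def)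
      ultimately show ?thesis using new_s by simp
    qed
  qed
  ultimately show ?thesis by (auto simp: derives_config_def new(1))
qed

lemma derives_accept:
  assumes "t < N" and "run_state t = accept M"
  shows G
proof -
  have "derives_config t" using assms(1)
    by (induction t) (auto intro: derives_initial derives_step)
  then show ?thesis
    using run_closed[of t t "([(St (accept M), [t])], None)"] assms
    by (simp add: run_clauses_def sat_def derives_config_def)
qed

end

end

section \<open>Soundness in a model and instances of Horn formulas\<close>

text \<open>
  All function symbols are interpreted as 0, since the instances contain none.
\<close>

primrec eval_trm :: "(nat \<Rightarrow> nat) \<Rightarrow> trm \<Rightarrow> nat" where
  "eval_trm e (Var i) = e i"
| "eval_trm e (Fun f ts) = 0"

primrec eval :: "(nat \<Rightarrow> nat list \<Rightarrow> bool) \<Rightarrow> (nat \<Rightarrow> nat) \<Rightarrow> fm \<Rightarrow> bool" where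
  "eval I e Top \<longleftrightarrow> True"
| "eval I e Bot \<longleftrightarrow> False"
| "eval I e (Atom p ts) \<longleftrightarrow> I p (map (eval_trm e) ts)"
| "eval I e (Conj A B) \<longleftrightarrow> eval I e A \<and> eval I e B"
| "eval I e (Disj A B) \<longleftrightarrow> eval I e A \<or> eval I e B"
| "eval I e (Imp A B) \<longleftrightarrow> (eval I e A \<longrightarrow> eval I e B)"
| "eval I e (All A) \<longleftrightarrow> (\<forall>a. eval I (case_nat a e) A)"
| "eval I e (Ex A) \<longleftrightarrow> (\<exists>a. eval I (case_nat a e) A)"

lemma eval_trm_lift: "eval_trm e (lift_trm k t) = eval_trm (\<lambda>i. if i < k then e i else e (Suc i)) t"
  by (cases t) auto

lemma eval_lift: "eval I e (lift k A) = eval I (\<lambda>i. if i < k then e i else e (Suc i)) A"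
proof (induction A arbitrary: e k)
  case (Atom p ts)
  show ?case by (simp add: eval_trm_lift comp_def)
next
  case (All A)
  have "(\<lambda>i. if i < Suc k then case_nat a e i else case_nat a e (Suc i)) =
      case_nat a (\<lambda>i. if i < k then e i else e (Suc i))" for a
    by (auto simp: fun_eq_iff split: nat.splits)
  then show ?case using All by simp
next
  case (Ex A)
  have "(\<lambda>i. if i < Suc k then case_nat a e i else case_nat a e (Suc i)) =
      case_nat a (\<lambda>i. if i < k then e i else e (Suc i))" for a
    by (auto simp: fun_eq_iff split: nat.splits)
  then show ?case using Ex by simp
qed auto

lemma eval_lift_0 [simp]: "eval I (case_nat a e) (lift 0 A) = eval I e A"
  by (simp add: eval_lift)

lemma eval_trm_subst:
  "eval_trm e (subst_trm k s t) = eval_trm (\<lambda>i. if i < k then e i else if i = k then eval_trm e s else e (i - 1)) t"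
  by (cases t) auto

lemma eval_subst:
  "eval I e (subst k s A) = eval I (\<lambda>i. if i < k then e i else if i = k then eval_trm e s else e (i - 1)) A"
proof (induction A arbitrary: e k s)
  case (Atom p ts)
  show ?case by (simp add: eval_trm_subst comp_def)
next
  case (All A)
  have "(\<lambda>i. if i < Suc k then case_nat a e i else if i = Suc k then eval_trm (case_nat a e) (lift_trm 0 s)
        else case_nat a e (i - 1)) =
      case_nat a (\<lambda>i. if i < k then e i else if i = k then eval_trm e s else e (i - 1))" for a
    by (auto simp: fun_eq_iff eval_trm_lift split: nat.splits)
  then show ?case using All by simp
next
  case (Ex A)
  have "(\<lambda>i. if i < Suc k then case_nat a e i else if i = Suc k then eval_trm (case_nat a e) (lift_trm 0 s)
        else case_nat a e (i - 1)) =
      case_nat a (\<lambda>i. if i < k then e i else if i = k then eval_trm e s else e (i - 1))" for a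
    by (auto simp: fun_eq_iff eval_trm_lift split: nat.splits)
  then show ?case using Ex by simp
qed auto

lemma eval_inst: "eval I e (inst A t) = eval I (case_nat (eval_trm e t) e) A"
proof -
  have "(\<lambda>i. if i < 0 then e i else if i = 0 then eval_trm e t else e (i - 1)) = case_nat (eval_trm e t) e"
    by (auto simp: fun_eq_iff split: nat.splits)
  then show ?thesis by (simp add: inst_def eval_subst)
qed

text \<open>This is how entailment of \<open>Bot\<close> is refuted: a structure and an assignment
  satisfying all clauses of an instance exclude a classical derivation.\<close>

lemma classical_sound: "classical \<Gamma> A \<Longrightarrow> \<forall>B \<in> \<Gamma>. eval I e B \<Longrightarrow> eval I e A"
proof (induction arbitrary: e rule: classical.induct)
  case (ExE \<Gamma> A C)
  then obtain a where "eval I (case_nat a e) A" by fastforce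
  then have "eval I (case_nat a e) (lift 0 C)" using ExE by (intro ExE.IH(2)) auto
  then show ?case by simp
qed (auto simp: eval_inst)

text \<open>An argument is a block of variable indices, the digits of one number. Blocks can be
  flattened because the decoding knows their length.\<close>

fun mk_atom :: "pred \<times> nat list list \<Rightarrow> fm" where
  "mk_atom (P, bs) = Atom (to_nat P) (map Var (concat bs))"

definition clause_matrix :: "nat list clause \<Rightarrow> fm" where
  "clause_matrix = (\<lambda>(As, B). foldr Imp (map mk_atom As) (case B of None \<Rightarrow> Bot | Some b \<Rightarrow> mk_atom b))"

text \<open>Inside \<open>K\<close> quantifiers the free variable \<open>i\<close> has index
  \<open>K + i\<close>; this is why names of constants are shifted by \<open>K\<close> from here
  on.\<close>

definition horn :: "nat \<Rightarrow> nat list clause \<Rightarrow> fm" where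
  "horn K c = (All ^^ K) (clause_matrix c)"

fun map_clause :: "(pred \<Rightarrow> 'b list \<Rightarrow> 'c list) \<Rightarrow> 'b clause \<Rightarrow> 'c clause" where
  "map_clause f (As, B) = (map (\<lambda>(P, as). (P, f P as)) As, map_option (\<lambda>(P, as). (P, f P as)) B)"

lemma fm_over_foldr: "fm_over \<Sigma> (foldr Imp As B) \<longleftrightarrow> list_all (fm_over \<Sigma>) As \<and> fm_over \<Sigma> B"
  by (induction As) auto

lemma quantifiers_foldr: "quantifiers (foldr Imp As B) = sum_list (map quantifiers As) + quantifiers B"
  by (induction As) auto

lemma fm_over_Alls: "fm_over \<Sigma> ((All ^^ K) A) \<longleftrightarrow> fm_over \<Sigma> A"
  by (induction K) auto

lemma quantifiers_Alls: "quantifiers ((All ^^ K) A) = K + quantifiers A"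
  by (induction K) auto

lemma fm_over_matrix: "fm_over \<Sigma> (clause_matrix c)"
proof -
  have "fm_over \<Sigma> (mk_atom a)" for a by (cases a) (simp add: list_all_iff)
  then show ?thesis by (cases c) (simp add: clause_matrix_def fm_over_foldr list_all_iff split: option.splits)
qed

lemma fm_over_horn: "fm_over \<Sigma> (horn K c)"
  by (simp add: horn_def fm_over_Alls fm_over_matrix)

lemma quantifiers_matrix: "quantifiers (clause_matrix c) = 0"
proof -
  have "quantifiers (mk_atom a) = 0" for a by (cases a) simp
  then show ?thesis by (cases c) (auto simp: clause_matrix_def quantifiers_foldr sum_list_0 split: option.splits)
qed

lemma quantifiers_horn: "quantifiers (horn K c) = K"
  by (simp add: horn_def quantifiers_Alls quantifiers_matrix)

lemma universal_horn_horn: "universal_horn (horn K c)"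
proof -
  obtain As B where c: "c = (As, B)" by (cases c)
  have "atomic (mk_atom a)" for a by (cases a) simp
  then have "list_all atomic (map mk_atom As)" "atomic (case B of None \<Rightarrow> Bot | Some b \<Rightarrow> mk_atom b)"
    by (auto simp: list_all_iff split: option.splits)
  then have "horn_clause (clause_matrix c)" unfolding horn_clause_def by (auto simp: clause_matrix_def c)
  then show ?thesis unfolding universal_horn_def horn_def by blast
qed

primrec arity :: "pred \<Rightarrow> nat" where
  "arity Zero = 1"
| "arity Succ = 2"
| "arity Inp = 2"
| "arity (St q) = 1"
| "arity (Act q ss) = 1"
| "arity (Rd j s) = 1"
| "arity (Hd j) = 2"
| "arity (Rt j) = 2"
| "arity (Lt j) = 2"
| "arity (Cell j s) = 2"

text \<open>The condition under which the polymorphic clause lists commute with a change of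
  arguments: \<open>f\<close> acts on atoms argument by argument as \<open>h\<close>.
  \<open>Inp\<close> is exempt, its first argument being coded in another way. The set
  \<open>S\<close> limits the condition to arguments that occur, which matters for decodings that
  work only on blocks of the right length.\<close>

definition natural :: "'b set \<Rightarrow> (pred \<Rightarrow> 'b list \<Rightarrow> 'c list) \<Rightarrow> ('b \<Rightarrow> 'c) \<Rightarrow> bool" where
  "natural S f h \<longleftrightarrow> (\<forall>P. \<forall>a \<in> S. arity P = 1 \<longrightarrow> f P [a] = [h a]) \<and>
     (\<forall>P. \<forall>a \<in> S. \<forall>b \<in> S. arity P = 2 \<longrightarrow> P \<noteq> Inp \<longrightarrow> f P [a, b] = [h a, h b])"

lemma map_move_clauses:
  "natural {t, t', p, p'} f h \<Longrightarrow> map (map_clause f) (move_clauses j As t t' p p' d) =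
    move_clauses j (map (\<lambda>(P, as). (P, f P as)) As) (h t) (h t') (h p) (h p') d"
  by (cases d) (auto simp: natural_def)

lemma map_action_clauses:
  assumes "natural {t, t', p, p'} f h"
  shows "map (map_clause f) (action_clauses M t t' p p' a) = action_clauses M (h t) (h t') (h p) (h p') a"
proof -
  obtain q ss where a: "a = (q, ss)" by (cases a)
  obtain q' ws where act: "action M q ss = (q', ws)" by (cases "action M q ss")
  have f1: "f P [b] = [h b]" if "arity P = 1" "b \<in> {t, t', p, p'}" for P b
    using assms that unfolding natural_def by blast
  have f2: "f P [b, c] = [h b, h c]" if "arity P = 2" "P \<noteq> Inp" "b \<in> {t, t', p, p'}" "c \<in> {t, t', p, p'}" for P b c
    using assms that unfolding natural_def by blast
  show ?thesis
    unfolding a action_clauses_def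
    by (simp add: act Let_def map_concat comp_def map_move_clauses[OF assms] f1 f2 del: upt_Suc)
qed

lemma map_cell_clauses:
  "natural {t, t', p, p'} f h \<Longrightarrow> map (map_clause f) (cell_clauses j t t' p s) =
    cell_clauses j (h t) (h t') (h p) s"
  by (simp add: cell_clauses_def natural_def)

lemma map_tape_clauses:
  assumes "natural {t, t', p, p'} f h"
  shows "map (map_clause f) (tape_clauses M t t' p p' j) = tape_clauses M (h t) (h t') (h p) (h p') j"
proof -
  have "f Zero [t] = [h t]" "f Zero [p] = [h p]" "f (Cell j 0) [t, p] = [h t, h p]"
    "f Succ [p, p'] = [h p, h p']"
    "\<forall>P \<in> {Hd j, Rt j, Lt j}. f P [t, p] = [h t, h p] \<and> f P [t, p'] = [h t, h p']"
    using assms unfolding natural_def by simp_all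
  then show ?thesis
    by (simp add: tape_clauses_def map_concat comp_def map_cell_clauses[OF assms])
qed

lemma map_run_clauses:
  assumes "natural {t, t', p, p'} f h" and "f Inp [z, p] = [z', h p]"
  shows "map (map_clause f) (run_clauses M z t t' p p') = run_clauses M z' (h t) (h t') (h p) (h p')"
proof -
  have "f Zero [t] = [h t]" "f Zero [p] = [h p]" "f (St q) [t] = [h t]" for q
    using assms unfolding natural_def by simp_all
  then show ?thesis using assms(2)
    by (simp add: run_clauses_def map_concat comp_def map_tape_clauses[OF assms(1)]
        map_action_clauses[OF assms(1)] del: upt_Suc n_lists.simps)
qed

lemma map_input_clauses:
  "natural {t, p, p'} f h \<Longrightarrow> f Inp [i, p] = [k, h p] \<Longrightarrow> f Inp [i', p'] = [k', h p'] \<Longrightarrow>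
    map (map_clause f) (input_clauses i i' t p p' a) = input_clauses k k' (h t) (h p) (h p') a"
  by (simp add: input_clauses_def natural_def)

text \<open>Input position \<open>i\<close> is named by free variable \<open>i\<close>, and the
  range includes both end markers. The same free variables also occur in the codes of numbers; the
  two uses are compatible since free variable \<open>i\<close> denotes \<open>i\<close> in the
  countermodel.\<close>

definition computation_clauses ::
    "machine \<Rightarrow> bool list \<Rightarrow> nat \<Rightarrow> nat list \<Rightarrow> nat list \<Rightarrow> nat list \<Rightarrow> nat list \<Rightarrow> nat list clause list" where
  "computation_clauses M x K t t' p p' = run_clauses M [K] t t' p p' @
     concat (map (\<lambda>i. input_clauses [K + i] [K + Suc i] t p p' (scan x i)) [0..<length x + 2])"

section \<open>Derivation of falsity and the countermodel\<close>

lemma sat_matrix: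
  assumes imp: "\<forall>A B. D (Imp A B) \<longrightarrow> D A \<longrightarrow> D B"
    and "D (clause_matrix (map_clause f c))"
  shows "sat (\<lambda>P as. D (mk_atom (P, f P as))) (D Bot) c"
proof -
  have imps: "D (foldr Imp As B) \<Longrightarrow> \<forall>A \<in> set As. D A \<Longrightarrow> D B" for As B
    by (induction As) (use imp in auto)
  obtain As B where c: "c = (As, B)" by (cases c)
  have 1: "map mk_atom (map (\<lambda>(P, as). (P, f P as)) As) = map (\<lambda>(P, as). mk_atom (P, f P as)) As"
    by (induction As) auto
  have 2: "D (foldr Imp (map (\<lambda>(P, as). mk_atom (P, f P as)) As)
      (case B of None \<Rightarrow> Bot | Some (P, as) \<Rightarrow> mk_atom (P, f P as)))"
    using assms(2) unfolding c clause_matrix_def map_clause.simps prod.case 1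
    by (cases B) (auto split: prod.splits)
  show ?thesis
    using imps[OF 2] unfolding c sat_def by (cases B) (auto split: prod.splits)
qed

text \<open>
  The first argument of \<^const>\<open>Inp\<close>, an input position, is always a single variable.
\<close>

fun code_args :: "(nat \<Rightarrow> nat list) \<Rightarrow> pred \<Rightarrow> nat list \<Rightarrow> nat list list" where
  "code_args cd Inp [i, p] = [[i], cd p]"
| "code_args cd P as = map cd as"

lemma natural_code_args: "natural S (code_args cd) cd"
proof -
  have "code_args cd P [a, b] = [cd a, cd b]" if "P \<noteq> Inp" for P a b
    using that by (cases P) auto
  moreover have "code_args cd P [a] = [cd a]" for P a
    by (cases P) auto
  ultimately show ?thesis by (simp add: natural_def)
qed

text \<open>\<open>D\<close> is any set of formulas closed under modus ponens and \<open>cd\<close>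
  any coding of numbers by blocks of variables. Single variables give the polynomial case, binary
  digits the exponential one; the instances of the quantified clauses are supposed to be available
  already.\<close>

lemma derives_Bot:
  assumes M: "is_machine M"
    and imp: "\<forall>A B. D (Imp A B) \<longrightarrow> D A \<longrightarrow> D B"
    and zero: "D (mk_atom (Zero, [cd 0]))"
    and succ: "\<And>v. v < N \<Longrightarrow> D (mk_atom (Succ, [cd v, cd (Suc v)]))"
    and closed: "\<And>t p c. t < N \<Longrightarrow> p < N \<Longrightarrow>
      c \<in> set (computation_clauses M x 0 (cd t) (cd (Suc t)) (cd p) (cd (Suc p))) \<Longrightarrow> D (clause_matrix c)"
    and N: "length x + 1 < N" and accept: "t < N" "state (run M x t) = accept M"
  shows "D Bot"
proof (rule derives_accept[OF M, where D = "\<lambda>P as. D (mk_atom (P, code_args cd P as))" and N = N and x = x and t = t])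
  show "D (mk_atom (Zero, code_args cd Zero [0]))" using zero by simp
  show "D (mk_atom (Succ, code_args cd Succ [v, Suc v]))" if "v < N" for v using succ[OF that] by simp
  fix t p c assume tp: "t < N" "p < N"
  {
    assume "c \<in> set (run_clauses M 0 t (Suc t) p (Suc p))"
    then have "map_clause (code_args cd) c \<in> set (map (map_clause (code_args cd)) (run_clauses M 0 t (Suc t) p (Suc p)))"
      by simp
    also have "map (map_clause (code_args cd)) (run_clauses M 0 t (Suc t) p (Suc p)) =
        run_clauses M [0] (cd t) (cd (Suc t)) (cd p) (cd (Suc p))"
      by (rule map_run_clauses[OF natural_code_args]) simp
    finally show "sat (\<lambda>P as. D (mk_atom (P, code_args cd P as))) (D Bot) c"
      by (intro sat_matrix[OF imp] closed[OF tp]) (auto simp: computation_clauses_def)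
  next
    fix i assume i: "i \<le> length x + 1"
    assume "c \<in> set (input_clauses i (Suc i) t p (Suc p) (scan x i))"
    then have "map_clause (code_args cd) c \<in> set (map (map_clause (code_args cd)) (input_clauses i (Suc i) t p (Suc p) (scan x i)))"
      by simp
    also have "map (map_clause (code_args cd)) (input_clauses i (Suc i) t p (Suc p) (scan x i)) =
        input_clauses [i] [Suc i] (cd t) (cd p) (cd (Suc p)) (scan x i)"
      by (rule map_input_clauses[OF natural_code_args]) simp_all
    finally show "sat (\<lambda>P as. D (mk_atom (P, code_args cd P as))) (D Bot) c"
      using i by (intro sat_matrix[OF imp] closed[OF tp]) (auto simp: computation_clauses_def simp del: upt_Suc)
  }
qed (use N accept in \<open>auto simp: run_state_def[OF M]\<close>)

text \<open>
  Every list of domain elements is decoded to some number, so the clauses need no premises restricting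
  the quantified variables to bits.
\<close>

definition decode_args :: "nat \<Rightarrow> (nat list \<Rightarrow> nat) \<Rightarrow> pred \<Rightarrow> nat list \<Rightarrow> nat list" where
  "decode_args m dec P ws = (if P = Inp then [hd ws, dec (tl ws)] else if arity P = 1 then [dec ws]
     else [dec (take m ws), dec (drop m ws)])"

definition model :: "machine \<Rightarrow> bool list \<Rightarrow> nat \<Rightarrow> (nat list \<Rightarrow> nat) \<Rightarrow> nat \<Rightarrow> nat list \<Rightarrow> bool" where
  "model M x m dec n ws = run_holds M x (from_nat n) (decode_args m dec (from_nat n) ws)"

lemma eval_mk_atom:
  "eval (model M x m dec) e (mk_atom a) =
    (case a of (P, bs) \<Rightarrow> run_holds M x P (decode_args m dec P (map e (concat bs))))"
  by (cases a) (simp add: model_def comp_def)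

lemma eval_foldr: "eval I e (foldr Imp As B) \<longleftrightarrow> ((\<forall>A \<in> set As. eval I e A) \<longrightarrow> eval I e B)"
  by (induction As) auto

lemma eval_matrix:
  "eval (model M x m dec) e (clause_matrix c) \<longleftrightarrow>
    sat (run_holds M x) False (map_clause (\<lambda>P bs. decode_args m dec P (map e (concat bs))) c)"
proof -
  obtain As B where c: "c = (As, B)" by (cases c)
  show ?thesis
    by (cases B) (auto simp: c clause_matrix_def eval_foldr sat_def eval_mk_atom case_prod_unfold
        simp del: mk_atom.simps)
qed

lemma natural_decode_args:
  "\<forall>a \<in> S. length a = m \<Longrightarrow>
    natural S (\<lambda>P bs. decode_args m dec P (map e (concat bs))) (\<lambda>b. dec (map e b))"
  by (auto simp: natural_def decode_args_def)

text \<open>The assumption on \<open>e\<close> fixes the free variables and leaves the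
  \<open>K\<close> quantified ones arbitrary. The four blocks then decode to four unrelated numbers,
  and by naturality the formula says what the clause says of these numbers, which holds for all of
  them.\<close>

lemma model_computation_clauses:
  assumes M: "is_machine M" and rejects: "\<And>t. state (run M x t) \<noteq> accept M"
    and "length t = m" "length t' = m" "length p = m" "length p' = m"
    and e: "\<And>i. e (K + i) = i"
    and c: "c \<in> set (computation_clauses M x K t t' p p')"
  shows "eval (model M x m dec) e (clause_matrix c)"
proof -
  let ?f = "\<lambda>P bs. decode_args m dec P (map e (concat bs))" and ?h = "\<lambda>b. dec (map e b)"
  have nat: "natural {t, t', p, p'} ?f ?h" "natural {t, p, p'} ?f ?h"
    using assms(3-6) by (auto intro!: natural_decode_args)
  have Inp: "?f Inp [[K + i], b] = [i, ?h b]" for i b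
    using e[of i] by (simp add: decode_args_def)
  from c consider "c \<in> set (run_clauses M [K] t t' p p')"
    | i where "c \<in> set (input_clauses [K + i] [K + Suc i] t p p' (scan x i))"
    unfolding computation_clauses_def by (auto simp del: upt_Suc)
  then have "sat (run_holds M x) False (map_clause ?f c)"
  proof cases
    case 1
    then have "map_clause ?f c \<in> set (map (map_clause ?f) (run_clauses M [K] t t' p p'))" by simp
    also have "\<dots> = set (run_clauses M 0 (?h t) (?h t') (?h p) (?h p'))"
      using map_run_clauses[OF nat(1), of "[K]" 0] Inp[of 0] by simp
    finally show ?thesis
      using rejects run_clauses_sound[OF M] by (auto simp: run_state_def[OF M])
  next
    case 2
    then have "map_clause ?f c \<in> set (map (map_clause ?f) (input_clauses [K + i] [K + Suc i] t p p' (scan x i)))"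
      by simp
    also have "\<dots> = set (input_clauses i (Suc i) (?h t) (?h p) (?h p') (scan x i))"
      using map_input_clauses[OF nat(2) Inp Inp, of i "Suc i" "scan x i"] by simp
    finally show ?thesis by (rule input_clauses_sound[OF M])
  qed
  then show ?thesis by (simp add: eval_matrix)
qed

section \<open>Universal closure and instantiation\<close>

lemma eval_Alls:
  assumes "\<And>e'. (\<And>i. e' (K + i) = e i) \<Longrightarrow> eval I e' A"
  shows "eval I e ((All ^^ K) A)"
  using assms
proof (induction K arbitrary: e)
  case 0
  then show ?case by simp
next
  case (Suc K)
  have "eval I (case_nat a e) ((All ^^ K) A)" for a
  proof (rule Suc.IH)
    fix e' assume "\<And>i. e' (K + i) = case_nat a e i"
    from this[of "Suc _"] show "eval I e' A" by (intro Suc.prems) simp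
  qed
  then show ?case by simp
qed

lemma eval_horn:
  "(\<And>e'. (\<And>i. e' (K + i) = e i) \<Longrightarrow> eval I e' (clause_matrix c)) \<Longrightarrow> eval I e (horn K c)"
  unfolding horn_def by (rule eval_Alls) blast

abbreviation rename_args :: "(nat \<Rightarrow> nat) \<Rightarrow> pred \<Rightarrow> nat list list \<Rightarrow> nat list list" where
  "rename_args \<rho> P \<equiv> map (map \<rho>)"

lemma subst_matrix:
  "subst k (Var v) (clause_matrix c) =
    clause_matrix (map_clause (rename_args (\<lambda>i. if i < k then i else if i = k then v else i - 1)) c)"
proof -
  let ?\<rho> = "\<lambda>i. if i < k then i else if i = k then v else i - 1"
  have var: "subst_trm k (Var v) (Var i) = Var (?\<rho> i)" for i by simp
  have atom: "subst k (Var v) (mk_atom (P, bs)) = mk_atom (P, map (map ?\<rho>) bs)" for P bs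
    by (simp only: mk_atom.simps subst.simps map_concat map_map comp_def var)
  have foldr: "subst k (Var v) (foldr Imp As B) = foldr Imp (map (subst k (Var v)) As) (subst k (Var v) B)" for As B
    by (induction As) auto
  obtain As B where c: "c = (As, B)" by (cases c)
  show ?thesis
    by (cases B) (auto simp: c clause_matrix_def foldr atom comp_def
        simp del: mk_atom.simps split: prod.splits intro!: arg_cong2[where f = "foldr Imp"])
qed

lemma subst_Alls: "subst k (Var v) ((All ^^ n) A) = (All ^^ n) (subst (k + n) (Var (v + n)) A)"
  by (induction n arbitrary: k v) auto

lemma map_clause_comp: "map_clause f (map_clause g c) = map_clause (\<lambda>P as. f P (g P as)) c"
  by (cases c) (auto simp: option.map_comp comp_def split: prod.splits intro!: option.map_cong)

text \<open>The quantifiers are removed from the outside. With \<open>K\<close> of them remaining,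
  the variable just released has index \<open>K\<close> in the matrix, and the term
  \<open>Var (g K)\<close> becomes \<open>Var (g K + K)\<close> when it passes below them. The rule
  is required only for formulas without function symbols, whose instances by variables belong to the
  language for every \<open>\<Sigma>\<close>.\<close>

lemma horn_instance:
  assumes all: "\<And>A v. fm_over {} A \<Longrightarrow> D (All A) \<Longrightarrow> D (inst A (Var v))"
    and "D (horn K c)"
  shows "D (clause_matrix (map_clause (rename_args (\<lambda>i. if i < K then g i else i - K)) c))"
  using assms(2)
proof (induction K arbitrary: c)
  case 0
  have "map_clause (rename_args (\<lambda>i. i)) c = c"
    by (cases c) (auto simp: option.map_ident_strong split: prod.splits intro!: map_idI)
  then show ?case using 0 by (simp add: horn_def)
next
  case (Suc K)
  let ?\<rho> = "\<lambda>i. if i < K then i else if i = K then g K + K else i - 1"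
  have eq: "(\<lambda>i. if i < K then g i else i - K) \<circ> ?\<rho> = (\<lambda>i. if i < Suc K then g i else i - Suc K)"
    by (auto simp: fun_eq_iff)
  have "D (inst (horn K c) (Var (g K)))"
    using Suc.prems by (intro all) (simp_all add: horn_def fm_over_Alls fm_over_matrix)
  also have "inst (horn K c) (Var (g K)) = horn K (map_clause (rename_args ?\<rho>) c)"
    by (simp add: inst_def horn_def subst_Alls subst_matrix)
  finally have "D (clause_matrix (map_clause (rename_args (\<lambda>i. if i < K then g i else i - K))
      (map_clause (rename_args ?\<rho>) c)))" by (rule Suc.IH)
  also have "map_clause (rename_args (\<lambda>i. if i < K then g i else i - K)) (map_clause (rename_args ?\<rho>) c) =
      map_clause (rename_args (\<lambda>i. if i < Suc K then g i else i - Suc K)) c"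
    by (simp add: map_clause_comp eq)
  finally show ?case .
qed

section \<open>The two families of instances and binary counting\<close>

definition ptime_clauses :: "machine \<Rightarrow> bool list \<Rightarrow> nat \<Rightarrow> nat list clause list" where
  "ptime_clauses M x N = ([], Some (Zero, [[0]])) #
     concat (map (\<lambda>t. ([], Some (Succ, [[t], [Suc t]])) #
       concat (map (\<lambda>p. computation_clauses M x 0 [t] [Suc t] [p] [Suc p]) [0..<N])) [0..<N])"

text \<open>Digits are written most significant first; \<open>4 * m\<close> and
  \<open>Suc (4 * m)\<close> are the free variables 0 and 1 below \<open>4 * m\<close> quantifiers.
  Successor clause \<open>i\<close> keeps \<open>i\<close> quantified leading digits and changes a
  zero followed by ones into a one followed by zeros. A common prefix of \<open>4 * m\<close>
  quantifiers gives all clauses the same shift.\<close>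

definition exptime_clauses :: "machine \<Rightarrow> bool list \<Rightarrow> nat \<Rightarrow> nat list clause list" where
  "exptime_clauses M x m = ([], Some (Zero, [replicate m (4 * m)])) #
     map (\<lambda>i. ([], Some (Succ,
       [[0..<i] @ [4 * m] @ replicate (m - Suc i) (Suc (4 * m)),
        [0..<i] @ [Suc (4 * m)] @ replicate (m - Suc i) (4 * m)]))) [0..<m] @
     computation_clauses M x (4 * m) [0..<m] [m..<2 * m] [2 * m..<3 * m] [3 * m..<4 * m]"

primrec bits :: "nat \<Rightarrow> nat \<Rightarrow> nat list" where
  "bits 0 v = []"
| "bits (Suc m) v = bits m (v div 2) @ [v mod 2]"

lemma length_bits [simp]: "length (bits m v) = m"
  by (induction m arbitrary: v) auto

lemma bits_0: "bits m 0 = replicate m 0"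
  by (induction m) (auto simp: replicate_append_same)

text \<open>Induction from the last digit: an even number changes only this digit, an odd one resets
  it and passes the carry on to the half.\<close>

lemma bits_Suc:
  "Suc v < 2 ^ m \<Longrightarrow> \<exists>i<m. \<exists>u. length u = i \<and>
    bits m v = u @ [0] @ replicate (m - Suc i) 1 \<and> bits m (Suc v) = u @ [1] @ replicate (m - Suc i) 0"
proof (induction m arbitrary: v)
  case (Suc m)
  show ?case
  proof (cases "even v")
    case True
    then show ?thesis by (intro exI[of _ m]) (auto elim!: evenE)
  next
    case False
    then have v: "Suc v div 2 = Suc (v div 2)" "v mod 2 = 1" "Suc v mod 2 = 0" "Suc (v div 2) < 2 ^ m"
      using Suc.prems by (auto elim!: oddE)
    from Suc.IH[OF v(4)] obtain i u where "i < m" "length u = i"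
      "bits m (v div 2) = u @ [0] @ replicate (m - Suc i) 1"
      "bits m (Suc (v div 2)) = u @ [1] @ replicate (m - Suc i) 0" by blast
    moreover from this have "m - i = Suc (m - Suc i)" by simp
    ultimately show ?thesis using v
      by (intro exI[of _ i] conjI exI[of _ u]) (simp_all add: replicate_append_same)
  qed
qed simp

text \<open>Binary value with entries reduced modulo 2. This gives sense to blocks of arbitrary
  domain elements, and the successor clauses hold for every value of the quantified leading
  digits.\<close>

definition parity_value :: "nat list \<Rightarrow> nat" where
  "parity_value = foldl (\<lambda>a w. 2 * a + w mod 2) 0"

lemma foldl_parity: "foldl (\<lambda>a w. 2 * a + w mod 2) b ws = b * 2 ^ length ws + parity_value ws"
proof (induction ws arbitrary: b)
  case (Cons w ws)
  show ?case using Cons[of "2 * b + w mod 2"] Cons[of "w mod 2"]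
    by (simp add: parity_value_def algebra_simps)
qed (simp add: parity_value_def)

lemma parity_value_append: "parity_value (us @ ws) = parity_value us * 2 ^ length ws + parity_value ws"
  using foldl_parity[of "parity_value us" ws] by (simp add: parity_value_def)

lemma parity_value_replicate [simp]:
  "parity_value (replicate n 0) = 0" "Suc (parity_value (replicate n (Suc 0))) = 2 ^ n"
proof -
  show "parity_value (replicate n 0) = 0"
    by (induction n) (auto simp: parity_value_def)
  show "Suc (parity_value (replicate n (Suc 0))) = 2 ^ n"
  proof (induction n)
    case (Suc n)
    then show ?case using parity_value_append[of "[1]" "replicate n 1"]
      by (simp add: parity_value_def)
  qed (simp add: parity_value_def)
qed

lemma parity_value_succ:
  "parity_value (u @ [1] @ replicate n 0) = Suc (parity_value (u @ [0] @ replicate n 1))"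
proof -
  have "parity_value [1] = 1" "parity_value [0] = 0" by (simp_all add: parity_value_def)
  then show ?thesis using parity_value_replicate(2)[of n]
    by (simp add: parity_value_append algebra_simps del: append_Cons append_Nil flip: append_assoc)
qed

lemma map_computation_clauses:
  fixes g :: "nat \<Rightarrow> nat" and K :: nat
  defines "\<rho> \<equiv> (\<lambda>i. if i < K then g i else i - K)"
  shows "map (map_clause (rename_args \<rho>)) (computation_clauses M x K t t' p p') =
    computation_clauses M x 0 (map \<rho> t) (map \<rho> t') (map \<rho> p) (map \<rho> p')"
proof -
  have nat: "natural S (rename_args \<rho>) (map \<rho>)" for S by (simp add: natural_def)
  have \<rho>: "\<rho> (K + i) = i" for i by (simp add: \<rho>_def)
  have "map (map_clause (rename_args \<rho>)) (run_clauses M [K] t t' p p') =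
      run_clauses M [0] (map \<rho> t) (map \<rho> t') (map \<rho> p) (map \<rho> p')"
    by (rule map_run_clauses[OF nat]) (use \<rho>[of 0] in simp)
  moreover have "map (map_clause (rename_args \<rho>)) (input_clauses [K + i] [K + Suc i] t p p' (scan x i)) =
      input_clauses [i] [Suc i] (map \<rho> t) (map \<rho> p) (map \<rho> p') (scan x i)" for i
    by (rule map_input_clauses[OF nat]) (use \<rho>[of i] \<rho>[of "Suc i"] in simp_all)
  ultimately show ?thesis
    unfolding computation_clauses_def map_append map_concat map_map comp_def by simp
qed

section \<open>Rejection excludes classical entailment\<close>

lemma run_after_halt:
  assumes "halted M (run M x T)" and "T \<le> t"
  shows "run M x t = run M x T"
  using assms(2)
proof (induction t rule: dec_induct)
  case (step t)
  have "run M x (Suc t) = step M x (run M x t)" by (simp add: run_def)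
  then show ?case using step.IH assms(1) by (simp add: Defs.step_def)
qed simp

lemma never_accepts:
  assumes "halted M (run M x T)" and "state (run M x T) \<noteq> accept M"
  shows "state (run M x t) \<noteq> accept M"
proof
  assume t: "state (run M x t) = accept M"
  then have "halted M (run M x t)" by (simp add: halted_def)
  then have "run M x t = run M x T"
    using run_after_halt assms(1) by (metis nat_le_linear)
  then show False using t assms(2) by simp
qed

lemma matrix_fact: "clause_matrix ([], Some a) = mk_atom a"
  by (simp add: clause_matrix_def)

lemma decode_Succ:
  "length a = m \<Longrightarrow> decode_args m dec Succ (map e (concat [a, b])) = [dec (map e a), dec (map e b)]"
  by (auto simp: decode_args_def)

lemma ptime_clauses_unsat:
  assumes M: "is_machine M" and "\<And>t. state (run M x t) \<noteq> accept M"
  shows "\<not> classical (set (map (horn 0) (ptime_clauses M x N))) Bot"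
proof
  assume *: "classical (set (map (horn 0) (ptime_clauses M x N))) Bot"
  \<comment> \<open>Blocks have length 1 here and are decoded by \<open>hd\<close>; under the
    identity assignment the free variable \<open>t\<close> stands for the number
    \<open>t\<close>.\<close>
  have "eval (model M x 1 hd) (\<lambda>i. i) (horn 0 c)" if c: "c \<in> set (ptime_clauses M x N)" for c
  proof -
    from c consider "c = ([], Some (Zero, [[0]]))" | t where "c = ([], Some (Succ, [[t], [Suc t]]))"
      | t p where "c \<in> set (computation_clauses M x 0 [t] [Suc t] [p] [Suc p])"
      by (auto simp: ptime_clauses_def)
    then show ?thesis
    proof cases
      case 3
      have "eval (model M x 1 hd) (\<lambda>i. i) (clause_matrix c)"
        by (rule model_computation_clauses[OF assms _ _ _ _ _ 3]) auto
      then show ?thesis by (simp add: horn_def)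
    qed (auto simp: horn_def matrix_fact eval_mk_atom decode_args_def M simp del: mk_atom.simps)
  qed
  then show False using classical_sound[OF *, of "model M x 1 hd" "\<lambda>i. i"] by simp
qed

lemma exptime_clauses_unsat:
  assumes M: "is_machine M" and "\<And>t. state (run M x t) \<noteq> accept M"
  shows "\<not> classical (set (map (horn (4 * m)) (exptime_clauses M x m))) Bot"
proof
  assume *: "classical (set (map (horn (4 * m)) (exptime_clauses M x m))) Bot"
  have "eval (model M x m parity_value) (\<lambda>i. i) (horn (4 * m) c)" if c: "c \<in> set (exptime_clauses M x m)" for c
  proof (rule eval_horn)
    fix e assume e: "\<And>i. e (4 * m + i) = i"
    have e01: "e (4 * m) = 0" "e (Suc (4 * m)) = 1" using e[of 0] e[of 1] by auto
    from c consider "c = ([], Some (Zero, [replicate m (4 * m)]))"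
      | i where "i < m" "c = ([], Some (Succ,
          [[0..<i] @ [4 * m] @ replicate (m - Suc i) (Suc (4 * m)),
           [0..<i] @ [Suc (4 * m)] @ replicate (m - Suc i) (4 * m)]))"
      | "c \<in> set (computation_clauses M x (4 * m) [0..<m] [m..<2 * m] [2 * m..<3 * m] [3 * m..<4 * m])"
      by (auto simp: exptime_clauses_def)
    then show "eval (model M x m parity_value) e (clause_matrix c)"
    proof cases
      case 1
      then show ?thesis
        by (simp add: matrix_fact eval_mk_atom decode_args_def M e01 del: mk_atom.simps)
    next
      case 2
      let ?a = "[0..<i] @ [4 * m] @ replicate (m - Suc i) (Suc (4 * m))"
        and ?b = "[0..<i] @ [Suc (4 * m)] @ replicate (m - Suc i) (4 * m)"
      have "length ?a = m" using 2(1) by simp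
      then have "decode_args m parity_value Succ (map e (concat [?a, ?b])) =
          [parity_value (map e ?a), parity_value (map e ?b)]" by (rule decode_Succ)
      moreover have "parity_value (map e ?b) = Suc (parity_value (map e ?a))"
        using parity_value_succ[of "map e [0..<i]" "m - Suc i"] by (simp add: e01)
      ultimately show ?thesis
        unfolding 2(2) matrix_fact eval_mk_atom prod.case by (simp only: run_holds.simps[OF M])
    next
      case 3
      show ?thesis by (rule model_computation_clauses[OF assms _ _ _ _ e 3]) auto
    qed
  qed
  then show False using classical_sound[OF *, of "model M x m parity_value" "\<lambda>i. i"] by simp
qed

section \<open>Acceptance yields entailment in the logic\<close>

context
  fixes L :: "fm logic" and \<Sigma> :: "(nat \<times> nat) set"
  assumes logic: "is_logic L" and sub: "classical_sublogic \<Sigma> L"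
begin

lemma entails_formulas: "entails L \<Gamma> A \<Longrightarrow> \<Gamma> \<subseteq> formulas L \<and> A \<in> formulas L"
  using logic[unfolded is_logic_def, THEN conjunct1] by blast

lemma entails_member: "\<Gamma> \<subseteq> formulas L \<Longrightarrow> A \<in> \<Gamma> \<Longrightarrow> entails L \<Gamma> A"
  using logic[unfolded is_logic_def, THEN conjunct2, THEN conjunct1]
    logic[unfolded is_logic_def, THEN conjunct2, THEN conjunct2, THEN conjunct1, rule_format, of "{A}" A \<Gamma>]
  by blast

lemma entails_cut: "\<Gamma> \<subseteq> formulas L \<Longrightarrow> \<forall>B \<in> \<Delta>. entails L \<Gamma> B \<Longrightarrow> entails L \<Delta> A \<Longrightarrow> entails L \<Gamma> A"
  using logic[unfolded is_logic_def, THEN conjunct2, THEN conjunct2, THEN conjunct2, THEN conjunct1, rule_format, of \<Gamma> \<Delta> A]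
  by blast

lemma formulas_iff: "A \<in> formulas L \<longleftrightarrow> fm_over \<Sigma> A"
  using sub by (simp add: classical_sublogic_def fo_formulas_def)

lemma entails_imp_elim:
  assumes "admits L imp_elim" "\<Gamma> \<subseteq> formulas L" "entails L \<Gamma> (Imp A B)" "entails L \<Gamma> A"
  shows "entails L \<Gamma> B"
proof (rule entails_cut[OF assms(2), of "{A, Imp A B}"])
  have "fm_over \<Sigma> (Imp A B)" "fm_over \<Sigma> A" using assms(3,4) entails_formulas formulas_iff by blast+
  then show "entails L {A, Imp A B} B"
    using bspec[OF assms(1)[unfolded admits_def], of "([A, Imp A B], B)"]
    by (auto simp: formulas_iff imp_elim_def)
qed (use assms in auto)

lemma entails_all_elim:
  assumes "admits L all_elim" "\<Gamma> \<subseteq> formulas L" "entails L \<Gamma> (All A)" "fm_over \<Sigma> (inst A t)"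
  shows "entails L \<Gamma> (inst A t)"
proof (rule entails_cut[OF assms(2), of "{All A}"])
  have "fm_over \<Sigma> (All A)" using assms(3) entails_formulas formulas_iff by blast
  then show "entails L {All A} (inst A t)"
    using bspec[OF assms(1)[unfolded admits_def], of "([All A], inst A t)"] assms(4)
    by (auto simp: formulas_iff all_elim_def)
qed (use assms in auto)

lemma horn_formulas: "set (map (horn K) cs) \<subseteq> formulas L"
  by (auto simp: formulas_iff fm_over_horn)

lemma ptime_clauses_entail:
  assumes "admits L imp_elim" and M: "is_machine M" and N: "length x + 1 < N"
    and accept: "t < N" "state (run M x t) = accept M"
  shows "entails L (set (map (horn 0) (ptime_clauses M x N))) Bot"
proof -
  define H where "H = set (map (horn 0) (ptime_clauses M x N))"
  have H: "H \<subseteq> formulas L" unfolding H_def by (rule horn_formulas)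
  have D: "entails L H (clause_matrix c)" if "c \<in> set (ptime_clauses M x N)" for c
    using that by (intro entails_member H) (force simp: H_def horn_def)
  have "entails L H Bot"
  proof (rule derives_Bot[OF M _ _ _ _ N accept, where D = "entails L H" and cd = "\<lambda>v. [v]"])
    show "\<forall>A B. entails L H (Imp A B) \<longrightarrow> entails L H A \<longrightarrow> entails L H B"
      using entails_imp_elim[OF assms(1) H] by blast
    have "entails L H (clause_matrix ([], Some (Zero, [[0]])))"
      by (rule D) (simp add: ptime_clauses_def)
    then show "entails L H (mk_atom (Zero, [[0]]))" by (simp only: matrix_fact)
    show "entails L H (mk_atom (Succ, [[v], [Suc v]]))" if "v < N" for v
    proof -
      have "entails L H (clause_matrix ([], Some (Succ, [[v], [Suc v]])))"
        by (rule D) (use that in \<open>auto simp: ptime_clauses_def\<close>)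
      then show ?thesis by (simp only: matrix_fact)
    qed
    show "entails L H (clause_matrix c)"
      if "t < N" "p < N" "c \<in> set (computation_clauses M x 0 [t] [Suc t] [p] [Suc p])" for t p c
      using that by (intro D) (auto simp: ptime_clauses_def)
  qed
  then show ?thesis by (simp only: H_def)
qed

lemma exptime_clauses_entail:
  assumes "admits L imp_elim" "admits L all_elim" and M: "is_machine M" and N: "length x + 2 < 2 ^ m"
    and accept: "Suc t < 2 ^ m" "state (run M x t) = accept M"
  shows "entails L (set (map (horn (4 * m)) (exptime_clauses M x m))) Bot"
proof -
  let ?K = "4 * m"
  define H where "H = set (map (horn ?K) (exptime_clauses M x m))"
  have H: "H \<subseteq> formulas L" unfolding H_def by (rule horn_formulas)
  let ?\<rho> = "\<lambda>g i. if i < ?K then g i else i - ?K"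
  have D: "entails L H (clause_matrix (map_clause (rename_args (?\<rho> g)) c))"
    if "c \<in> set (exptime_clauses M x m)" for c g
  proof (rule horn_instance)
    show "entails L H (horn ?K c)" using that by (intro entails_member H) (auto simp: H_def)
    fix A v assume A: "fm_over {} A" "entails L H (All A)"
    \<comment> \<open>No function symbol occurs in \<open>A\<close>, so substituting a variable
      gives a formula over any \<open>\<Sigma>\<close>, as admissibility of the rule
      requires.\<close>
    have trm: "trm_over {} t \<Longrightarrow> trm_over \<Sigma> (subst_trm k (Var v) t)" for t k v
      by (cases t) auto
    have "fm_over {} A \<Longrightarrow> fm_over \<Sigma> (subst k (Var v) A)" for A k v
      by (induction A arbitrary: k v) (auto simp: list_all_iff trm)
    then have "fm_over \<Sigma> (inst A (Var v))" using A(1) by (simp add: inst_def)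
    then show "entails L H (inst A (Var v))" by (rule entails_all_elim[OF assms(2) H A(2)])
  qed
  have "entails L H Bot"
  \<comment> \<open>The successors of \<open>t\<close> and \<open>p\<close> must have
    \<open>m\<close> digits too, so \<open>t\<close> and \<open>p\<close> stay below
    \<open>2 ^ m - 1\<close>.\<close>
  proof (rule derives_Bot[OF M _ _ _ _ _ _ accept(2), where D = "entails L H" and cd = "bits m" and N = "2 ^ m - 1"])
    show "\<forall>A B. entails L H (Imp A B) \<longrightarrow> entails L H A \<longrightarrow> entails L H B"
      using entails_imp_elim[OF assms(1) H] by blast
    show "entails L H (mk_atom (Zero, [bits m 0]))"
      using D[of "([], Some (Zero, [replicate m ?K]))" id]
      by (simp add: exptime_clauses_def matrix_fact bits_0 del: mk_atom.simps upt_Suc)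
    show "entails L H (mk_atom (Succ, [bits m v, bits m (Suc v)]))" if "v < 2 ^ m - 1" for v
    proof -
      from that have "Suc v < 2 ^ m" by simp
      from bits_Suc[OF this] obtain i u where iu: "i < m" "length u = i"
        "bits m v = u @ [0] @ replicate (m - Suc i) 1" "bits m (Suc v) = u @ [1] @ replicate (m - Suc i) 0"
        by blast
      \<comment> \<open>The quantified leading digits are instantiated by the prefix that
        \<open>v\<close> and \<open>Suc v\<close> have in common; variables from \<open>i\<close> on
        do not occur in this clause.\<close>
      have "map (?\<rho> (nth u)) [0..<i] = map (nth u) [0..<length u]" using iu(1,2) by (intro map_cong) auto
      then have "map (?\<rho> (nth u)) [0..<i] = u" by (simp add: map_nth)
      moreover have "([], Some (Succ, [[0..<i] @ [?K] @ replicate (m - Suc i) (Suc ?K),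
          [0..<i] @ [Suc ?K] @ replicate (m - Suc i) ?K])) \<in> set (exptime_clauses M x m)"
        using iu(1) by (auto simp: exptime_clauses_def)
      note D[OF this, of "nth u"]
      ultimately show ?thesis
        using iu by (simp add: matrix_fact del: mk_atom.simps)
    qed
    fix t p c
    assume c: "c \<in> set (computation_clauses M x 0 (bits m t) (bits m (Suc t)) (bits m p) (bits m (Suc p)))"
    \<comment> \<open>Variable \<open>j\<close> receives entry \<open>j\<close> of the four numerals
      written one after another, in line with the four blocks of \<open>m\<close> variables.\<close>
    let ?g = "nth (bits m t @ bits m (Suc t) @ bits m p @ bits m (Suc p))"
    have block: "map (?\<rho> ?g) [0..<m] = bits m t" "map (?\<rho> ?g) [m..<2 * m] = bits m (Suc t)"
      "map (?\<rho> ?g) [2 * m..<3 * m] = bits m p" "map (?\<rho> ?g) [3 * m..<4 * m] = bits m (Suc p)"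
      by (intro nth_equalityI; auto simp: nth_append)+
    have "map (map_clause (rename_args (?\<rho> ?g)))
        (computation_clauses M x ?K [0..<m] [m..<2 * m] [2 * m..<3 * m] [3 * m..<4 * m]) =
      computation_clauses M x 0 (bits m t) (bits m (Suc t)) (bits m p) (bits m (Suc p))"
      unfolding map_computation_clauses block ..
    with c have "c \<in> map_clause (rename_args (?\<rho> ?g)) ` set
        (computation_clauses M x ?K [0..<m] [m..<2 * m] [2 * m..<3 * m] [3 * m..<4 * m])"
      by (metis image_set)
    then obtain c' where
      "c' \<in> set (computation_clauses M x ?K [0..<m] [m..<2 * m] [2 * m..<3 * m] [3 * m..<4 * m])"
      "c = map_clause (rename_args (?\<rho> ?g)) c'" by blast
    then show "entails L H (clause_matrix c)"
      using D[of c' ?g] by (simp add: exptime_clauses_def)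
  qed (use N accept in auto)
  then show ?thesis by (simp only: H_def)
qed

end

section \<open>Programs writing the instances\<close>

text \<open>\<open>kR\<close> holds the number of quantifiers, which is also the index of free
  variable 0, and \<open>k1R\<close> the index of free variable 1. \<open>nR\<close> holds the bound
  or digit count, \<open>m2R\<close> and \<open>m3R\<close> two and three times it, where blocks of
  quantified variables end. \<open>hR\<close> and \<open>h1R\<close> hold the names of an input
  position and its successor.\<close>

datatype reg = zeroR | oneR | varR | prefR | baseR | accR | iR | jR | nR | m2R | m3R | kR | k1R
  | tR | t1R | pR | p1R | hR | h1R

instance reg :: finite
proof
  let ?R = "{zeroR, oneR, varR, prefR, baseR, accR, iR, jR, nR, m2R, m3R, kR, k1R, tR, t1R, pR, p1R, hR, h1R}"
  have "r \<in> ?R" for r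
    by (cases r) simp_all
  then have "UNIV \<subseteq> ?R" by blast
  then show "finite (UNIV :: reg set)" by (rule finite_subset) simp
qed

type_synonym block = "(reg \<times> reg \<times> reg) list"

definition seqs :: "'r com list \<Rightarrow> 'r com" where
  "seqs cs = foldr Seq cs Skip"

definition emits :: "bool list \<Rightarrow> 'r com" where
  "emits bs = seqs (map Emit bs)"

text \<open>The final reset gives back the state at entry. Emitting programs thereby leave the state
  unchanged and their correctness is a matter of output alone.\<close>

definition For :: "reg \<Rightarrow> reg \<Rightarrow> reg \<Rightarrow> reg com \<Rightarrow> reg com" where
  "For r a b c = seqs [Copy r a, While r b (seqs [c, Inc r]), Copy r zeroR]"

definition With_Suc :: "reg \<Rightarrow> reg \<Rightarrow> reg com \<Rightarrow> reg com" where
  "With_Suc r s c = seqs [Copy r s, Inc r, c, Copy r zeroR]"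

text \<open>
  A block \<open>(c, a, b)\<close> stands for the variables whose indices are the values of \<open>c\<close> while \<open>varR\<close> runs from
  the value of \<open>a\<close> to that of \<open>b\<close>: an interval if \<open>c\<close> is \<open>varR\<close>, a repeated variable otherwise.
\<close>

definition emit_vars :: "reg \<times> reg \<times> reg \<Rightarrow> reg com" where
  "emit_vars = (\<lambda>(c, a, b). For varR a b (seqs [emits [True, False], Print c]))"

definition emit_atom :: "pred \<times> block list \<Rightarrow> reg com" where
  "emit_atom = (\<lambda>(P, bs). seqs ([emits ([False, True, False] @ enc_nat (to_nat P))] @
     map emit_vars (concat bs) @ [Emit False]))"

definition emit_clause :: "block clause \<Rightarrow> reg com" where
  "emit_clause = (\<lambda>(As, B). seqs ([Emit True, For prefR zeroR kR (emits [True, True, False])] @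
     map (\<lambda>a. seqs [emits [True, False, True], emit_atom a]) As @
     [case B of None \<Rightarrow> emits [False, False, True] | Some b \<Rightarrow> emit_atom b]))"

definition single :: "reg \<Rightarrow> block" where
  "single r = [(r, zeroR, oneR)]"

definition emit_input_clauses :: "block \<Rightarrow> block \<Rightarrow> block \<Rightarrow> reg com" where
  "emit_input_clauses t p p' = With_Suc h1R hR
     (Branch (\<lambda>a. seqs (map emit_clause (input_clauses (single hR) (single h1R) t p p' a))))"

text \<open>\<open>hR\<close> advances together with the input head. The loop stops on reaching the
  right end marker, before its body runs there, so the clauses for that position are emitted once
  more after it.\<close>

definition emit_computation :: "machine \<Rightarrow> block \<Rightarrow> block \<Rightarrow> block \<Rightarrow> block \<Rightarrow> reg com" where
  "emit_computation M t t' p p' =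
     seqs (map emit_clause (run_clauses M (single kR) t t' p p') @
       [Copy hR kR,
        Until Right_End (seqs [emit_input_clauses t p p', Inc hR, Head Go_Right]),
        emit_input_clauses t p p',
        Until Left_End (Head Go_Left),
        Copy hR zeroR])"

text \<open>Multiplication by repeated increment: \<open>accR\<close> collects \<open>nR\<close>
  times \<open>baseR\<close>. Only space is limited, so counting by ones is affordable.\<close>

primrec power_prog :: "nat \<Rightarrow> reg com" where
  "power_prog 0 = Inc nR"
| "power_prog (Suc e) = seqs [power_prog e,
     While iR nR (seqs [While jR baseR (seqs [Inc accR, Inc jR]), Copy jR zeroR, Inc iR]),
     Copy iR zeroR, Copy nR accR, Copy accR zeroR]"

text \<open>The loop counts the left end marker and the bits of the input, and one more increment
  makes \<open>baseR\<close> the input length plus 2. A base of at least 2, even for empty input,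
  lets constant factors be absorbed by the exponent.\<close>

definition prepare :: "nat \<Rightarrow> reg com" where
  "prepare e = seqs [Inc oneR,
     Until Right_End (seqs [Inc baseR, Head Go_Right]),
     Inc baseR,
     Until Left_End (Head Go_Left),
     power_prog e]"

definition prepare_blocks :: "reg com" where
  "prepare_blocks = seqs [
     While iR nR (seqs (replicate 2 (Inc m2R) @ replicate 3 (Inc m3R) @ replicate 4 (Inc kR) @ [Inc iR])),
     Copy iR zeroR, Copy k1R kR, Inc k1R]"

definition ptime_prog :: "machine \<Rightarrow> nat \<Rightarrow> reg com" where
  "ptime_prog M e = seqs [prepare e,
     emit_clause ([], Some (Zero, [single zeroR])),
     For tR zeroR nR (With_Suc t1R tR (seqs [
       emit_clause ([], Some (Succ, [single tR, single t1R])),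
       For pR zeroR nR (With_Suc p1R pR
         (emit_computation M (single tR) (single t1R) (single pR) (single p1R)))])),
     Emit False]"

definition exptime_prog :: "machine \<Rightarrow> nat \<Rightarrow> reg com" where
  "exptime_prog M e = seqs [prepare e, prepare_blocks,
     emit_clause ([], Some (Zero, [[(kR, zeroR, nR)]])),
     For iR zeroR nR (With_Suc jR iR (emit_clause ([], Some (Succ,
       [[(varR, zeroR, iR), (kR, zeroR, oneR), (k1R, jR, nR)],
        [(varR, zeroR, iR), (k1R, zeroR, oneR), (kR, jR, nR)]])))),
     emit_computation M [(varR, zeroR, nR)] [(varR, nR, m2R)] [(varR, m2R, m3R)] [(varR, m3R, kR)],
     Emit False]"

fun vars_val :: "(reg \<Rightarrow> nat) \<Rightarrow> reg \<times> reg \<times> reg \<Rightarrow> nat list" where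
  "vars_val \<sigma> (c, a, b) = map (\<lambda>v. (\<sigma>(varR := v)) c) [\<sigma> a..<\<sigma> b]"

definition block_val :: "(reg \<Rightarrow> nat) \<Rightarrow> block \<Rightarrow> nat list" where
  "block_val \<sigma> bs = concat (map (vars_val \<sigma>) bs)"

text \<open>The leading \<open>True\<close> is the continuation flag of \<open>enc_list\<close>, so
  an encoded instance is a concatenation of such pieces closed by \<open>False\<close>.\<close>

definition emitted :: "nat \<Rightarrow> nat list clause \<Rightarrow> bool list" where
  "emitted K c = True # enc_fm (horn K c)"

text \<open>The clause lists contain only arguments handed to them, so conditions on all emitted
  variables reduce to conditions on a few register blocks.\<close>

fun clause_args :: "'b clause \<Rightarrow> 'b set" where
  "clause_args (As, B) = (\<Union>a \<in> set As \<union> set_option B. set (snd a))"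

lemma concat_map_Nil [simp]: "concat (map (\<lambda>_. []) xs) = []"
  by (induction xs) simp_all

lemma move_clauses_args:
  "c \<in> set (move_clauses j As t t' p p' d) \<Longrightarrow> clause_args c \<subseteq> (\<Union>a \<in> set As. set (snd a)) \<union> {t, t', p, p'}"
  by (cases d) auto

lemma action_clauses_args:
  assumes "c \<in> set (action_clauses M t t' p p' a)"
  shows "clause_args c \<subseteq> {t, t', p, p'}"
proof -
  obtain q ss where a: "a = (q, ss)" by (cases a)
  obtain q' ws where act: "action M q ss = (q', ws)" by (cases "action M q ss")
  let ?As = "[(Act q ss, [t]), (Succ, [t, t'])]"
  from assms consider
    "c = ((St q, [t]) # map (\<lambda>j. (Rd j (ss ! j), [t])) [0..<Suc (work_tapes M)], Some (Act q ss, [t]))"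
    | "c = (?As, Some (St q', [t']))"
    | j where "c = (?As @ [(Hd j, [t, p])], Some (Cell j (fst (ws ! j)), [t', p]))"
    | j where "c \<in> set (move_clauses j ?As t t' p p' (snd (ws ! j)))"
    unfolding action_clauses_def a by (auto simp: act Let_def less_Suc_eq_le simp del: upt_Suc move_clauses.simps)
  then show ?thesis
  proof cases
    case 4
    then show ?thesis using move_clauses_args by fastforce
  qed (auto simp del: upt_Suc)
qed

lemma tape_clauses_args:
  "c \<in> set (tape_clauses M t t' p p' j) \<Longrightarrow> clause_args c \<subseteq> {t, t', p, p'}"
  by (auto simp: tape_clauses_def cell_clauses_def split: if_splits)

lemma run_clauses_args:
  assumes "c \<in> set (run_clauses M z t t' p p')"
  shows "clause_args c \<subseteq> {z, t, t', p, p'}"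
proof -
  from assms consider "c \<in> {([(Zero, [t])], Some (St (start M), [t])),
      ([(Zero, [p])], Some (Inp, [z, p])), ([(St (accept M), [t])], None)}"
    | j where "c \<in> set (tape_clauses M t t' p p' j)"
    | a where "c \<in> set (action_clauses M t t' p p' a)"
    unfolding run_clauses_def by (auto simp del: upt_Suc n_lists.simps)
  then show ?thesis
  proof cases
    case 1
    then show ?thesis by auto
  qed (auto dest: tape_clauses_args action_clauses_args)
qed

lemma input_clauses_args:
  "c \<in> set (input_clauses i i' t p p' a) \<Longrightarrow> clause_args c \<subseteq> {i, i', t, p, p'}"
  by (auto simp: input_clauses_def)

section \<open>Correctness of the emitting programs\<close>

context
  fixes x :: "bool list" and B :: nat
begin

lemma exec_seqs_Nil: "exec x B (seqs []) s s []"
  by (simp add: seqs_def exec_Skip)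

lemma exec_seqs_Cons:
  "exec x B c s s' o1 \<Longrightarrow> exec x B (seqs cs) s' s'' o2 \<Longrightarrow> exec x B (seqs (c # cs)) s s'' (o1 @ o2)"
  by (simp add: seqs_def exec_Seq)

lemma exec_seqs_Cons_silent:
  "exec x B c s s' [] \<Longrightarrow> exec x B (seqs cs) s' s'' o2 \<Longrightarrow> exec x B (seqs (c # cs)) s s'' o2"
  using exec_seqs_Cons[of c s s' "[]" cs s'' o2] by simp

lemma exec_rewind: "exec x B (Until Left_End (Head Go_Left)) (\<sigma>, length x + 1) (\<sigma>, 0) []"
proof -
  have "exec x B (Head Go_Left) (\<sigma>, length x + 1 - v) (\<sigma>, length x + 1 - Suc v) []" if "v < length x + 1" for v
    using exec_Head[of x B Go_Left \<sigma> "length x + 1 - v"] that by (simp add: min_absorb1)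
  then have "exec x B (Until Left_End (Head Go_Left)) (\<sigma>, length x + 1 - 0) (\<sigma>, length x + 1 - (length x + 1))
      (concat (map (\<lambda>_. []) [0..<length x + 1]))"
    by (intro exec_Until[where \<sigma> = "\<lambda>_. \<sigma>" and h = "\<lambda>v. length x + 1 - v"]) (auto simp: scan_def)
  then show ?thesis by simp
qed

lemma exec_seqs_append:
  assumes "\<And>c. c \<in> set cs \<Longrightarrow> exec x B (f c) s s (out_of c)" and "exec x B (seqs ds) s s' o2"
  shows "exec x B (seqs (map f cs @ ds)) s s' (concat (map out_of cs) @ o2)"
  using assms(1)
proof (induction cs)
  case Nil
  then show ?case using assms(2) by simp
next
  case (Cons c cs)
  then show ?case using exec_seqs_Cons[of "f c" s s "out_of c"] by simp
qed

lemma exec_emits: "exec x B (emits bs) s s bs"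
  using exec_seqs_append[where f = Emit and out_of = "\<lambda>b. [b]", OF exec_Emit exec_seqs_Nil, of bs s]
  by (simp add: emits_def)

lemma exec_For:
  assumes "\<sigma> r = 0" "\<sigma> zeroR = 0" "r \<noteq> zeroR" "r \<noteq> b" "\<sigma> a \<le> \<sigma> b" "\<sigma> b < 2 ^ B"
    and "\<And>v. \<sigma> a \<le> v \<Longrightarrow> v < \<sigma> b \<Longrightarrow> exec x B c (\<sigma>(r := v), h) (\<sigma>(r := v), h) (os v)"
  shows "exec x B (For r a b c) (\<sigma>, h) (\<sigma>, h) (concat (map os [\<sigma> a..<\<sigma> b]))"
proof -
  have body: "exec x B (seqs [c, Inc r]) (\<sigma>(r := v), h) (\<sigma>(r := Suc v), h) (os v)"
    if "\<sigma> a \<le> v" "v < \<sigma> b" for v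
    using exec_seqs_Cons[OF assms(7)[OF that] exec_seqs_Cons[OF exec_Inc[where r = r] exec_seqs_Nil]] that assms(6) by simp
  have "exec x B (While r b (seqs [c, Inc r])) (\<sigma>(r := \<sigma> a), h) (\<sigma>(r := \<sigma> b), h)
      (concat (map os [\<sigma> a..<\<sigma> b]))"
    using exec_While[of "\<sigma> a" "\<sigma> b" "\<lambda>v. \<sigma>(r := v)" r b x B "seqs [c, Inc r]" h os] body assms(4,5) by simp
  from exec_seqs_Cons[OF this exec_seqs_Cons[OF exec_Copy exec_seqs_Nil], of r zeroR]
  have "exec x B (seqs [While r b (seqs [c, Inc r]), Copy r zeroR]) (\<sigma>(r := \<sigma> a), h) (\<sigma>, h)
      (concat (map os [\<sigma> a..<\<sigma> b]))"
    using assms(1-3) by (simp add: fun_upd_idem)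
  from exec_seqs_Cons_silent[OF exec_Copy this] show ?thesis by (simp add: For_def)
qed

lemma exec_With_Suc:
  assumes "\<sigma> r = 0" "\<sigma> zeroR = 0" "r \<noteq> zeroR" "Suc (\<sigma> s) < 2 ^ B"
    and "exec x B c (\<sigma>(r := Suc (\<sigma> s)), h) (\<sigma>(r := Suc (\<sigma> s)), h) o1"
  shows "exec x B (With_Suc r s c) (\<sigma>, h) (\<sigma>, h) o1"
proof -
  from exec_seqs_Cons[OF assms(5) exec_seqs_Cons[OF exec_Copy exec_seqs_Nil], of r zeroR]
  have "exec x B (seqs [c, Copy r zeroR]) (\<sigma>(r := Suc (\<sigma> s)), h) (\<sigma>, h) o1"
    using assms(1-3) by (simp add: fun_upd_idem)
  moreover have "exec x B (Inc r) (\<sigma>(r := \<sigma> s), h) (\<sigma>(r := Suc (\<sigma> s)), h) []"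
    using exec_Inc[of "\<sigma>(r := \<sigma> s)" r] assms(4) by simp
  ultimately have "exec x B (seqs [Inc r, c, Copy r zeroR]) (\<sigma>(r := \<sigma> s), h) (\<sigma>, h) o1"
    by (metis exec_seqs_Cons_silent)
  from exec_seqs_Cons_silent[OF exec_Copy this] show ?thesis by (simp only: With_Suc_def)
qed

definition base_ok :: "(reg \<Rightarrow> nat) \<Rightarrow> bool" where
  "base_ok \<sigma> \<longleftrightarrow> \<sigma> zeroR = 0 \<and> \<sigma> oneR = 1 \<and> \<sigma> varR = 0 \<and> \<sigma> prefR = 0 \<and> \<sigma> kR < 2 ^ B"

fun vars_ok :: "(reg \<Rightarrow> nat) \<Rightarrow> reg \<times> reg \<times> reg \<Rightarrow> bool" where
  "vars_ok \<sigma> (c, a, b) \<longleftrightarrow> b \<noteq> varR \<and> \<sigma> a \<le> \<sigma> b \<and> \<sigma> b < 2 ^ B"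

abbreviation enc_vars :: "nat list \<Rightarrow> bool list" where
  "enc_vars vs \<equiv> concat (map (\<lambda>i. [True, False] @ enc_nat i) vs)"

lemma exec_emit_vars:
  assumes "base_ok \<sigma>" "vars_ok \<sigma> v"
  shows "exec x B (emit_vars v) (\<sigma>, h) (\<sigma>, h) (enc_vars (vars_val \<sigma> v))"
proof -
  obtain c a b where v: "v = (c, a, b)" by (cases v)
  have "exec x B (seqs [emits [True, False], Print c]) (\<sigma>(varR := i), h) (\<sigma>(varR := i), h)
      ([True, False] @ enc_nat ((\<sigma>(varR := i)) c))" for i
    using exec_seqs_Cons[OF exec_emits exec_seqs_Cons[OF exec_Print exec_seqs_Nil],
      of "[True, False]" c "\<sigma>(varR := i)" h] by simp
  then have "exec x B (emit_vars v) (\<sigma>, h) (\<sigma>, h)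
      (concat (map (\<lambda>i. [True, False] @ enc_nat ((\<sigma>(varR := i)) c)) [\<sigma> a..<\<sigma> b]))"
    using assms unfolding v emit_vars_def prod.case by (intro exec_For) (auto simp: base_ok_def)
  then show ?thesis by (simp add: v comp_def)
qed

lemma exec_emit_atom:
  assumes "base_ok \<sigma>" "\<And>bs v. bs \<in> set (snd a) \<Longrightarrow> v \<in> set bs \<Longrightarrow> vars_ok \<sigma> v"
  shows "exec x B (emit_atom a) (\<sigma>, h) (\<sigma>, h)
    (enc_fm (mk_atom (fst a, map (block_val \<sigma>) (snd a))))"
proof -
  obtain P bss where a: "a = (P, bss)" by (cases a)
  have blocks: "enc_vars (concat (map (block_val \<sigma>) bss)) = concat (map (\<lambda>v. enc_vars (vars_val \<sigma> v)) (concat bss))"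
  proof (induction bss)
    case (Cons bs bss)
    have "enc_vars (block_val \<sigma> bs) = concat (map (\<lambda>v. enc_vars (vars_val \<sigma> v)) bs)"
      by (induction bs) (auto simp: block_val_def simp del: vars_val.simps)
    then show ?case using Cons by simp
  qed simp
  have "exec x B (seqs (map emit_vars (concat bss) @ [Emit False])) (\<sigma>, h) (\<sigma>, h)
      (concat (map (\<lambda>v. enc_vars (vars_val \<sigma> v)) (concat bss)) @ [False])"
    using assms exec_seqs_Cons[OF exec_Emit exec_seqs_Nil]
    by (intro exec_seqs_append exec_emit_vars) (auto simp: a)
  from exec_seqs_Cons[OF exec_emits this, of "[False, True, False] @ enc_nat (to_nat P)"] show ?thesis
    unfolding emit_atom_def a blocks[symmetric] by (simp add: enc_list_def comp_def)
qed

lemma enc_Alls: "enc_fm ((All ^^ K) A) = concat (replicate K [True, True, False]) @ enc_fm A"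
  by (induction K) auto

lemma enc_foldr: "enc_fm (foldr Imp As A) = concat (map (\<lambda>A. [True, False, True] @ enc_fm A) As) @ enc_fm A"
  by (induction As) auto

lemma exec_emit_clause:
  assumes ok: "base_ok \<sigma>" and args: "\<And>bs v. bs \<in> clause_args c \<Longrightarrow> v \<in> set bs \<Longrightarrow> vars_ok \<sigma> v"
  shows "exec x B (emit_clause c) (\<sigma>, h) (\<sigma>, h)
    (emitted (\<sigma> kR) (map_clause (\<lambda>_. map (block_val \<sigma>)) c))"
proof -
  obtain As A where c: "c = (As, A)" by (cases c)
  let ?atom = "\<lambda>a. enc_fm (mk_atom (fst a, map (block_val \<sigma>) (snd a)))"
  have atom: "exec x B (emit_atom a) (\<sigma>, h) (\<sigma>, h) (?atom a)" if "a \<in> set As \<union> set_option A" for a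
  proof (rule exec_emit_atom[OF ok])
    fix bs v assume "bs \<in> set (snd a)" "v \<in> set bs"
    then show "vars_ok \<sigma> v" using that by (intro args[of bs]) (auto simp: c)
  qed
  have "exec x B (case A of None \<Rightarrow> emits [False, False, True] | Some b \<Rightarrow> emit_atom b) (\<sigma>, h) (\<sigma>, h)
      (case A of None \<Rightarrow> [False, False, True] | Some b \<Rightarrow> ?atom b)"
    using exec_emits atom by (cases A) auto
  note last = exec_seqs_Cons[OF this exec_seqs_Nil]
  have premise: "exec x B (seqs [emits [True, False, True], emit_atom a]) (\<sigma>, h) (\<sigma>, h) ([True, False, True] @ ?atom a)"
    if "a \<in> set As" for a
  proof -
    have "exec x B (emit_atom a) (\<sigma>, h) (\<sigma>, h) (?atom a)" using atom that by simp
    from exec_seqs_Cons[OF exec_emits exec_seqs_Cons[OF this exec_seqs_Nil], of "[True, False, True]"]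
    show ?thesis by (simp only: append_Nil2)
  qed
  have rest: "exec x B (seqs (map (\<lambda>a. seqs [emits [True, False, True], emit_atom a]) As @
      [case A of None \<Rightarrow> emits [False, False, True] | Some b \<Rightarrow> emit_atom b])) (\<sigma>, h) (\<sigma>, h)
      (concat (map (\<lambda>a. [True, False, True] @ ?atom a) As) @
        (case A of None \<Rightarrow> [False, False, True] | Some b \<Rightarrow> ?atom b))"
    using exec_seqs_append[where f = "\<lambda>a. seqs [emits [True, False, True], emit_atom a]", OF premise last]
    by (simp only: append_Nil2)
  have "exec x B (For prefR zeroR kR (emits [True, True, False])) (\<sigma>, h) (\<sigma>, h)
      (concat (map (\<lambda>_. [True, True, False]) [\<sigma> zeroR..<\<sigma> kR]))"
    using ok exec_emits by (intro exec_For) (auto simp: base_ok_def)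
  from exec_seqs_Cons[OF exec_Emit[of _ _ True] exec_seqs_Cons[OF this rest]]
  have "exec x B (emit_clause c) (\<sigma>, h) (\<sigma>, h) ([True] @
      concat (map (\<lambda>_. [True, True, False]) [\<sigma> zeroR..<\<sigma> kR]) @
      concat (map (\<lambda>a. [True, False, True] @ ?atom a) As) @
        (case A of None \<Rightarrow> [False, False, True] | Some b \<Rightarrow> ?atom b))"
    by (simp only: emit_clause_def c prod.case append_Cons append_Nil)
  moreover have "map (\<lambda>_. [True, True, False]) [\<sigma> zeroR..<\<sigma> kR] = replicate (\<sigma> kR) [True, True, False]"
    using ok by (simp add: map_replicate_const base_ok_def)
  ultimately show ?thesis
    by (cases A) (simp_all add: c emitted_def horn_def clause_matrix_def enc_Alls enc_foldr comp_def case_prod_unfold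
        del: mk_atom.simps)
qed

lemma exec_emit_clauses:
  assumes "base_ok \<sigma>" and "\<And>c bs v. c \<in> set cs \<Longrightarrow> bs \<in> clause_args c \<Longrightarrow> v \<in> set bs \<Longrightarrow> vars_ok \<sigma> v"
    and "exec x B (seqs ds) (\<sigma>, h) s' o2"
  shows "exec x B (seqs (map emit_clause cs @ ds)) (\<sigma>, h) s'
    (concat (map (emitted (\<sigma> kR)) (map (map_clause (\<lambda>_. map (block_val \<sigma>))) cs)) @ o2)"
  using exec_seqs_append[OF exec_emit_clause[OF assms(1)] assms(3), of cs] assms(2) by (simp add: comp_def)

text \<open>While the input is traversed, \<open>hR\<close> and \<open>h1R\<close> change; a block
  for a time or cell must keep its value meanwhile.\<close>

definition block_ok :: "(reg \<Rightarrow> nat) \<Rightarrow> block \<Rightarrow> nat list \<Rightarrow> bool" where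
  "block_ok \<sigma> bs V \<longleftrightarrow> (\<forall>u w. block_val (\<sigma>(hR := u, h1R := w)) bs = V \<and>
     (\<forall>v \<in> set bs. vars_ok (\<sigma>(hR := u, h1R := w)) v))"

lemma block_okD:
  assumes "block_ok \<sigma> bs V"
  shows "block_val (\<sigma>(hR := u, h1R := w)) bs = V"
    and "v \<in> set bs \<Longrightarrow> vars_ok (\<sigma>(hR := u, h1R := w)) v"
  using assms unfolding block_ok_def by (blast, blast)

lemma natural_block_val: "natural S (\<lambda>_. map (block_val \<sigma>)) (block_val \<sigma>)"
  by (simp add: natural_def)

lemma single_val: "base_ok \<sigma> \<Longrightarrow> r \<noteq> varR \<Longrightarrow> block_val \<sigma> (single r) = [\<sigma> r]"
  by (simp add: single_def block_val_def base_ok_def)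

lemma single_vars_ok: "base_ok \<sigma> \<Longrightarrow> 0 < B \<Longrightarrow> v \<in> set (single r) \<Longrightarrow> vars_ok \<sigma> v"
  using one_less_power[of "2 :: nat" B] by (simp add: single_def base_ok_def)

lemma exec_emit_input_clauses:
  assumes ok: "base_ok \<sigma>" and "block_ok \<sigma> t T" "block_ok \<sigma> p P" "block_ok \<sigma> p' P'"
    and "\<sigma> h1R = 0" "Suc k < 2 ^ B" and B: "0 < B"
  shows "exec x B (emit_input_clauses t p p') (\<sigma>(hR := k), h) (\<sigma>(hR := k), h)
    (concat (map (emitted (\<sigma> kR)) (input_clauses [k] [Suc k] T P P' (scan x h))))"
proof -
  let ?\<sigma> = "\<sigma>(hR := k, h1R := Suc k)"
  have ok': "base_ok ?\<sigma>" using ok by (simp add: base_ok_def)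
  have val: "block_val ?\<sigma> t = T" "block_val ?\<sigma> p = P" "block_val ?\<sigma> p' = P'"
    using assms(2-4) by (simp_all only: block_okD(1))
  have sing: "block_val ?\<sigma> (single hR) = [k]" "block_val ?\<sigma> (single h1R) = [Suc k]"
    using single_val[OF ok'] by auto
  have vals: "map (map_clause (\<lambda>_. map (block_val ?\<sigma>))) (input_clauses (single hR) (single h1R) t p p' a) =
      input_clauses [k] [Suc k] T P P' a" for a
    using map_input_clauses[OF natural_block_val, of ?\<sigma> "single hR" p "[k]" "single h1R" p' "[Suc k]" t a]
    by (simp add: val sing)
  have args: "vars_ok ?\<sigma> v" if "c \<in> set (input_clauses (single hR) (single h1R) t p p' a)"
    "bs \<in> clause_args c" "v \<in> set bs" for c a bs v
  proof -
    have "bs \<in> {single hR, single h1R, t, p, p'}" using input_clauses_args[OF that(1)] that(2) by (rule subsetD)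
    then show ?thesis
      using single_vars_ok[OF ok' B] block_okD(2)[OF assms(2)] block_okD(2)[OF assms(3)] block_okD(2)[OF assms(4)] that(3)
      by (elim insertE emptyE) (simp_all only:)
  qed
  let ?f = "\<lambda>a. seqs (map emit_clause (input_clauses (single hR) (single h1R) t p p' a))"
  let ?cs = "input_clauses (single hR) (single h1R) t p p' (scan x h)"
  have "exec x B (seqs (map emit_clause ?cs @ [])) (?\<sigma>, h) (?\<sigma>, h)
      (concat (map (emitted (?\<sigma> kR)) (map (map_clause (\<lambda>_. map (block_val ?\<sigma>))) ?cs)) @ [])"
    by (rule exec_emit_clauses[OF ok' _ exec_seqs_Nil]) (rule args)
  then have "exec x B (?f (scan x h)) (?\<sigma>, h) (?\<sigma>, h)
      (concat (map (emitted (\<sigma> kR)) (input_clauses [k] [Suc k] T P P' (scan x h))))"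
    
    by (simp only: vals append_Nil2 fun_upd_apply reg.distinct if_False)
  then have "exec x B (Branch ?f) (?\<sigma>, h) (?\<sigma>, h)
      (concat (map (emitted (\<sigma> kR)) (input_clauses [k] [Suc k] T P P' (scan x h))))"
    by (rule exec_Branch)
  then show ?thesis
    unfolding emit_input_clauses_def
    using exec_With_Suc[of "\<sigma>(hR := k)" h1R hR "Branch ?f" h] assms(5,6) ok by (simp add: base_ok_def)
qed

lemma exec_emit_computation:
  assumes ok: "base_ok \<sigma>" and "block_ok \<sigma> t T" "block_ok \<sigma> t' T'" "block_ok \<sigma> p P" "block_ok \<sigma> p' P'"
    and h: "\<sigma> hR = 0" "\<sigma> h1R = 0" "\<sigma> kR + length x + 3 < 2 ^ B" and B: "0 < B"
  shows "exec x B (emit_computation M t t' p p') (\<sigma>, 0) (\<sigma>, 0)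
    (concat (map (emitted (\<sigma> kR)) (computation_clauses M x (\<sigma> kR) T T' P P')))"
proof -
  have upd: "\<sigma>(hR := 0, h1R := 0) = \<sigma>" using h by (auto simp: fun_eq_iff)
  have val: "block_val \<sigma> t = T" "block_val \<sigma> t' = T'" "block_val \<sigma> p = P" "block_val \<sigma> p' = P'"
    by (fact assms(2-5)[THEN block_okD(1)[where \<sigma> = \<sigma> and u = 0 and w = 0, unfolded upd]])+
  have vok: "\<And>v. v \<in> set t \<Longrightarrow> vars_ok \<sigma> v" "\<And>v. v \<in> set t' \<Longrightarrow> vars_ok \<sigma> v"
      "\<And>v. v \<in> set p \<Longrightarrow> vars_ok \<sigma> v" "\<And>v. v \<in> set p' \<Longrightarrow> vars_ok \<sigma> v"
    by (fact assms(2-5)[THEN block_okD(2)[where \<sigma> = \<sigma> and u = 0 and w = 0, unfolded upd]])+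
  let ?K = "\<sigma> kR" and ?n = "length x"
  let ?out = "\<lambda>v. concat (map (emitted ?K) (input_clauses [?K + v] [?K + Suc v] T P P' (scan x v)))"
  have inp: "exec x B (emit_input_clauses t p p') (\<sigma>(hR := ?K + v), v) (\<sigma>(hR := ?K + v), v) (?out v)"
    if "v \<le> ?n + 1" for v
    using exec_emit_input_clauses[OF ok assms(2,4,5) h(2) _ B, of "?K + v" v] that h(3) by simp
  have "exec x B (seqs [emit_input_clauses t p p', Inc hR, Head Go_Right])
      (\<sigma>(hR := ?K + v), v) (\<sigma>(hR := ?K + Suc v), Suc v) (?out v)" if "v < ?n + 1" for v
  proof -
    have inc: "exec x B (Inc hR) (\<sigma>(hR := ?K + v), v) (\<sigma>(hR := ?K + Suc v), v) []"
      using exec_Inc[of "\<sigma>(hR := ?K + v)" hR B x v] that h(3) by simp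
    have right: "exec x B (Head Go_Right) (\<sigma>(hR := ?K + Suc v), v) (\<sigma>(hR := ?K + Suc v), Suc v) []"
      using exec_Head[of x B Go_Right "\<sigma>(hR := ?K + Suc v)" v] that by simp
    from exec_seqs_Cons[OF inp exec_seqs_Cons[OF inc exec_seqs_Cons[OF right exec_seqs_Nil]]] that
    show ?thesis by simp
  qed
  then have loop: "exec x B (Until Right_End (seqs [emit_input_clauses t p p', Inc hR, Head Go_Right]))
      (\<sigma>(hR := ?K), 0) (\<sigma>(hR := ?K + (?n + 1)), ?n + 1) (concat (map ?out [0..<?n + 1]))"
    using exec_Until[of 0 "?n + 1" x "\<lambda>v. v" Right_End B _ "\<lambda>v. \<sigma>(hR := ?K + v)" ?out]
    by (simp add: scan_def del: upt_Suc)
  have "exec x B (Copy hR zeroR) (\<sigma>(hR := ?K + (?n + 1)), 0) (\<sigma>, 0) []"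
    using exec_Copy[of x B hR zeroR "\<sigma>(hR := ?K + (?n + 1))" 0] ok h(1) by (simp add: base_ok_def fun_upd_idem)
  from exec_seqs_Cons_silent[OF exec_rewind exec_seqs_Cons_silent[OF this exec_seqs_Nil]]
  have "exec x B (seqs [Until Left_End (Head Go_Left), Copy hR zeroR])
      (\<sigma>(hR := ?K + (?n + 1)), ?n + 1) (\<sigma>, 0) []" .
  from exec_seqs_Cons_silent[OF exec_Copy[of x B hR kR \<sigma> 0] exec_seqs_Cons[OF loop exec_seqs_Cons[OF inp this]]]
  have "exec x B (seqs [Copy hR kR, Until Right_End (seqs [emit_input_clauses t p p', Inc hR, Head Go_Right]),
        emit_input_clauses t p p', Until Left_End (Head Go_Left), Copy hR zeroR]) (\<sigma>, 0) (\<sigma>, 0)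
      (concat (map ?out [0..<?n + 1]) @ ?out (?n + 1))"
    by simp
  also have "concat (map ?out [0..<?n + 1]) @ ?out (?n + 1) = concat (map ?out [0..<?n + 2])"
    by simp
  finally have tail: "exec x B (seqs [Copy hR kR, Until Right_End (seqs [emit_input_clauses t p p', Inc hR, Head Go_Right]),
        emit_input_clauses t p p', Until Left_End (Head Go_Left), Copy hR zeroR]) (\<sigma>, 0) (\<sigma>, 0)
      (concat (map ?out [0..<?n + 2]))" .
  have "block_val \<sigma> (single kR) = [?K]" by (rule single_val[OF ok]) simp
  then have vals: "map (map_clause (\<lambda>_. map (block_val \<sigma>))) (run_clauses M (single kR) t t' p p') =
      run_clauses M [?K] T T' P P'"
    using map_run_clauses[OF natural_block_val, of \<sigma> "single kR" p "[?K]" M t t' p'] by (simp add: val)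
  have args: "vars_ok \<sigma> v" if "c \<in> set (run_clauses M (single kR) t t' p p')"
    "bs \<in> clause_args c" "v \<in> set bs" for c bs v
  proof -
    have "bs \<in> {single kR, t, t', p, p'}" using run_clauses_args[OF that(1)] that(2) by (rule subsetD)
    then show ?thesis
      using single_vars_ok[OF ok B] vok that(3) by (elim insertE emptyE) (simp_all only:)
  qed
  have "exec x B (emit_computation M t t' p p') (\<sigma>, 0) (\<sigma>, 0)
      (concat (map (emitted ?K) (map (map_clause (\<lambda>_. map (block_val \<sigma>))) (run_clauses M (single kR) t t' p p'))) @
        concat (map ?out [0..<?n + 2]))"
    unfolding emit_computation_def by (rule exec_emit_clauses[OF ok _ tail]) (rule args)
  moreover have "concat (map ?out is) = concat (map (emitted ?K) (concat (map (\<lambda>i.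
      input_clauses [?K + i] [?K + Suc i] T P P' (scan x i)) is)))" for "is"
    by (induction "is") auto
  ultimately show ?thesis by (simp only: vals computation_clauses_def map_append concat_append)
qed

end

section \<open>Preparation of the registers and the complete programs\<close>

context
  fixes x :: "bool list" and B :: nat
begin

lemma exec_eqI: "exec x B c s s' o1 \<Longrightarrow> s' = t \<Longrightarrow> o1 = o2 \<Longrightarrow> exec x B c s t o2"
  by simp

lemma exec_Incs:
  "\<sigma> r + k < 2 ^ B \<Longrightarrow> exec x B (seqs ds) (\<sigma>(r := \<sigma> r + k), h) s' o1 \<Longrightarrow>
    exec x B (seqs (replicate k (Inc r) @ ds)) (\<sigma>, h) s' o1"
proof (induction k arbitrary: \<sigma>)
  case (Suc k)
  have "exec x B (seqs (replicate k (Inc r) @ ds)) (\<sigma>(r := Suc (\<sigma> r)), h) s' o1"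
    by (rule Suc.IH) (use Suc.prems in \<open>simp_all add: fun_upd_same del: fun_upd_apply\<close>)
  from exec_seqs_Cons_silent[OF exec_Inc this] Suc.prems(1) show ?case by simp
qed simp

lemma exec_power_prog:
  assumes "\<sigma> zeroR = 0" "\<sigma> iR = 0" "\<sigma> jR = 0" "\<sigma> accR = 0" "\<sigma> nR = 0" "\<sigma> baseR = b"
    and b: "0 < b" "b < 2 ^ B" "b ^ e < 2 ^ B"
  shows "exec x B (power_prog e) (\<sigma>, h) (\<sigma>(nR := b ^ e), h) []"
  using b(3)
proof (induction e)
  case 0
  then show ?case
    unfolding power_prog.simps by (intro exec_eqI[OF exec_Inc]) (use assms(5) in \<open>auto simp: fun_eq_iff\<close>)
next
  case (Suc e)
  let ?N = "b ^ e"
  have le: "?N * b < 2 ^ B" using Suc.prems by (simp add: mult.commute)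
  have N: "?N \<le> ?N * b" using b(1) by simp
  let ?s = "\<lambda>v. \<sigma>(nR := ?N, iR := v, accR := v * b)"
  have inner: "exec x B (While jR baseR (seqs [Inc accR, Inc jR])) (?s v, h)
      (\<sigma>(nR := ?N, iR := v, accR := v * b + b, jR := b), h) []" if v: "v < ?N" for v
  proof -
    let ?u = "\<lambda>w. \<sigma>(nR := ?N, iR := v, accR := v * b + w, jR := w)"
    \<comment> \<open>The accumulator never exceeds the next power, so the size bound on the final
      result covers the whole loop.\<close>
    have "Suc v * b \<le> ?N * b" using v by (intro mult_le_mono1) simp
    then have small: "v * b + b < 2 ^ B" using le by simp
    have body: "exec x B (seqs [Inc accR, Inc jR]) (?u w, h) (?u (Suc w), h) []" if w: "w < b" for w
    proof -
      have "exec x B (Inc accR) (?u w, h) ((?u w)(accR := Suc (?u w accR)), h) []"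
        using w small by (intro exec_Inc) simp
      moreover have "exec x B (Inc jR) ((?u w)(accR := Suc (?u w accR)), h) (?u (Suc w), h) []"
        using w b(2) by (intro exec_eqI[OF exec_Inc]) (auto simp: fun_eq_iff)
      ultimately show ?thesis using exec_seqs_Cons_silent exec_seqs_Nil by blast
    qed
    have "exec x B (While jR baseR (seqs [Inc accR, Inc jR])) (?u 0, h) (?u b, h) (concat (map (\<lambda>_. []) [0..<b]))"
      by (rule exec_While[where \<sigma> = ?u]) (use body assms(6) in auto)
    moreover have "?u 0 = ?s v" using assms(3) by (auto simp: fun_eq_iff)
    ultimately show ?thesis by simp
  qed
  have body: "exec x B (seqs [While jR baseR (seqs [Inc accR, Inc jR]), Copy jR zeroR, Inc iR])
      (?s v, h) (?s (Suc v), h) []" if v: "v < ?N" for v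
  proof -
    have "exec x B (Copy jR zeroR) (\<sigma>(nR := ?N, iR := v, accR := v * b + b, jR := b), h) (\<sigma>(nR := ?N, iR := v, accR := v * b + b), h) []"
      by (intro exec_eqI[OF exec_Copy]) (use assms in \<open>auto simp: fun_eq_iff\<close>)
    moreover have "Suc v < 2 ^ B" using v le N by linarith
    then have "exec x B (Inc iR) (\<sigma>(nR := ?N, iR := v, accR := v * b + b), h) (?s (Suc v), h) []"
      by (intro exec_eqI[OF exec_Inc]) (auto simp: fun_eq_iff)
    ultimately show ?thesis using inner[OF v] exec_seqs_Cons_silent exec_seqs_Nil by blast
  qed
  have "exec x B (While iR nR (seqs [While jR baseR (seqs [Inc accR, Inc jR]), Copy jR zeroR, Inc iR]))
      (?s 0, h) (?s ?N, h) (concat (map (\<lambda>_. []) [0..<?N]))"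
    by (rule exec_While[where \<sigma> = ?s]) (use body in auto)
  moreover have "?s 0 = \<sigma>(nR := ?N)" using assms(2,4) by (auto simp: fun_eq_iff)
  ultimately have loop: "exec x B (While iR nR (seqs [While jR baseR (seqs [Inc accR, Inc jR]), Copy jR zeroR, Inc iR]))
      (\<sigma>(nR := ?N), h) (?s ?N, h) []" by simp
  have 1: "exec x B (Copy iR zeroR) (?s ?N, h) (\<sigma>(nR := ?N, accR := ?N * b), h) []"
    by (intro exec_eqI[OF exec_Copy]) (use assms in \<open>auto simp: fun_eq_iff\<close>)
  have 2: "exec x B (Copy nR accR) (\<sigma>(nR := ?N, accR := ?N * b), h) (\<sigma>(nR := ?N * b, accR := ?N * b), h) []"
    by (intro exec_eqI[OF exec_Copy]) (auto simp: fun_eq_iff)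
  have 3: "exec x B (Copy accR zeroR) (\<sigma>(nR := ?N * b, accR := ?N * b), h) (\<sigma>(nR := b ^ Suc e), h) []"
    by (intro exec_eqI[OF exec_Copy]) (use assms in \<open>auto simp: fun_eq_iff\<close>)
  have IH: "exec x B (power_prog e) (\<sigma>, h) (\<sigma>(nR := ?N), h) []"
    by (rule Suc.IH) (use N le in linarith)
  show ?case
    unfolding power_prog.simps(2)
    by (rule exec_seqs_Cons_silent[OF IH exec_seqs_Cons_silent[OF loop exec_seqs_Cons_silent[OF 1
      exec_seqs_Cons_silent[OF 2 exec_seqs_Cons_silent[OF 3 exec_seqs_Nil]]]]])
qed

definition prepared :: "nat \<Rightarrow> reg \<Rightarrow> nat" where
  "prepared N = (\<lambda>_. 0)(oneR := 1, baseR := length x + 2, nR := N)"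

lemma exec_prepare:
  assumes "0 < B" and "length x + 2 < 2 ^ B" and "(length x + 2) ^ e < 2 ^ B"
  shows "exec x B (prepare e) (\<lambda>_. 0, 0) (prepared ((length x + 2) ^ e), 0) []"
proof -
  let ?n = "length x" and ?z = "(\<lambda>_. 0) :: reg \<Rightarrow> nat"
  have 1: "exec x B (Inc oneR) (?z, 0) (?z(oneR := 1), 0) []"
    using exec_Inc[of ?z oneR B x 0] one_less_power[of "2 :: nat" B] assms(1) by simp
  have "exec x B (seqs [Inc baseR, Head Go_Right]) (?z(oneR := 1, baseR := v), v)
      (?z(oneR := 1, baseR := Suc v), Suc v) []" if v: "v < ?n + 1" for v
  proof -
    have "exec x B (Inc baseR) (?z(oneR := 1, baseR := v), v) (?z(oneR := 1, baseR := Suc v), v) []"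
      by (intro exec_eqI[OF exec_Inc]) (use v assms(2) in \<open>auto simp: fun_eq_iff\<close>)
    moreover have "exec x B (Head Go_Right) (?z(oneR := 1, baseR := Suc v), v) (?z(oneR := 1, baseR := Suc v), Suc v) []"
      by (intro exec_eqI[OF exec_Head]) (use v in auto)
    ultimately show ?thesis using exec_seqs_Cons_silent exec_seqs_Nil by blast
  qed
  then have "exec x B (Until Right_End (seqs [Inc baseR, Head Go_Right])) (?z(oneR := 1, baseR := 0), 0)
      (?z(oneR := 1, baseR := ?n + 1), ?n + 1) (concat (map (\<lambda>_. []) [0..<?n + 1]))"
    by (intro exec_Until[where \<sigma> = "\<lambda>v. ?z(oneR := 1, baseR := v)" and h = "\<lambda>v. v"])
      (auto simp: scan_def simp del: upt_Suc)
  moreover have "?z(oneR := 1, baseR := 0) = ?z(oneR := 1)" by (auto simp: fun_eq_iff)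
  ultimately have 2: "exec x B (Until Right_End (seqs [Inc baseR, Head Go_Right])) (?z(oneR := 1), 0)
      (?z(oneR := 1, baseR := ?n + 1), ?n + 1) []" by simp
  have 3: "exec x B (Inc baseR) (?z(oneR := 1, baseR := ?n + 1), ?n + 1) (?z(oneR := 1, baseR := ?n + 2), ?n + 1) []"
    by (intro exec_eqI[OF exec_Inc]) (use assms(2) in \<open>auto simp: fun_eq_iff\<close>)
  have 4: "exec x B (power_prog e) (?z(oneR := 1, baseR := ?n + 2), 0) (prepared ((?n + 2) ^ e), 0) []"
    unfolding prepared_def by (rule exec_power_prog) (use assms in simp_all)
  show ?thesis
    unfolding prepare_def
    by (rule exec_seqs_Cons_silent[OF 1 exec_seqs_Cons_silent[OF 2 exec_seqs_Cons_silent[OF 3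
      exec_seqs_Cons_silent[OF exec_rewind exec_seqs_Cons_silent[OF 4 exec_seqs_Nil]]]]])
qed

lemma exec_prepare_blocks:
  assumes "4 * N + 1 < 2 ^ B"
  shows "exec x B prepare_blocks (prepared N, 0)
    ((prepared N)(m2R := 2 * N, m3R := 3 * N, kR := 4 * N, k1R := 4 * N + 1), 0) []"
proof -
  let ?s = "\<lambda>v. (prepared N)(m2R := 2 * v, m3R := 3 * v, kR := 4 * v, iR := v)"
  have body: "exec x B (seqs (replicate 2 (Inc m2R) @ replicate 3 (Inc m3R) @ replicate 4 (Inc kR) @ [Inc iR]))
      (?s v, 0) (?s (Suc v), 0) []" if v: "v < N" for v
  proof (rule exec_Incs, use v assms in simp, rule exec_Incs, use v assms in simp, rule exec_Incs, use v assms in simp)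
    have "exec x B (Inc iR) ((?s v)(m2R := ?s v m2R + 2, m3R := ((?s v)(m2R := ?s v m2R + 2)) m3R + 3,
        kR := ((?s v)(m2R := ?s v m2R + 2, m3R := ((?s v)(m2R := ?s v m2R + 2)) m3R + 3)) kR + 4), 0)
        (?s (Suc v), 0) []"
      by (intro exec_eqI[OF exec_Inc]) (use v assms in \<open>auto simp: fun_eq_iff\<close>)
    from exec_seqs_Cons_silent[OF this exec_seqs_Nil]
    show "exec x B (seqs [Inc iR]) ((?s v)(m2R := ?s v m2R + 2, m3R := ((?s v)(m2R := ?s v m2R + 2)) m3R + 3,
        kR := ((?s v)(m2R := ?s v m2R + 2, m3R := ((?s v)(m2R := ?s v m2R + 2)) m3R + 3)) kR + 4), 0)
        (?s (Suc v), 0) []" .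
  qed
  have "exec x B (While iR nR (seqs (replicate 2 (Inc m2R) @ replicate 3 (Inc m3R) @ replicate 4 (Inc kR) @ [Inc iR])))
      (?s 0, 0) (?s N, 0) (concat (map (\<lambda>_. []) [0..<N]))"
    by (rule exec_While[where \<sigma> = ?s and h = 0]) (use body in \<open>auto simp: prepared_def\<close>)
  moreover have "?s 0 = prepared N" by (auto simp: fun_eq_iff prepared_def)
  ultimately have 1: "exec x B (While iR nR (seqs (replicate 2 (Inc m2R) @ replicate 3 (Inc m3R) @ replicate 4 (Inc kR) @ [Inc iR])))
      (prepared N, 0) (?s N, 0) []" by simp
  let ?t = "(prepared N)(m2R := 2 * N, m3R := 3 * N, kR := 4 * N)"
  have 2: "exec x B (Copy iR zeroR) (?s N, 0) (?t, 0) []"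
    by (intro exec_eqI[OF exec_Copy]) (auto simp: fun_eq_iff prepared_def)
  have 3: "exec x B (Copy k1R kR) (?t, 0) (?t(k1R := 4 * N), 0) []"
    by (intro exec_eqI[OF exec_Copy]) auto
  have 4: "exec x B (Inc k1R) (?t(k1R := 4 * N), 0) (?t(k1R := 4 * N + 1), 0) []"
    by (intro exec_eqI[OF exec_Inc]) (use assms in auto)
  show ?thesis
    unfolding prepare_blocks_def
    by (rule exec_seqs_Cons_silent[OF 1 exec_seqs_Cons_silent[OF 2 exec_seqs_Cons_silent[OF 3
      exec_seqs_Cons_silent[OF 4 exec_seqs_Nil]]]])
qed

text \<open>\<open>kR\<close> stays 0, so no quantifier is printed and the value of a register is
  directly the index of a free variable.\<close>

lemma exec_ptime_prog:
  fixes e :: nat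
  defines "N \<equiv> (length x + 2) ^ e"
  assumes B: "0 < B" "N + length x + 3 < 2 ^ B"
  shows "exec x B (ptime_prog M e) (\<lambda>_. 0, 0) (prepared N, 0)
    (enc_list enc_fm (map (horn 0) (ptime_clauses M x N)))"
proof -
  let ?p = "prepared N"
  have one: "1 < (2 :: nat) ^ B" using one_less_power[of "2 :: nat" B] B(1) by simp
  have body: "exec x B (With_Suc p1R pR (emit_computation M (single tR) (single t1R) (single pR) (single p1R)))
      (?p(tR := t, t1R := Suc t, pR := p), 0) (?p(tR := t, t1R := Suc t, pR := p), 0)
      (concat (map (emitted 0) (computation_clauses M x 0 [t] [Suc t] [p] [Suc p])))" if "p < N" for t p
  proof -
    let ?S = "?p(tR := t, t1R := Suc t, pR := p, p1R := Suc p)"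
    have "base_ok B ?S" by (simp add: base_ok_def prepared_def)
    moreover have "block_ok B ?S (single tR) [t]" "block_ok B ?S (single t1R) [Suc t]"
      "block_ok B ?S (single pR) [p]" "block_ok B ?S (single p1R) [Suc p]"
      using one by (simp_all add: block_ok_def single_def block_val_def prepared_def)
    moreover have "?S hR = 0" "?S h1R = 0" "?S kR = 0" by (simp_all add: prepared_def)
    moreover have "length x + 3 < 2 ^ B" using B(2) by simp
    ultimately have "exec x B (emit_computation M (single tR) (single t1R) (single pR) (single p1R)) (?S, 0) (?S, 0)
        (concat (map (emitted 0) (computation_clauses M x 0 [t] [Suc t] [p] [Suc p])))"
      using exec_emit_computation[of B ?S "single tR" "[t]" "single t1R" "[Suc t]" "single pR" "[p]" "single p1R" "[Suc p]" x M]
        B(1) by simp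
    then show ?thesis
      by (intro exec_With_Suc) (use that B(2) in \<open>simp_all add: prepared_def\<close>)
  qed
  have inner: "exec x B (For pR zeroR nR (With_Suc p1R pR (emit_computation M (single tR) (single t1R) (single pR) (single p1R))))
      (?p(tR := t, t1R := Suc t), 0) (?p(tR := t, t1R := Suc t), 0)
      (concat (map (\<lambda>p. concat (map (emitted 0) (computation_clauses M x 0 [t] [Suc t] [p] [Suc p]))) [0..<N]))" for t
    using exec_For[where \<sigma> = "?p(tR := t, t1R := Suc t)" and r = pR and a = zeroR and b = nR
      and os = "\<lambda>p. concat (map (emitted 0) (computation_clauses M x 0 [t] [Suc t] [p] [Suc p]))", OF _ _ _ _ _ _ body]
      B(2) by (simp add: prepared_def)
  have succ: "exec x B (emit_clause ([], Some (Succ, [single tR, single t1R])))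
      (?p(tR := t, t1R := Suc t), 0) (?p(tR := t, t1R := Suc t), 0) (emitted 0 ([], Some (Succ, [[t], [Suc t]])))" for t
    by (rule exec_eqI[OF exec_emit_clause])
      (use one in \<open>auto simp: base_ok_def prepared_def single_def block_val_def\<close>)
  have outer_body: "exec x B (With_Suc t1R tR (seqs [emit_clause ([], Some (Succ, [single tR, single t1R])),
       For pR zeroR nR (With_Suc p1R pR (emit_computation M (single tR) (single t1R) (single pR) (single p1R)))]))
      (?p(tR := t), 0) (?p(tR := t), 0)
      (concat (map (emitted 0) (([], Some (Succ, [[t], [Suc t]])) #
       concat (map (\<lambda>p. computation_clauses M x 0 [t] [Suc t] [p] [Suc p]) [0..<N]))))" if "t < N" for t
  proof (rule exec_With_Suc)
    have "concat (map (\<lambda>p. concat (map (emitted 0) (g p))) is) = concat (map (emitted 0) (concat (map g is)))"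
      for g :: "nat \<Rightarrow> nat list clause list" and "is" by (induction "is") auto
    then show "exec x B (seqs [emit_clause ([], Some (Succ, [single tR, single t1R])),
       For pR zeroR nR (With_Suc p1R pR (emit_computation M (single tR) (single t1R) (single pR) (single p1R)))])
      ((?p(tR := t))(t1R := Suc ((?p(tR := t)) tR)), 0) ((?p(tR := t))(t1R := Suc ((?p(tR := t)) tR)), 0)
      (concat (map (emitted 0) (([], Some (Succ, [[t], [Suc t]])) #
       concat (map (\<lambda>p. computation_clauses M x 0 [t] [Suc t] [p] [Suc p]) [0..<N]))))"
      using exec_seqs_Cons[OF succ exec_seqs_Cons[OF inner exec_seqs_Nil], of t] by simp
  qed (use that B(2) in \<open>simp_all add: prepared_def\<close>)
  let ?out = "\<lambda>t. ([], Some (Succ, [[t], [Suc t]])) #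
       concat (map (\<lambda>p. computation_clauses M x 0 [t] [Suc t] [p] [Suc p]) [0..<N])"
  have outer: "exec x B (For tR zeroR nR (With_Suc t1R tR (seqs [emit_clause ([], Some (Succ, [single tR, single t1R])),
       For pR zeroR nR (With_Suc p1R pR (emit_computation M (single tR) (single t1R) (single pR) (single p1R)))])))
      (?p, 0) (?p, 0) (concat (map (\<lambda>t. concat (map (emitted 0) (?out t))) [0..<N]))"
    using exec_For[where \<sigma> = ?p and r = tR and a = zeroR and b = nR
      and os = "\<lambda>t. concat (map (emitted 0) (?out t))", OF _ _ _ _ _ _ outer_body]
      B(2) by (simp add: prepared_def)
  have zero: "exec x B (emit_clause ([], Some (Zero, [single zeroR]))) (?p, 0) (?p, 0) (emitted 0 ([], Some (Zero, [[0]])))"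
    by (rule exec_eqI[OF exec_emit_clause])
      (use one in \<open>auto simp: base_ok_def prepared_def single_def block_val_def\<close>)
  have prep: "exec x B (prepare e) (\<lambda>_. 0, 0) (?p, 0) []"
    unfolding N_def by (rule exec_prepare) (use B N_def in simp_all)
  have "concat (map (\<lambda>t. concat (map (emitted 0) (g t))) is) = concat (map (emitted 0) (concat (map g is)))"
    for g :: "nat \<Rightarrow> nat list clause list" and "is" by (induction "is") auto
  note flat = this[of ?out "[0..<N]"]
  have enc: "enc_list enc_fm (map (horn 0) cs) = concat (map (emitted 0) cs) @ [False]" for cs
    by (simp add: enc_list_def emitted_def[abs_def] comp_def)
  show ?thesis
    using exec_seqs_Cons_silent[OF prep exec_seqs_Cons[OF zero exec_seqs_Cons[OF outer
      exec_seqs_Cons[OF exec_Emit[of _ _ False] exec_seqs_Nil]]]]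
    unfolding ptime_prog_def enc ptime_clauses_def flat by simp
qed

text \<open>The size bound has room for \<open>4 * N + length x + 2\<close>, the name of the
  position after the right end marker; no register gets larger.\<close>

lemma exec_exptime_prog:
  fixes e :: nat
  defines "N \<equiv> (length x + 2) ^ e"
  assumes B: "0 < B" "4 * N + length x + 3 < 2 ^ B"
  shows "\<exists>s. exec x B (exptime_prog M e) (\<lambda>_. 0, 0) s
    (enc_list enc_fm (map (horn (4 * N)) (exptime_clauses M x N)))"
proof -
  let ?p = "(prepared N)(m2R := 2 * N, m3R := 3 * N, kR := 4 * N, k1R := 4 * N + 1)"
  have one: "1 < (2 :: nat) ^ B" using one_less_power[of "2 :: nat" B] B(1) by simp
  have upt: "map (\<lambda>v. v) is = is" for "is" :: "nat list" by simp
  have ok: "base_ok B ?p" using B(2) by (simp add: base_ok_def prepared_def)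
  have bok: "block_ok B ?p [(varR, zeroR, nR)] [0..<N]" "block_ok B ?p [(varR, nR, m2R)] [N..<2 * N]"
    "block_ok B ?p [(varR, m2R, m3R)] [2 * N..<3 * N]" "block_ok B ?p [(varR, m3R, kR)] [3 * N..<4 * N]"
    using B(2) by (simp_all add: block_ok_def block_val_def prepared_def)
  have comp: "exec x B (emit_computation M [(varR, zeroR, nR)] [(varR, nR, m2R)] [(varR, m2R, m3R)] [(varR, m3R, kR)])
      (?p, 0) (?p, 0) (concat (map (emitted (4 * N)) (computation_clauses M x (4 * N)
        [0..<N] [N..<2 * N] [2 * N..<3 * N] [3 * N..<4 * N])))"
    using exec_emit_computation[OF ok bok _ _ _ B(1), of x M] B(2) by (simp add: prepared_def)
  let ?succ = "\<lambda>i. ([], Some (Succ, [[0..<i] @ [4 * N] @ replicate (N - Suc i) (Suc (4 * N)),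
        [0..<i] @ [Suc (4 * N)] @ replicate (N - Suc i) (4 * N)])) :: nat list clause"
  have "exec x B (With_Suc jR iR (emit_clause ([], Some (Succ,
       [[(varR, zeroR, iR), (kR, zeroR, oneR), (k1R, jR, nR)],
        [(varR, zeroR, iR), (k1R, zeroR, oneR), (kR, jR, nR)]]))))
      (?p(iR := i), 0) (?p(iR := i), 0) (emitted (4 * N) (?succ i))" if i: "i < N" for i
  proof (rule exec_With_Suc)
    show "exec x B (emit_clause ([], Some (Succ,
       [[(varR, zeroR, iR), (kR, zeroR, oneR), (k1R, jR, nR)],
        [(varR, zeroR, iR), (k1R, zeroR, oneR), (kR, jR, nR)]])))
      ((?p(iR := i))(jR := Suc ((?p(iR := i)) iR)), 0) ((?p(iR := i))(jR := Suc ((?p(iR := i)) iR)), 0)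
      (emitted (4 * N) (?succ i))"
      by (rule exec_eqI[OF exec_emit_clause])
        (use one i B(2) in \<open>auto simp: base_ok_def prepared_def block_val_def map_replicate_const\<close>)
  qed (use i B(2) in \<open>simp_all add: prepared_def\<close>)
  then have succs: "exec x B (For iR zeroR nR (With_Suc jR iR (emit_clause ([], Some (Succ,
       [[(varR, zeroR, iR), (kR, zeroR, oneR), (k1R, jR, nR)],
        [(varR, zeroR, iR), (k1R, zeroR, oneR), (kR, jR, nR)]])))))
      (?p, 0) (?p, 0) (concat (map (\<lambda>i. emitted (4 * N) (?succ i)) [0..<N]))"
    using exec_For[where \<sigma> = ?p and r = iR and a = zeroR and b = nR and os = "\<lambda>i. emitted (4 * N) (?succ i)"] B(2)
    by (simp add: prepared_def)
  have zero: "exec x B (emit_clause ([], Some (Zero, [[(kR, zeroR, nR)]]))) (?p, 0) (?p, 0)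
      (emitted (4 * N) ([], Some (Zero, [replicate N (4 * N)])))"
    by (rule exec_eqI[OF exec_emit_clause])
      (use B(2) in \<open>auto simp: base_ok_def prepared_def block_val_def map_replicate_const\<close>)
  have prep: "exec x B (prepare e) (\<lambda>_. 0, 0) (prepared N, 0) []"
    unfolding N_def by (rule exec_prepare) (use B N_def in simp_all)
  have blocks: "exec x B prepare_blocks (prepared N, 0) (?p, 0) []"
    by (rule exec_prepare_blocks) (use B(2) in simp)
  have enc: "enc_list enc_fm (map (horn K) cs) = concat (map (emitted K) cs) @ [False]" for K cs
    by (simp add: enc_list_def emitted_def[abs_def] comp_def)
  show ?thesis
    using exec_seqs_Cons_silent[OF prep exec_seqs_Cons_silent[OF blocks exec_seqs_Cons[OF zero exec_seqs_Cons[OF succs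
      exec_seqs_Cons[OF comp exec_seqs_Cons[OF exec_Emit[of _ _ False] exec_seqs_Nil]]]]]]
    unfolding exptime_prog_def enc exptime_clauses_def by (auto simp: comp_def)
qed

end

section \<open>Hardness\<close>

text \<open>A single power of \<open>n + 2\<close> dominates a polynomial running time together with
  the input length. The factor \<open>c + 1\<close> is at most \<open>(n + 2) ^ c\<close>, and three
  further powers give \<open>4 * (n + 2)\<close> for the remaining terms.\<close>

lemma power_bound:
  fixes n :: nat
  shows "c * n ^ d + c + n + 2 < (n + 2) ^ (d + c + 3)"
proof -
  define a where "a = (n + 2) ^ d"
  have a: "n ^ d \<le> a" "1 \<le> a" by (auto simp: a_def intro: power_mono)
  have "c < 2 ^ c" by simp
  also have "(2 :: nat) ^ c \<le> (n + 2) ^ c" by (intro power_mono) auto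
  finally have c: "c + 1 \<le> (n + 2) ^ c" by simp
  have "4 * (n + 2) \<le> (n + 2) ^ 3"
    using mult_mono[of 4 "(n + 2) * (n + 2)" "n + 2" "n + 2"] by (simp add: power3_eq_cube)
  then have "(c + 1) * (4 * (n + 2)) \<le> (n + 2) ^ c * (n + 2) ^ 3" using c by (intro mult_mono) auto
  then have le: "a * ((c + 1) * (4 * (n + 2))) \<le> (n + 2) ^ (d + c + 3)"
    by (simp add: a_def power_add mult.assoc)
  have "c * n ^ d + c * 1 + (n + 2) * 1 \<le> c * a + c * a + (n + 2) * a"
    by (intro add_mono mult_le_mono2 a)
  then have "c * n ^ d + c + n + 2 \<le> c * a + c * a + (n + 2) * a" by simp
  also have "\<dots> < a * ((c + 1) * (4 * (n + 2)))"
  proof -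
    have "2 * c + (n + 2) < (c + 1) * (4 * (n + 2))" by (simp add: algebra_simps)
    then have "a * (2 * c + (n + 2)) < a * ((c + 1) * (4 * (n + 2)))" using a(2) by (intro mult_strict_left_mono) simp_all
    moreover have "c * a + c * a + (n + 2) * a = a * (2 * c + (n + 2))" by (simp add: algebra_simps)
    ultimately show ?thesis by (simp only:)
  qed
  also note le
  finally show ?thesis .
qed

text \<open>The rounded logarithm is a number of bits sufficient for \<open>length x + 2\<close>, so
  \<open>e + 6\<close> times it is sufficient for the power \<open>e + 6\<close>. Of the six
  additional factors, each at least 2, five give 32 and the last one pays for the terms linear in
  the length.\<close>

definition register_bits :: "nat \<Rightarrow> bool list \<Rightarrow> nat" where
  "register_bits e x = (e + 6) * nat \<lceil>log 2 (real (length x + 2))\<rceil>"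

text \<open>With \<open>l\<close> the logarithm of \<open>length x + 1\<close>, passing to
  \<open>length x + 2\<close> and rounding up cost at most 1 each. This gives
  \<open>(e + 6) * (l + 2) + 1\<close>, whose constant part is \<open>2 * e + 13\<close>.\<close>

lemma register_bits_bound:
  "real (register_bits e x + 1) \<le> real (2 * e + 13) * log 2 (real (length x + 1)) + real (2 * e + 13)"
proof -
  define l where "l = log 2 (real (length x + 1))"
  have l: "0 \<le> l" by (simp add: l_def)
  have "log 2 (real (length x + 2)) \<le> log 2 (2 * real (length x + 1))" by simp
  also have "\<dots> = 1 + l" unfolding l_def by (subst log_mult) auto
  finally have "real (nat \<lceil>log 2 (real (length x + 2))\<rceil>) \<le> l + 2"
    using l by linarith
  then have "real (e + 6) * real (nat \<lceil>log 2 (real (length x + 2))\<rceil>) \<le> real (e + 6) * (l + 2)"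
    by (intro mult_left_mono) auto
  then have "real (register_bits e x + 1) \<le> real (e + 6) * (l + 2) + 1" by (simp add: register_bits_def)
  also have "\<dots> \<le> real (2 * e + 13) * l + real (2 * e + 13)"
    using mult_nonneg_nonneg[OF _ l, of "real (e + 7)"] by (simp add: algebra_simps)
  finally show ?thesis by (simp add: l_def)
qed

lemma register_bits_enough:
  "0 < register_bits e x" "4 * (length x + 2) ^ e + length x + 3 < 2 ^ register_bits e x"
proof -
  let ?n = "length x + 2"
  define l where "l = nat \<lceil>log 2 (real ?n)\<rceil>"
  have bits: "register_bits e x = (e + 6) * l" by (simp add: register_bits_def l_def)
  have "real ?n = 2 powr log 2 (real ?n)" by simp
  also have "\<dots> \<le> 2 powr real l" unfolding l_def by (intro powr_mono) linarith+
  also have "\<dots> = real (2 ^ l)" by (simp add: powr_realpow)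
  finally have n: "?n \<le> 2 ^ l" by (simp only: of_nat_le_iff)
  then show "0 < register_bits e x" by (cases l) (auto simp: bits)
  have 1: "1 \<le> ?n ^ e" by simp
  have "32 * ?n \<le> ?n ^ 6"
    using mult_le_mono[OF power_mono[of 2 ?n 5] le_refl[of ?n]] by (simp add: power_add[of _ 5 1, simplified] mult.commute)
  then have "?n ^ e * (32 * ?n) \<le> ?n ^ (e + 6)" by (simp add: power_add)
  also have "\<dots> \<le> (2 ^ l) ^ (e + 6)" by (intro power_mono n) simp
  also have "\<dots> = 2 ^ register_bits e x" by (simp add: bits power_mult[symmetric] mult.commute)
  finally have 2: "?n ^ e * (32 * ?n) \<le> 2 ^ register_bits e x" .
  have "4 * ?n ^ e + length x + 3 \<le> 4 * ?n ^ e + 2 * ?n * ?n ^ e" using mult_le_mono2[OF 1, of "2 * ?n"] by simp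
  also have "\<dots> < ?n ^ e * (32 * ?n)" using 1 by (simp add: algebra_simps)
  also note 2
  finally show "4 * ?n ^ e + length x + 3 < 2 ^ register_bits e x" .
qed

lemma ptime_reduction_computable:
  "logspace_computable (\<lambda>x. enc_list enc_fm (map (horn 0) (ptime_clauses M x ((length x + 2) ^ e))))"
proof (rule exec_logspace_computable[where prog = "ptime_prog M e" and B = "register_bits e"])
  show "\<exists>s. exec x (register_bits e x) (ptime_prog M e) (\<lambda>_. 0, 0) s
      (enc_list enc_fm (map (horn 0) (ptime_clauses M x ((length x + 2) ^ e))))" for x
    using exec_ptime_prog[where B = "register_bits e x" and x = x and e = e and M = M] register_bits_enough[where e = e and x = x]
    by fastforce
qed (rule register_bits_bound)

lemma exptime_reduction_computable:
  "logspace_computable (\<lambda>x. enc_list enc_fm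
    (map (horn (4 * (length x + 2) ^ e)) (exptime_clauses M x ((length x + 2) ^ e))))"
proof (rule exec_logspace_computable[where prog = "exptime_prog M e" and B = "register_bits e"])
  show "\<exists>s. exec x (register_bits e x) (exptime_prog M e) (\<lambda>_. 0, 0) s (enc_list enc_fm
    (map (horn (4 * (length x + 2) ^ e)) (exptime_clauses M x ((length x + 2) ^ e))))" for x
    by (rule exec_exptime_prog[OF register_bits_enough])
qed (rule register_bits_bound)

section \<open>The reductions\<close>

context
  fixes L :: "fm logic" and \<Sigma> :: "(nat \<times> nat) set"
  assumes logic: "is_logic L" and sub: "classical_sublogic \<Sigma> L"
begin

text \<open>The encoding is injective, so the list of formulas behind the string is the given
  one.\<close>

lemma HE_iff:
  "enc_list enc_fm (map (horn K) cs) \<in> HE L \<longleftrightarrow> entails L (set (map (horn K) cs)) Bot"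
  using horn_formulas[OF logic sub, of K cs] unfolding HE_def
  by (auto simp: enc_instance_inject universal_horn_horn simp del: set_map) (auto simp: universal_horn_horn)

lemma HE_bounded_iff:
  "enc_list enc_fm (map (horn 0) cs) \<in> HE_bounded L k \<longleftrightarrow> entails L (set (map (horn 0) cs)) Bot"
proof -
  have "(\<Sum>H \<in> set (map (horn 0) cs). quantifiers H) = 0"
    by (intro sum.neutral) (auto simp: quantifiers_horn)
  then show ?thesis
    using horn_formulas[OF logic sub, of 0 cs] unfolding HE_bounded_def
    by (auto simp: enc_instance_inject universal_horn_horn simp del: set_map) (auto simp: universal_horn_horn)
qed

text \<open>The instances contain no quantifier, so one reduction serves every \<open>k\<close>, and
  modus ponens alone derives falsity.\<close>

lemma HE_bounded_hard:
  assumes imp: "admits L imp_elim"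
  shows "hard_for PTime (HE_bounded L k)"
  unfolding hard_for_def
proof
  fix X assume X: "X \<in> PTime"
  obtain d M c where M: "is_machine M"
    and halt: "\<And>x. halted M (run M x (c * length x ^ d + c))"
    and dec: "\<And>x. x \<in> X \<longleftrightarrow> state (run M x (c * length x ^ d + c)) = accept M"
    using X by (auto simp: PTime_def Time_def Let_def)
  define N where "N = (\<lambda>x :: bool list. (length x + 2) ^ (d + c + 3))"
  define H where "H = (\<lambda>x. map (horn 0) (ptime_clauses M x (N x)))"
  have "x \<in> X \<longleftrightarrow> entails L (set (H x)) Bot" for x
  proof
    assume "x \<in> X"
    then have acc: "state (run M x (c * length x ^ d + c)) = accept M" using dec by simp
    have "length x + 1 < N x" "c * length x ^ d + c < N x"
      using power_bound[of c "length x" d] unfolding N_def by linarith+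
    from ptime_clauses_entail[OF logic sub imp M this acc] show "entails L (set (H x)) Bot"
      by (simp only: H_def)
  next
    assume "entails L (set (H x)) Bot"
    then have *: "classical (set (H x)) Bot" using sub unfolding classical_sublogic_def by blast
    show "x \<in> X"
    proof (rule ccontr)
      assume "x \<notin> X"
      then have "state (run M x (c * length x ^ d + c)) \<noteq> accept M" using dec by simp
      from ptime_clauses_unsat[OF M never_accepts[OF halt this], of "N x"] * show False
        by (simp only: H_def)
    qed
  qed
  moreover have "logspace_computable (\<lambda>x. enc_list enc_fm (H x))"
    unfolding H_def N_def by (rule ptime_reduction_computable)
  moreover have "enc_list enc_fm (H x) \<in> HE_bounded L k \<longleftrightarrow> entails L (set (H x)) Bot" for x
    unfolding H_def by (rule HE_bounded_iff)
  ultimately show "logspace_reducible X (HE_bounded L k)"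
    unfolding logspace_reducible_def by (intro exI[of _ "\<lambda>x. enc_list enc_fm (H x)"]) simp
qed

lemma HE_hard:
  assumes imp: "admits L imp_elim" and all: "admits L all_elim"
  shows "hard_for EXPTime (HE L)"
  unfolding hard_for_def
proof
  fix X assume X: "X \<in> EXPTime"
  obtain d M c where M: "is_machine M"
    and halt: "\<And>x. halted M (run M x (c * 2 ^ (length x ^ d) + c))"
    and dec: "\<And>x. x \<in> X \<longleftrightarrow> state (run M x (c * 2 ^ (length x ^ d) + c)) = accept M"
    using X by (auto simp: EXPTime_def Time_def Let_def)
  \<comment> \<open>As the number of binary digits, \<open>m x\<close> must exceed the logarithm of
    the running time. Applied to \<open>Suc c\<close>, \<open>power_bound\<close> makes it at least
    \<open>length x ^ d + c + length x + 3\<close>, so \<open>2 ^ m x\<close> is at least the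
    product of \<open>2 ^ (length x ^ d)\<close>, \<open>2 ^ c\<close>, \<open>2 ^ length x\<close>
    and 8.\<close>
  define m where "m = (\<lambda>x :: bool list. (length x + 2) ^ (d + Suc c + 3))"
  define H where "H = (\<lambda>x. map (horn (4 * m x)) (exptime_clauses M x (m x)))"
  have bound: "length x + 2 < 2 ^ m x" "Suc (c * 2 ^ (length x ^ d) + c) < 2 ^ m x" for x :: "bool list"
  proof -
    let ?n = "length x" and ?a = "(2 :: nat) ^ (length x ^ d)"
    have "length x ^ d + (c + ?n + 3) \<le> m x" using power_bound[of "Suc c" ?n d] by (simp add: m_def)
    then have le: "?a * (2 ^ c * (2 ^ ?n * 8)) \<le> 2 ^ m x"
      using power_increasing[of "?n ^ d + (c + ?n + 3)" "m x" "2 :: nat"] by (simp add: power_add)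
    have c: "c + 1 \<le> 2 ^ c" and n: "?n + 1 \<le> 2 ^ ?n" by (simp_all add: Suc_le_eq)
    have a: "1 \<le> ?a" by simp
    have "?n + 2 < 1 * (1 * (2 ^ ?n * 8))" using n by simp
    also have "\<dots> \<le> ?a * (2 ^ c * (2 ^ ?n * 8))" by (intro mult_le_mono) auto
    finally show "?n + 2 < 2 ^ m x" using le by simp
    have "c * 1 \<le> c * ?a" by (intro mult_le_mono2 a)
    moreover have "z * (c + 1) * 8 = 8 * (c * z) + 8 * z" for z :: nat by (simp add: algebra_simps)
    note this[of ?a]
    ultimately have "Suc (c * ?a + c) < ?a * (c + 1) * 8" using a by linarith
    also have "\<dots> = ?a * ((c + 1) * (1 * 8))" by (simp only: mult.assoc mult_1)
    also have "\<dots> \<le> ?a * (2 ^ c * (2 ^ ?n * 8))" using c by (intro mult_le_mono) auto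
    finally show "Suc (c * ?a + c) < 2 ^ m x" using le by simp
  qed
  have "x \<in> X \<longleftrightarrow> entails L (set (H x)) Bot" for x
  proof
    assume "x \<in> X"
    then have acc: "state (run M x (c * 2 ^ (length x ^ d) + c)) = accept M" using dec by simp
    from exptime_clauses_entail[OF logic sub imp all M bound acc] show "entails L (set (H x)) Bot"
      by (simp only: H_def)
  next
    assume "entails L (set (H x)) Bot"
    then have *: "classical (set (H x)) Bot" using sub unfolding classical_sublogic_def by blast
    show "x \<in> X"
    proof (rule ccontr)
      assume "x \<notin> X"
      then have "state (run M x (c * 2 ^ (length x ^ d) + c)) \<noteq> accept M" using dec by simp
      from exptime_clauses_unsat[OF M never_accepts[OF halt this], of "m x"] * show False
        by (simp only: H_def)
    qed
  qed
  moreover have "logspace_computable (\<lambda>x. enc_list enc_fm (H x))"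
    unfolding H_def m_def by (rule exptime_reduction_computable)
  moreover have "enc_list enc_fm (H x) \<in> HE L \<longleftrightarrow> entails L (set (H x)) Bot" for x
    unfolding H_def by (rule HE_iff)
  ultimately show "logspace_reducible X (HE L)"
    unfolding logspace_reducible_def by (intro exI[of _ "\<lambda>x. enc_list enc_fm (H x)"]) simp
qed

end

theorem theorem9p2:
  fixes L :: "fm logic" and \<Sigma> :: "(nat \<times> nat) set"
  assumes "is_logic L" and "classical_sublogic \<Sigma> L"
  shows "(admits L imp_elim \<and> admits L all_elim \<longrightarrow> hard_for EXPTime (HE L)) \<and>
         (admits L imp_elim \<longrightarrow> hard_for PTime (HE_bounded L 0)) \<and>
         (admits L imp_elim \<and> admits L all_elim \<longrightarrow> (\<forall>k. hard_for PTime (HE_bounded L k)))"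
  using HE_hard[OF assms] HE_bounded_hard[OF assms] by blast

end
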